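(* Let $\mathbb{K}$ be an algebraically closed field and let $n$ be a positive integer. Then the set $\{(I(\mathsf{MSV}^{\mathrm{ss}}_w),J^{\mathrm{ss}}_w): w\in\mathsf{Mat}^{\mathrm{ss}}_{n\times n}\}$ is a finite transition system in $\mathbb{K}[\mathsf{Mat}^{\mathrm{ss}}_{n\times n}]$, with respect to the reverse lexicographic term order.
   Context: $[k]=\{1,\dots,k\}$. A matrix $M$ is skew-symmetric if $M^\top=-M$ and all its diagonal entries are zero. $\mathsf{Mat}^{\mathrm{ss}}_{n\times n}$ is the affine variety of skew-symmetric $n\times n$ matrices over $\mathbb{K}$, and $M_{[i][j]}$ is the upper left $i\times j$ submatrix of $M$. For $w\in\mathsf{Mat}^{\mathrm{ss}}_{n\times n}$, $$\mathsf{MSV}^{\mathrm{ss}}_w=\{M\in\mathsf{Mat}^{\mathrm{ss}}_{n\times n}:\operatorname{rank}M_{[i][j]}\le\operatorname{rank}w_{[i][j]}\text{ for all }(i,j)\in[n]\times[n]\}.$$ The coordinate ring is $\mathbb{K}[\mathsf{Mat}^{\mathrm{ss}}_{n\times n}]=\mathbb{K}[u_{ij}:1\le j<i\le n]$ with $u_{ij}(M)=M_{ij}$. For a subset $V$ of an affine space, $I(V)$ is the ideal of all polynomials vanishing on $V$. For sets of positive integers $A=\{a_0<a_1<\dots<a_r\}$ and $B=\{b_0<b_1<\dots<b_r\}$ let $A\odot B=\{(a_i,b_j):i+j=r\}$ and $$A\boxplus B=\{(i,j)\in A\odot B:i\ge j\}\cup\{(i,j)\in B\odot A:i\ge j\}.$$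 Let $u^{\mathrm{ss}}_{AB}=\prod_{(i,j)\in A\boxplus B}u_{ij}$ if every $(i,j)\in A\boxplus B$ has $i\ne j$, and $u^{\mathrm{ss}}_{AB}=0$ otherwise. Define the monomial ideal $$J^{\mathrm{ss}}_w=\langle u^{\mathrm{ss}}_{AB}: i,j\in[n],\ i\ge j,\ A\subseteq[i],\ B\subseteq[j],\ |A|=|B|=1+\operatorname{rank}w_{[i][j]}\rangle.$$ Reverse lexicographic term order: monomials of smaller degree are smaller; for distinct monomials $\mathsf{m}_1=\prod u_{ij}^{a_{ij}}$ and $\mathsf{m}_2=\prod u_{ij}^{b_{ij}}$ of the same degree, $\mathsf{m}_1<\mathsf{m}_2$ if and only if $a_{ij}>b_{ij}$ for the lexicographically largest index $(i,j)$ with $a_{ij}\ne b_{ij}$. For a polynomial $f\ne0$, $\operatorname{init}(f)$ is the maximal monomial occurring in $f$ with nonzero coefficient, and $\operatorname{init}(0)=0$; for an ideal $I$, $\operatorname{init}(I)$ is the $\mathbb{K}$-span of $\{\operatorname{init}(f):f\in I\}$. For an ideal $I$ and a polynomial $f\neq0$, $(I:\langle f\rangle)=\{g: fg\in I\}$. Definition (transition system) in a polynomial ring $S$ over $\mathbb{K}$ with a fixed term order. Let $\mathcal{T}$ be a set of pairs $(I,J)$ of proper ideals of $S$ such that: (T1) for each $(I,J)\in\mathcal{T}$, $J$ is a monomial ideal contained in $\operatorname{init}(I)$, with $J=\operatorname{init}(I)$ if $I$ is maximal; (T2) if $(I,J),(I',J')\in\mathcal{T}$ have $I=I'$ then $J=J'$.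 The set $\mathcal{T}$ is a transition system if for each $(I,J)\in\mathcal{T}$ where $I$ is neither maximal nor equal to $J$, there exist a non-constant $f\in S$ with $f\notin I$ and a nonempty finite set $\Phi\subseteq\mathcal{T}$ such that: (T3) $I+\langle f\rangle\subseteq\bigcap_{(P,Q)\in\Phi}P$ and $J+\langle\operatorname{init}(f)\rangle=\bigcap_{(P,Q)\in\Phi}Q$; (T4) if $I':=(I:\langle f\rangle)$ is not equal to $I$ and $J':=(J:\langle\operatorname{init}(f)\rangle)$, then $(I',J')\in\mathcal{T}$. *)

theory Defs
  imports
    "HOL-Library.Poly_Mapping"
    "HOL-Computational_Algebra.Polynomial"
    "HOL-Algebra.Ideal"
    "Jordan_Normal_Form.DL_Rank"
begin

section \<open>Polynomial rings with a term order\<close>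

text \<open>Exponent vectors are finitely supported maps from variables to \<^typ>\<open>nat\<close>; the variables
  themselves form a subset \<open>X\<close> of the type \<^typ>\<open>'x\<close>. The ring operations on \<open>mpoly\<close> are the
  convolution operations that the library provides for finitely supported maps.\<close>

type_synonym 'x mon = "'x \<Rightarrow>\<^sub>0 nat"
type_synonym ('x, 'k) mpoly = "'x mon \<Rightarrow>\<^sub>0 'k"

definition mons :: "'x set \<Rightarrow> 'x mon set" where
  "mons X = {m. Poly_Mapping.keys m \<subseteq> X}"

definition poly_ring :: "'x set \<Rightarrow> ('x, 'k::field) mpoly ring" where
  "poly_ring X = \<lparr>carrier = {p. Poly_Mapping.keys p \<subseteq> mons X},
     monoid.mult = (*), one = 1, zero = 0, add = (+)\<rparr>"

definition const_poly :: "'k::field \<Rightarrow> ('x, 'k) mpoly" where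
  "const_poly c = Poly_Mapping.single 0 c"

definition mon_poly :: "'x mon \<Rightarrow> ('x, 'k::field) mpoly" where
  "mon_poly m = Poly_Mapping.single m 1"

definition var_poly :: "'x \<Rightarrow> ('x, 'k::field) mpoly" where
  "var_poly x = mon_poly (Poly_Mapping.single x 1)"

definition poly_eval :: "('x \<Rightarrow> 'k) \<Rightarrow> ('x, 'k::field) mpoly \<Rightarrow> 'k" where
  "poly_eval v p = (\<Sum>m\<in>Poly_Mapping.keys p.
     Poly_Mapping.lookup p m * (\<Prod>x\<in>Poly_Mapping.keys m. v x ^ Poly_Mapping.lookup m x))"

text \<open>Term orders are given by their strict part.\<close>

definition term_order :: "'x set \<Rightarrow> ('x mon \<Rightarrow> 'x mon \<Rightarrow> bool) \<Rightarrow> bool" where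
  "term_order X lt \<longleftrightarrow>
     (\<forall>a\<in>mons X. \<not> lt a a) \<and>
     (\<forall>a\<in>mons X. \<forall>b\<in>mons X. \<forall>c\<in>mons X. lt a b \<longrightarrow> lt b c \<longrightarrow> lt a c) \<and>
     (\<forall>a\<in>mons X. \<forall>b\<in>mons X. a \<noteq> b \<longrightarrow> lt a b \<or> lt b a) \<and>
     (\<forall>a\<in>mons X. a \<noteq> 0 \<longrightarrow> lt 0 a) \<and>
     (\<forall>a\<in>mons X. \<forall>b\<in>mons X. \<forall>c\<in>mons X. lt a b \<longrightarrow> lt (a + c) (b + c))"

definition lead_mon :: "('x mon \<Rightarrow> 'x mon \<Rightarrow> bool) \<Rightarrow> ('x, 'k::field) mpoly \<Rightarrow> 'x mon" where
  "lead_mon lt f = (THE m. m \<in> Poly_Mapping.keys f \<and>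
     (\<forall>m'\<in>Poly_Mapping.keys f. m' \<noteq> m \<longrightarrow> lt m' m))"

definition init :: "('x mon \<Rightarrow> 'x mon \<Rightarrow> bool) \<Rightarrow> ('x, 'k::field) mpoly \<Rightarrow> ('x, 'k) mpoly" where
  "init lt f = (if f = 0 then 0 else mon_poly (lead_mon lt f))"

text \<open>The coefficient field acts on polynomials by multiplication with constants;
  see \<open>vector_space_mpoly\<close> below.\<close>

definition init_ideal ::
    "('x mon \<Rightarrow> 'x mon \<Rightarrow> bool) \<Rightarrow> ('x, 'k::field) mpoly set \<Rightarrow> ('x, 'k) mpoly set" where
  "init_ideal lt I = Modules.module.span (\<lambda>c p. const_poly c * p) (init lt ` I)"

definition colon_ideal ::
    "'x set \<Rightarrow> ('x, 'k::field) mpoly set \<Rightarrow> ('x, 'k) mpoly \<Rightarrow> ('x, 'k) mpoly set" where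
  "colon_ideal X I f = {g \<in> carrier (poly_ring X). f * g \<in> I}"

definition proper_ideal :: "'x set \<Rightarrow> ('x, 'k::field) mpoly set \<Rightarrow> bool" where
  "proper_ideal X I \<longleftrightarrow> ideal I (poly_ring X) \<and> I \<noteq> carrier (poly_ring X)"

definition monomial_ideal :: "'x set \<Rightarrow> ('x, 'k::field) mpoly set \<Rightarrow> bool" where
  "monomial_ideal X J \<longleftrightarrow> (\<exists>N \<subseteq> mons X. J = Idl\<^bsub>poly_ring X\<^esub> (mon_poly ` N))"

section \<open>Transition systems\<close>

definition transition_system ::
    "'x set \<Rightarrow> ('x mon \<Rightarrow> 'x mon \<Rightarrow> bool) \<Rightarrow>
     (('x, 'k::field) mpoly set \<times> ('x, 'k) mpoly set) set \<Rightarrow> bool" where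
  "transition_system X lt T \<longleftrightarrow>
     (\<forall>(I, J)\<in>T. proper_ideal X I \<and> proper_ideal X J) \<and>
     (\<forall>(I, J)\<in>T. monomial_ideal X J \<and> J \<subseteq> init_ideal lt I \<and>
        (maximalideal I (poly_ring X) \<longrightarrow> J = init_ideal lt I)) \<and>
     (\<forall>(I, J)\<in>T. \<forall>(I', J')\<in>T. I = I' \<longrightarrow> J = J') \<and>
     (\<forall>(I, J)\<in>T. \<not> maximalideal I (poly_ring X) \<longrightarrow> I \<noteq> J \<longrightarrow>
        (\<exists>f \<Phi>. f \<in> carrier (poly_ring X) \<and> (\<nexists>c. f = const_poly c) \<and> f \<notin> I \<and>
           \<Phi> \<noteq> {} \<and> finite \<Phi> \<and> \<Phi> \<subseteq> T \<and>
           I <+>\<^bsub>poly_ring X\<^esub> Idl\<^bsub>poly_ring X\<^esub> {f} \<subseteq> (\<Inter>(P, Q)\<in>\<Phi>. P) \<and>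
           J <+>\<^bsub>poly_ring X\<^esub> Idl\<^bsub>poly_ring X\<^esub> {init lt f} = (\<Inter>(P, Q)\<in>\<Phi>. Q) \<and>
           (colon_ideal X I f \<noteq> I \<longrightarrow>
              (colon_ideal X I f, colon_ideal X J (init lt f)) \<in> T)))"

section \<open>The reverse lexicographic order\<close>

definition mon_deg :: "'x mon \<Rightarrow> nat" where
  "mon_deg m = (\<Sum>x\<in>Poly_Mapping.keys m. Poly_Mapping.lookup m x)"

definition revlex :: "(nat \<times> nat) mon \<Rightarrow> (nat \<times> nat) mon \<Rightarrow> bool" where
  "revlex m1 m2 \<longleftrightarrow> mon_deg m1 < mon_deg m2 \<or>
     (mon_deg m1 = mon_deg m2 \<and>
      (\<exists>x. Poly_Mapping.lookup m1 x > Poly_Mapping.lookup m2 x \<and>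
         (\<forall>y. (x, y) \<in> less_than <*lex*> less_than \<longrightarrow>
              Poly_Mapping.lookup m1 y = Poly_Mapping.lookup m2 y)))"

section \<open>Skew-symmetric matrix Schubert varieties\<close>

definition skew_mats :: "nat \<Rightarrow> 'k::field mat set" where
  "skew_mats n = {M \<in> carrier_mat n n. transpose_mat M = - M \<and> (\<forall>i<n. M $$ (i, i) = 0)}"

text \<open>The rank of the upper left \<open>i \<times> j\<close> block. Matrix entries are indexed from \<open>0\<close>, so the block
  consists of the entries at positions \<open>(a, b)\<close> with \<open>a < i\<close> and \<open>b < j\<close>.\<close>

definition corner_rank :: "'k::field mat \<Rightarrow> nat \<Rightarrow> nat \<Rightarrow> nat" where
  "corner_rank M i j = vec_space.rank i (mat i j (\<lambda>(a, b). M $$ (a, b)))"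

definition MSV_ss :: "nat \<Rightarrow> 'k::field mat \<Rightarrow> 'k mat set" where
  "MSV_ss n w = {M \<in> skew_mats n. \<forall>i\<in>{1..n}. \<forall>j\<in>{1..n}. corner_rank M i j \<le> corner_rank w i j}"

text \<open>The variable \<open>u\<^sub>i\<^sub>j\<close> is represented by the pair \<open>(i, j)\<close> with indices counted from \<open>1\<close>,
  whence the shift in \<open>ss_point\<close>.\<close>

definition ss_vars :: "nat \<Rightarrow> (nat \<times> nat) set" where
  "ss_vars n = {(i, j). 1 \<le> j \<and> j < i \<and> i \<le> n}"

definition ss_point :: "'k mat \<Rightarrow> nat \<times> nat \<Rightarrow> 'k" where
  "ss_point M = (\<lambda>(i, j). M $$ (i - 1, j - 1))"

definition vanishing_ideal :: "nat \<Rightarrow> 'k::field mat set \<Rightarrow> (nat \<times> nat, 'k) mpoly set" where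
  "vanishing_ideal n V =
     {p \<in> carrier (poly_ring (ss_vars n)). \<forall>M\<in>V. poly_eval (ss_point M) p = 0}"

text \<open>Meant for finite sets of the same size \<open>r + 1\<close>, so that \<open>i + j = r\<close> reads
  \<open>i + j + 1 = card A\<close>.\<close>

definition odot :: "nat set \<Rightarrow> nat set \<Rightarrow> (nat \<times> nat) set" where
  "odot A B = {(sorted_list_of_set A ! i, sorted_list_of_set B ! j) | i j. i + j + 1 = card A}"

definition boxplus :: "nat set \<Rightarrow> nat set \<Rightarrow> (nat \<times> nat) set" where
  "boxplus A B = {(i, j) \<in> odot A B. i \<ge> j} \<union> {(i, j) \<in> odot B A. i \<ge> j}"

definition u_ss :: "nat set \<Rightarrow> nat set \<Rightarrow> (nat \<times> nat, 'k::field) mpoly" where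
  "u_ss A B = (if \<forall>(i, j)\<in>boxplus A B. i \<noteq> j then \<Prod>x\<in>boxplus A B. var_poly x else 0)"

definition J_ss :: "nat \<Rightarrow> 'k::field mat \<Rightarrow> (nat \<times> nat, 'k) mpoly set" where
  "J_ss n w = Idl\<^bsub>poly_ring (ss_vars n)\<^esub>
     {u_ss A B | A B i j. i \<in> {1..n} \<and> j \<in> {1..n} \<and> i \<ge> j \<and> A \<subseteq> {1..i} \<and> B \<subseteq> {1..j} \<and>
        card A = 1 + corner_rank w i j \<and> card B = 1 + corner_rank w i j}"

definition ss_system ::
    "nat \<Rightarrow> ((nat \<times> nat, 'k::field) mpoly set \<times> (nat \<times> nat, 'k) mpoly set) set" where
  "ss_system n = {(vanishing_ideal n (MSV_ss n w), J_ss n w) | w. w \<in> skew_mats n}"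

section \<open>Well-formedness\<close>

lemma vector_space_mpoly:
  "vector_space (\<lambda>(c::'k::field) (p::('x, 'k) mpoly). const_poly c * p)"
proof unfold_locales
  fix a b :: 'k and p :: "('x, 'k) mpoly"
  have "const_poly a * const_poly b = (const_poly (a * b) :: ('x, 'k) mpoly)"
    by (simp add: const_poly_def mult_single)
  then show "const_poly a * (const_poly b * p) = const_poly (a * b) * p"
    by (metis mult.assoc)
qed (simp_all add: const_poly_def distrib_left distrib_right single_add)

lemma zero_in_mons: "0 \<in> mons X"
  by (simp add: mons_def)

lemma add_in_mons: "a \<in> mons X \<Longrightarrow> b \<in> mons X \<Longrightarrow> a + b \<in> mons X"
  using keys_add[of a b] by (auto simp: mons_def)

lemma cring_poly_ring: "cring (poly_ring X :: ('x, 'k::field) mpoly ring)"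
proof -
  let ?R = "poly_ring X :: ('x, 'k) mpoly ring"
  let ?C = "{p :: ('x, 'k) mpoly. Poly_Mapping.keys p \<subseteq> mons X}"
  have times: "p * q \<in> ?C" if "p \<in> ?C" "q \<in> ?C" for p q
    using keys_mult[of p q] that add_in_mons by blast
  have plus: "p + q \<in> ?C" if "p \<in> ?C" "q \<in> ?C" for p q
    using keys_add[of p q] that by blast
  have neg: "- p \<in> ?C" if "p \<in> ?C" for p
    using that by (auto simp: in_keys_iff)
  have sel: "carrier ?R = ?C" "monoid.mult ?R = (*)" "one ?R = 1" "zero ?R = 0" "add ?R = (+)"
    by (simp_all add: poly_ring_def)
  have zo: "0 \<in> ?C" "1 \<in> ?C"
    by (simp_all add: zero_in_mons)
  have ag: "abelian_group ?R"
  proof (rule abelian_groupI, unfold sel)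
    show "\<exists>q\<in>?C. q + p = 0" if "p \<in> ?C" for p
      using neg[OF that] by (rule rev_bexI) simp
  qed (rule plus zo add.assoc add.commute add_0_left | assumption)+
  have cm: "comm_monoid ?R"
    by (rule comm_monoidI, unfold sel)
      (rule times zo mult.assoc mult.commute mult_1_left | assumption)+
  show ?thesis
    by (rule cringI[OF ag cm], unfold sel) (rule distrib_right)
qed

lemma mon_deg_superset:
  assumes "finite S" "Poly_Mapping.keys m \<subseteq> S"
  shows "mon_deg m = (\<Sum>x\<in>S. Poly_Mapping.lookup m x)"
  unfolding mon_deg_def
  by (rule sum.mono_neutral_left) (use assms in \<open>auto simp: in_keys_iff\<close>)

lemma mon_deg_add: "mon_deg (a + b) = mon_deg a + mon_deg b"
proof -
  let ?S = "Poly_Mapping.keys a \<union> Poly_Mapping.keys b"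
  have "mon_deg (a + b) = (\<Sum>x\<in>?S. Poly_Mapping.lookup (a + b) x)"
    by (rule mon_deg_superset) (use keys_add[of a b] in auto)
  then show ?thesis
    by (simp add: mon_deg_superset[of ?S a] mon_deg_superset[of ?S b] lookup_add sum.distrib)
qed

lemma term_order_revlex: "term_order X revlex"
proof -
  let ?r = "less_than <*lex*> less_than"
  let ?l = "Poly_Mapping.lookup :: (nat \<times> nat) mon \<Rightarrow> _"
  have irr: "\<not> revlex a a" for a
    by (auto simp: revlex_def)
  have tot: "(x, y) \<in> ?r \<or> (y, x) \<in> ?r \<or> x = y" for x y :: "nat \<times> nat"
    by (cases x; cases y) auto
  have tr: "(x, y) \<in> ?r \<Longrightarrow> (y, z) \<in> ?r \<Longrightarrow> (x, z) \<in> ?r" for x y z :: "nat \<times> nat"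
    by (cases x; cases y; cases z) auto
  have trans: "revlex a c" if ab: "revlex a b" and bc: "revlex b c" for a b c
  proof (cases "mon_deg a = mon_deg b \<and> mon_deg b = mon_deg c")
    case False
    then show ?thesis using that by (auto simp: revlex_def)
  next
    case True
    then obtain x y where x: "?l a x > ?l b x" "\<And>z. (x, z) \<in> ?r \<Longrightarrow> ?l a z = ?l b z"
      and y: "?l b y > ?l c y" "\<And>z. (y, z) \<in> ?r \<Longrightarrow> ?l b z = ?l c z"
      using ab bc unfolding revlex_def by (metis less_irrefl)
    consider "(x, y) \<in> ?r" | "(y, x) \<in> ?r" | "x = y" using tot by blast
    then have "\<exists>z. ?l a z > ?l c z \<and> (\<forall>y. (z, y) \<in> ?r \<longrightarrow> ?l a y = ?l c y)"
    proof cases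
      case 1
      then show ?thesis by (intro exI[of _ y]) (metis x y tr)
    next
      case 2
      then show ?thesis by (intro exI[of _ x]) (metis x y tr)
    next
      case 3
      then show ?thesis by (intro exI[of _ x]) (metis x y less_trans)
    qed
    then show ?thesis using True by (simp add: revlex_def)
  qed
  have total: "revlex a b \<or> revlex b a" if "a \<noteq> b" for a b
  proof (cases "mon_deg a = mon_deg b")
    case False
    then show ?thesis by (auto simp: revlex_def)
  next
    case True
    define D where "D = {x. ?l a x \<noteq> ?l b x}"
    have "D \<subseteq> Poly_Mapping.keys a \<union> Poly_Mapping.keys b"
      by (auto simp: D_def in_keys_iff)
    then have fin: "finite D" by (rule finite_subset) simp
    have "D \<noteq> {}"
      using that poly_mapping_eqI[of a b] unfolding D_def by blast
    then obtain z where z: "z \<in> D" by blast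
    define W where "W = ?r \<inter> D \<times> D"
    have "finite W" unfolding W_def using fin by blast
    moreover have "acyclic W"
      unfolding W_def by (rule acyclic_subset[of ?r]) (auto intro: wf_acyclic)
    ultimately have "wf (W\<inverse>)" by (rule finite_acyclic_wf_converse)
    then obtain x where x: "x \<in> D" and max: "\<And>y. (y, x) \<in> W\<inverse> \<Longrightarrow> y \<notin> D"
      using z by (rule wfE_min) simp
    have "y \<notin> D" if "(x, y) \<in> ?r" for y
      using max[of y] x that by (auto simp: W_def)
    then have eq: "\<forall>y. (x, y) \<in> ?r \<longrightarrow> ?l a y = ?l b y" unfolding D_def by blast
    have "?l a x > ?l b x \<or> ?l b x > ?l a x" using x unfolding D_def by auto
    then show ?thesis
    proof
      assume "?l a x > ?l b x"
      then have "revlex a b" unfolding revlex_def using True eq by blast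
      then show ?thesis ..
    next
      assume "?l b x > ?l a x"
      moreover have "\<forall>y. (x, y) \<in> ?r \<longrightarrow> ?l b y = ?l a y" using eq by simp
      ultimately have "revlex b a" unfolding revlex_def using True by metis
      then show ?thesis ..
    qed
  qed
  have zero: "revlex 0 a" if "a \<noteq> 0" for a
  proof -
    obtain x where "?l a x \<noteq> 0"
      using \<open>a \<noteq> 0\<close> poly_mapping_eqI[of a 0] unfolding lookup_zero by blast
    then have "mon_deg a \<noteq> 0"
      unfolding mon_deg_def using sum_eq_0_iff[OF finite_keys, of "?l a" a] by (metis in_keys_iff)
    then show ?thesis by (simp add: revlex_def mon_deg_def[of 0])
  qed
  have add: "revlex (a + c) (b + c)" if "revlex a b" for a b c
    using that by (simp add: revlex_def mon_deg_add lookup_add)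
  show ?thesis
    unfolding term_order_def using irr trans total zero add by blast
qed

end

theory Submission
  imports Defs
begin

text \<open>
  For a skew-symmetric matrix \<open>w\<close> write \<open>I\<close> and \<open>J\<close> for the
  two ideals of its pair. If \<open>w\<close> is zero, then \<open>I\<close> and \<open>J\<close>
  are both the ideal of the origin. Otherwise let \<open>(p, q)\<close> be the pivot of
  \<open>w\<close>, the topmost nonzero position in its leftmost nonzero column; it lies below the
  diagonal. The transition at \<open>w\<close> uses the pivot variable as \<open>f\<close>, and as
  \<open>\<Phi>\<close> the pairs of all matrices in the variety of \<open>w\<close> with
  vanishing pivot entry. Four facts carry the argument.

  The monomial ideal in terms of chains. Call a sequence of positions whose rows increase and
  whose columns decrease an antidiagonal chain. A monomial with support \<open>D\<close> lies in
  \<open>J\<close> exactly if \<open>D\<close> together with its reflection contains, in some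
  corner, an antidiagonal chain longer than the rank of \<open>w\<close> there
  (\<open>J_ss_iff\<close>).

  The inclusion of \<open>J\<close> in the initial ideal. Minors do not suffice, because the arcs
  of a chain, folded below the diagonal, may overlap. Instead one takes the Pfaffian of a matrix
  with selected, possibly repeated, rows and columns of the generic skew-symmetric matrix, in
  which a diagonal block is set to zero. A rank bound makes it singular, and its leading monomial
  divides the monomial of the chain (\<open>select_arcs\<close>, \<open>pfaffian_lead\<close>,
  \<open>masked_pfaffian_vanishes\<close>, \<open>chain_lead\<close>).

  The monomial identity of the transition. The lengths of the longest antidiagonal chains in the
  reflected set \<open>D\<close> are the corner ranks of a skew-symmetric signed partial
  permutation matrix: they satisfy the exchange inequality of rank functions, and in square
  corners they are even, which excludes diagonal entries (\<open>has_chain_supermodular\<close>,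
  \<open>square_chain_even\<close>, \<open>corner_rank_chain_matrix\<close>). If the monomial with
  support \<open>D\<close> is in neither \<open>J\<close> nor the ideal of the pivot variable,
  then this matrix is one of those that define \<open>\<Phi>\<close>, and the monomial is not in
  its ideal (\<open>J_ss_boundary\<close>).

  The colon ideal. The pivot variable is a nonzerodivisor modulo \<open>I\<close>, so that the
  colon ideal equals \<open>I\<close> and there is nothing to check for it. Indeed, every matrix
  of the variety is a limit of matrices in it with nonzero pivot entry, obtained by finitely many
  steps along lines \<open>M + \<epsilon> (d g\<^sup>T - g d\<^sup>T)\<close> that stay in the
  variety (\<open>deformation_direction\<close>, \<open>variable_nonzerodivisor\<close>).

  Finally, the vanishing ideal determines the corner ranks of \<open>w\<close> by means of minors,
  and \<open>J\<close> depends only on these ranks; there are finitely many rank tables.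
\<close>

section \<open>Matrix rank through factorizations\<close>

text \<open>The condition that the block of \<open>m\<close> with rows \<open>Y\<close> and columns
  \<open>Z\<close> has rank at most \<open>r\<close>. Stating it through a factorization lets
  \<open>m\<close> be a plain function and the blocks be arbitrary index sets, so that
  submatrices, transposes and rank-one updates cost nothing.\<close>

definition factors_through ::
    "(nat \<Rightarrow> nat \<Rightarrow> 'k::field) \<Rightarrow> nat set \<Rightarrow> nat set \<Rightarrow> nat \<Rightarrow> bool" where
  "factors_through m Y Z r \<longleftrightarrow>
     (\<exists>P Q. \<forall>y\<in>Y. \<forall>z\<in>Z. m y z = (\<Sum>l<r. P y l * Q l z))"

lemma factors_through_index_set:
  assumes "finite L" "card L \<le> r"
    and "\<And>y z. y \<in> Y \<Longrightarrow> z \<in> Z \<Longrightarrow> m y z = (\<Sum>l\<in>L. P y l * Q l z)"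
  shows "factors_through m Y Z r"
proof -
  obtain h where h: "bij_betw h {..<card L} L"
    using ex_bij_betw_nat_finite[OF assms(1)] by (auto simp: atLeast0LessThan)
  have "m y z = (\<Sum>l<r. (if l < card L then P y (h l) else 0) * Q (h l) z)" if "y \<in> Y" "z \<in> Z" for y z
  proof -
    have "(\<Sum>l<r. (if l < card L then P y (h l) else 0) * Q (h l) z) =
        (\<Sum>l<card L. (if l < card L then P y (h l) else 0) * Q (h l) z)"
      using assms(2) by (intro sum.mono_neutral_right) auto
    also have "\<dots> = (\<Sum>l\<in>{..<card L}. P y (h l) * Q (h l) z)" by (intro sum.cong) auto
    also have "\<dots> = (\<Sum>l\<in>L. P y l * Q l z)" by (rule sum.reindex_bij_betw[OF h])
    finally show ?thesis using assms(3)[OF that] by simp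
  qed
  then show ?thesis unfolding factors_through_def
    by (intro exI[of _ "\<lambda>y l. if l < card L then P y (h l) else 0"] exI[of _ "\<lambda>l. Q (h l)"]) auto
qed

lemma factors_throughE:
  assumes "factors_through m Y Z r"
  obtains P Q where "\<And>y z. y \<in> Y \<Longrightarrow> z \<in> Z \<Longrightarrow> m y z = (\<Sum>l<r. P y l * Q l z)"
  using assms unfolding factors_through_def by blast

lemma factors_through_mono:
  assumes "factors_through m Y Z r" "r \<le> r'" "Y' \<subseteq> Y" "Z' \<subseteq> Z"
  shows "factors_through m Y' Z' r'"
proof -
  obtain P Q where "\<And>y z. y \<in> Y \<Longrightarrow> z \<in> Z \<Longrightarrow> m y z = (\<Sum>l<r. P y l * Q l z)"
    using assms(1) by (rule factors_throughE) blast
  then show ?thesis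
    by (intro factors_through_index_set[of "{..<r}" _ _ _ _ P Q]) (use assms in auto)
qed

lemma factors_through_transpose:
  assumes "factors_through m Y Z r"
  shows "factors_through (\<lambda>z y. m y z) Z Y r"
proof -
  obtain P Q where "\<And>y z. y \<in> Y \<Longrightarrow> z \<in> Z \<Longrightarrow> m y z = (\<Sum>l<r. P y l * Q l z)"
    using assms(1) by (rule factors_throughE) blast
  then show ?thesis
    by (intro factors_through_index_set[of "{..<r}" _ _ _ _ "\<lambda>z l. Q l z" "\<lambda>l y. P y l"])
      (auto simp: mult.commute)
qed

lemma factors_through_cong:
  assumes "\<And>y z. y \<in> Y \<Longrightarrow> z \<in> Z \<Longrightarrow> m y z = m' y z"
  shows "factors_through m Y Z r \<longleftrightarrow> factors_through m' Y Z r"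
  using assms unfolding factors_through_def by simp

lemma underdetermined_system:
  fixes Q :: "nat \<Rightarrow> 'l \<Rightarrow> 'k::field"
  assumes "finite F" "card F > r"
  shows "\<exists>v. (\<exists>f\<in>F. v f \<noteq> 0) \<and> (\<forall>l<r. (\<Sum>f\<in>F. v f * Q l f) = 0)"
  using assms
proof (induction r arbitrary: F Q)
  case 0
  then have "F \<noteq> {}" by auto
  then show ?case by (intro exI[of _ "\<lambda>_. 1"]) auto
next
  case (Suc r)
  show ?case
  proof (cases "\<forall>f\<in>F. Q r f = 0")
    case True
    obtain v where "\<exists>f\<in>F. v f \<noteq> 0" "\<forall>l<r. (\<Sum>f\<in>F. v f * Q l f) = 0"
      using Suc.IH[of F Q] Suc.prems by auto
    then show ?thesis using True by (intro exI[of _ v]) (auto simp: less_Suc_eq)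
  next
    case False
    then obtain e where e: "e \<in> F" "Q r e \<noteq> 0" by blast
    define Q' where "Q' l f = Q l f - Q l e * Q r f / Q r e" for l f
    have big: "r < card (F - {e})" using Suc.prems e(1) by simp
    obtain v where v: "\<exists>f\<in>F - {e}. v f \<noteq> 0" "\<forall>l<r. (\<Sum>f\<in>F - {e}. v f * Q' l f) = 0"
      using Suc.IH[of "F - {e}" Q', OF finite_Diff[OF Suc.prems(1)] big] by blast
    define t where "t = (\<Sum>f\<in>F - {e}. v f * Q r f) / Q r e"
    define w where "w = v(e := - t)"
    have split: "(\<Sum>f\<in>F. w f * Q l f) = (\<Sum>f\<in>F - {e}. v f * Q l f) - t * Q l e" for l
    proof -
      have "(\<Sum>f\<in>F. w f * Q l f) = w e * Q l e + (\<Sum>f\<in>F - {e}. w f * Q l f)"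
        using Suc.prems(1) e(1) by (rule sum.remove)
      also have "(\<Sum>f\<in>F - {e}. w f * Q l f) = (\<Sum>f\<in>F - {e}. v f * Q l f)"
        by (rule sum.cong) (auto simp: w_def)
      finally show ?thesis by (simp add: w_def)
    qed
    have "(\<Sum>f\<in>F. w f * Q l f) = 0" if "l < Suc r" for l
    proof (cases "l = r")
      case True
      then show ?thesis using e(2) by (simp add: split t_def)
    next
      case False
      then have "l < r" using that by simp
      have "(\<Sum>f\<in>F - {e}. v f * Q' l f) =
          (\<Sum>f\<in>F - {e}. v f * Q l f - v f * Q r f * (Q l e / Q r e))"
        by (rule sum.cong) (auto simp: Q'_def algebra_simps)
      also have "\<dots> = (\<Sum>f\<in>F - {e}. v f * Q l f) - t * Q l e"
        by (simp add: sum_subtractf sum_distrib_right t_def sum_divide_distrib)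
      finally show ?thesis using v(2) \<open>l < r\<close> by (simp add: split)
    qed
    moreover have "\<exists>f\<in>F. w f \<noteq> 0" using v(1) by (auto simp: w_def)
    ultimately show ?thesis by blast
  qed
qed

text \<open>The coefficients of a dependency among the columns of the second factor form \<open>r\<close>
  equations in more than \<open>r\<close> unknowns. The reindexing \<open>\<phi>\<close> permits
  repeated columns, which the Pfaffians below contain.\<close>

lemma factors_through_dependency:
  assumes "factors_through m Y Z r" "finite F" "card F > r" "\<phi> ` F \<subseteq> Z"
  shows "\<exists>v. (\<exists>f\<in>F. v f \<noteq> 0) \<and> (\<forall>y\<in>Y. (\<Sum>f\<in>F. v f * m y (\<phi> f)) = 0)"
proof -
  obtain P Q where PQ: "\<And>y z. y \<in> Y \<Longrightarrow> z \<in> Z \<Longrightarrow> m y z = (\<Sum>l<r. P y l * Q l z)"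
    using assms(1) by (rule factors_throughE) blast
  obtain v where v: "\<exists>f\<in>F. v f \<noteq> 0" "\<forall>l<r. (\<Sum>f\<in>F. v f * Q l (\<phi> f)) = 0"
    using underdetermined_system[OF assms(2,3), of "\<lambda>l f. Q l (\<phi> f)"] by blast
  have "(\<Sum>f\<in>F. v f * m y (\<phi> f)) = 0" if "y \<in> Y" for y
  proof -
    have "(\<Sum>f\<in>F. v f * m y (\<phi> f)) = (\<Sum>f\<in>F. \<Sum>l<r. P y l * (v f * Q l (\<phi> f)))"
      using PQ[OF that] assms(4)
      by (intro sum.cong) (auto simp: sum_distrib_left algebra_simps image_subset_iff)
    also have "\<dots> = (\<Sum>l<r. P y l * (\<Sum>f\<in>F. v f * Q l (\<phi> f)))"
      by (subst sum.swap) (simp add: sum_distrib_left)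
    also have "\<dots> = 0" using v(2) by simp
    finally show ?thesis .
  qed
  then show ?thesis using v(1) by blast
qed

definition indep_columns :: "(nat \<Rightarrow> nat \<Rightarrow> 'k::field) \<Rightarrow> nat set \<Rightarrow> nat set \<Rightarrow> bool" where
  "indep_columns m Y S \<longleftrightarrow>
     (\<forall>v. (\<forall>y\<in>Y. (\<Sum>z\<in>S. v z * m y z) = 0) \<longrightarrow> (\<forall>z\<in>S. v z = 0))"

lemma indep_columns_card:
  assumes "indep_columns m Y S" "S \<subseteq> Z" "finite S" "factors_through m Y Z r"
  shows "card S \<le> r"
proof (rule ccontr)
  assume "\<not> card S \<le> r"
  then obtain v where "\<exists>z\<in>S. v z \<noteq> 0" "\<forall>y\<in>Y. (\<Sum>z\<in>S. v z * m y z) = 0"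
    using factors_through_dependency[OF assms(4,3), of "\<lambda>x. x"] assms(2) by auto
  then show False using assms(1) unfolding indep_columns_def by blast
qed

lemma indep_columns_subset:
  assumes "indep_columns m Y S" "T \<subseteq> S" "finite S"
  shows "indep_columns m Y T"
  unfolding indep_columns_def
proof (intro allI impI ballI)
  fix v z assume v: "\<forall>y\<in>Y. (\<Sum>z\<in>T. v z * m y z) = 0" and z: "z \<in> T"
  define w where "w z = (if z \<in> T then v z else 0)" for z
  have "(\<Sum>z\<in>S. w z * m y z) = (\<Sum>z\<in>T. v z * m y z)" for y
    using assms(2,3) by (intro sum.mono_neutral_cong_right) (auto simp: w_def)
  then have "\<forall>y\<in>Y. (\<Sum>z\<in>S. w z * m y z) = 0" using v by simp
  then have "\<forall>z\<in>S. w z = 0" using assms(1) unfolding indep_columns_def by blast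
  then have "w z = 0" using assms(2) z by blast
  then show "v z = 0" using z by (simp add: w_def)
qed

text \<open>An independent set of columns of the largest possible size spans the remaining columns, and the
  coefficients of these combinations are the second factor.\<close>

lemma column_basis:
  assumes "finite Z"
  shows "\<exists>S \<subseteq> Z. indep_columns m Y S \<and> factors_through m Y Z (card S)"
proof -
  have "\<exists>S. (S \<subseteq> Z \<and> indep_columns m Y S) \<and>
      (\<forall>T. T \<subseteq> Z \<and> indep_columns m Y T \<longrightarrow> card T \<le> card S)"
  proof (rule ex_has_greatest_nat)
    show "{} \<subseteq> Z \<and> indep_columns m Y {}" by (simp add: indep_columns_def)
    show "\<forall>S. S \<subseteq> Z \<and> indep_columns m Y S \<longrightarrow> card S < Suc (card Z)"
      using card_mono[OF assms] by (auto simp: less_Suc_eq_le)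
  qed
  then obtain S where S: "S \<subseteq> Z" "indep_columns m Y S"
    and max: "\<And>T. T \<subseteq> Z \<Longrightarrow> indep_columns m Y T \<Longrightarrow> card T \<le> card S" by blast
  have fin: "finite S" using S(1) assms finite_subset by blast
  have "\<exists>c. \<forall>y\<in>Y. m y z = (\<Sum>s\<in>S. m y s * c s)" if "z \<in> Z" for z
  proof (cases "z \<in> S")
    case True
    have "(\<Sum>s\<in>S. m y s * (if s = z then 1 else 0)) = m y z" for y
      using True fin by (simp add: if_distrib cong: if_cong)
    then show ?thesis by (intro exI[of _ "\<lambda>s. if s = z then 1 else 0"]) simp
  next
    case False
    have "card (insert z S) = Suc (card S)" using False fin by simp
    then have "\<not> indep_columns m Y (insert z S)"
      using max[of "insert z S"] S(1) that by (metis insert_subset not_less_eq_eq order_refl)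
    then have "\<exists>v. (\<forall>y\<in>Y. (\<Sum>s\<in>insert z S. v s * m y s) = 0) \<and> (\<exists>s\<in>insert z S. v s \<noteq> 0)"
      by (simp only: indep_columns_def not_all not_imp bex_simps ball_simps simp_thms de_Morgan_conj)
    then obtain v where v: "\<forall>y\<in>Y. (\<Sum>s\<in>insert z S. v s * m y s) = 0"
      and nz: "\<exists>s\<in>insert z S. v s \<noteq> 0" by blast
    have eq: "v z * m y z + (\<Sum>s\<in>S. v s * m y s) = 0" if "y \<in> Y" for y
      using v that False fin by simp
    have "v z \<noteq> 0"
    proof
      assume "v z = 0"
      then have "\<forall>y\<in>Y. (\<Sum>s\<in>S. v s * m y s) = 0" using eq by simp
      then have "\<forall>s\<in>S. v s = 0" using S(2) unfolding indep_columns_def by blast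
      then show False using \<open>v z = 0\<close> nz by auto
    qed
    have "m y z = (\<Sum>s\<in>S. m y s * (- v s / v z))" if "y \<in> Y" for y
     
    proof -
      have "m y z = - (\<Sum>s\<in>S. v s * m y s) / v z"
      proof -
        have "v z * m y z = - (\<Sum>s\<in>S. v s * m y s)"
          using eq[OF that] by (simp only: eq_neg_iff_add_eq_0)
        then have "m y z * v z = - (\<Sum>s\<in>S. v s * m y s)" by (simp only: mult.commute)
        then show ?thesis using \<open>v z \<noteq> 0\<close> by (metis eq_divide_imp)
      qed
      also have "\<dots> = (\<Sum>s\<in>S. m y s * (- v s / v z))"
        by (simp add: sum_divide_distrib sum_negf mult.commute)
      finally show ?thesis .
    qed
    then show ?thesis by (intro exI[of _ "\<lambda>s. - v s / v z"]) auto
  qed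
  then have "\<forall>z\<in>Z. \<exists>c. \<forall>y\<in>Y. m y z = (\<Sum>s\<in>S. m y s * c s)" by blast
  then obtain c where "\<forall>z\<in>Z. \<forall>y\<in>Y. m y z = (\<Sum>s\<in>S. m y s * c z s)"
    by (rule bchoice[THEN exE])
  then have "factors_through m Y Z (card S)"
    by (intro factors_through_index_set[OF fin order_refl, of _ _ _ "\<lambda>y s. m y s" "\<lambda>s z. c z s"]) blast
  then show ?thesis using S by blast
qed

lemma indep_columns_iff_lin_indpt:
  assumes A: "A \<in> carrier_mat i j" and S: "S \<subseteq> {..<j}" and inj: "inj_on (col A) S"
  shows "indep_columns (\<lambda>y z. A $$ (y, z)) {..<i} S \<longleftrightarrow>
    module.lin_indpt class_ring (module_vec TYPE('k::field) i) (col A ` S)"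
proof -
  interpret vec_space "TYPE('k)" i .
  have fin: "finite S" using S finite_subset by blast
  have car: "col A ` S \<subseteq> carrier_vec i" using A by auto
  have comb: "lincomb a (col A ` S) $ y = (\<Sum>z\<in>S. a (col A z) * A $$ (y, z))" if "y < i" for a y
  proof -
    have "lincomb a (col A ` S) $ y = (\<Sum>x\<in>col A ` S. a x * x $ y)"
      using that car by (rule lincomb_index)
    also have "\<dots> = (\<Sum>z\<in>S. a (col A z) * col A z $ y)"
      using sum.reindex[OF inj] by simp
    also have "\<dots> = (\<Sum>z\<in>S. a (col A z) * A $$ (y, z))"
      using A S that by (intro sum.cong refl) auto
    finally show ?thesis .
  qed
  show ?thesis
  proof
    assume ind: "indep_columns (\<lambda>y z. A $$ (y, z)) {..<i} S"
    show "lin_indpt (col A ` S)"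
    proof (rule finite_lin_indpt2)
      fix a :: "'k vec \<Rightarrow> 'k" assume "lincomb a (col A ` S) = 0\<^sub>v i"
      then have "\<forall>y\<in>{..<i}. (\<Sum>z\<in>S. a (col A z) * A $$ (y, z)) = 0"
        using comb[of _ a] by (metis index_zero_vec(1) lessThan_iff)
      then have "\<forall>z\<in>S. a (col A z) = 0"
        using ind[unfolded indep_columns_def, rule_format, of "\<lambda>z. a (col A z)"] by blast
      then show "\<forall>v\<in>col A ` S. a v = 0" by blast
    qed (use fin car in auto)
  next
    assume ind: "lin_indpt (col A ` S)"
    show "indep_columns (\<lambda>y z. A $$ (y, z)) {..<i} S"
      unfolding indep_columns_def
    proof (intro allI impI ballI)
      fix v z assume v: "\<forall>y\<in>{..<i}. (\<Sum>z\<in>S. v z * A $$ (y, z)) = 0" and z: "z \<in> S"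
      define a where "a x = v (the_inv_into S (col A) x)" for x
      have a: "a (col A z) = v z" if "z \<in> S" for z
        using that by (simp add: a_def the_inv_into_f_f[OF inj])
      have "lincomb a (col A ` S) = 0\<^sub>v i"
      proof (rule eq_vecI)
        show "dim_vec (lincomb a (col A ` S)) = dim_vec (0\<^sub>v i :: 'k vec)"
          using lincomb_dim[of "col A ` S" a] fin car by simp
        fix y assume "y < dim_vec (0\<^sub>v i :: 'k vec)"
        then have y: "y < i" by simp
        have "(\<Sum>z\<in>S. a (col A z) * A $$ (y, z)) = (\<Sum>z\<in>S. v z * A $$ (y, z))"
          by (intro sum.cong refl) (simp add: a)
        then show "lincomb a (col A ` S) $ y = 0\<^sub>v i $ y" using v comb[OF y] y by simp
      qed
      then have "a \<in> col A ` S \<rightarrow> {0}"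
        by (intro not_lindepD[OF ind]) (use fin in auto)
      then have "a (col A z) = 0" using z by blast
      then show "v z = 0" using a[OF z] by simp
    qed
  qed
qed

text \<open>The size of a column basis is the rank of \<open>A\<close> as well as the smallest
  \<open>r\<close> for which \<open>A\<close> factors.\<close>

lemma rank_le_iff_factors_through:
  fixes A :: "'k::field mat"
  assumes A: "A \<in> carrier_mat i j"
  shows "vec_space.rank i A \<le> r \<longleftrightarrow> factors_through (\<lambda>y z. A $$ (y, z)) {..<i} {..<j} r"
proof -
  interpret vec_space "TYPE('k)" i .
  obtain S where S: "S \<subseteq> {..<j}" "indep_columns (\<lambda>y z. A $$ (y, z)) {..<i} S"
    and fac: "factors_through (\<lambda>y z. A $$ (y, z)) {..<i} {..<j} (card S)"
    using column_basis[of "{..<j}"] by blast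
  have cols: "set (cols A) = col A ` {..<j}"
    using A by (auto simp: cols_def)
  have fin: "finite S" using S(1) finite_subset by blast
  have inj: "inj_on (col A) S"
  proof (rule inj_onI, rule ccontr)
    fix x z assume xz: "x \<in> S" "z \<in> S" "col A x = col A z" "x \<noteq> z"
    define v :: "nat \<Rightarrow> 'k" where "v s = (if s = x then 1 else if s = z then - 1 else 0)" for s
    have "(\<Sum>s\<in>S. v s * A $$ (y, s)) = 0" if "y < i" for y
    proof -
      have "(\<Sum>s\<in>S. v s * A $$ (y, s)) = (\<Sum>s\<in>{x, z}. v s * A $$ (y, s))"
        using xz fin by (intro sum.mono_neutral_right) (auto simp: v_def)
      also have "\<dots> = A $$ (y, x) - A $$ (y, z)" using xz by (simp add: v_def)
      also have "\<dots> = col A x $ y - col A z $ y"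
        using A S(1) xz(1,2) that by (subst (1 2) index_col) auto
      finally show ?thesis using xz by simp
    qed
    then have "v x = 0" using S(2) xz(1) unfolding indep_columns_def by blast
    then show False by (simp add: v_def)
  qed
  have le: "rank A \<ge> card S"
  proof -
    have "card (col A ` S) \<le> rank A"
      using A S(1) cols indep_columns_iff_lin_indpt[OF A S(1) inj] S(2)
      by (intro rank_ge_card_indpt[OF A]) auto
    then show ?thesis using card_image[OF inj] by simp
  qed
  have ge: "rank A \<le> card S"
  proof -
    obtain U where max: "maximal U (\<lambda>T. T \<subseteq> set (cols A) \<and> lin_indpt T)"
      using maximal_exists_superset[of "set (cols A)" "\<lambda>T. T \<subseteq> set (cols A) \<and> lin_indpt T" "{}"]
      by (auto simp: lin_dep_def)
    then have U: "U \<subseteq> col A ` {..<j}" "lin_indpt U" unfolding maximal_def cols by auto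
    then obtain T where T: "T \<subseteq> {..<j}" "inj_on (col A) T" "U = col A ` T"
      using subset_image_inj by metis
    have "indep_columns (\<lambda>y z. A $$ (y, z)) {..<i} T"
      using indep_columns_iff_lin_indpt[OF A T(1,2)] U T by simp
    then have "card T \<le> card S"
      using T(1) fac finite_subset[OF T(1)] by (intro indep_columns_card) auto
    then show ?thesis using rank_card_indpt[OF A max] T card_image by metis
  qed
  show ?thesis
  proof
    assume "rank A \<le> r"
    then show "factors_through (\<lambda>y z. A $$ (y, z)) {..<i} {..<j} r"
      using fac le by (intro factors_through_mono[OF fac]) auto
  next
    assume "factors_through (\<lambda>y z. A $$ (y, z)) {..<i} {..<j} r"
    then have "card S \<le> r" using S fin by (intro indep_columns_card) auto
    then show "rank A \<le> r" using ge by simp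
  qed
qed

definition entry :: "'k mat \<Rightarrow> nat \<Rightarrow> nat \<Rightarrow> 'k" where
  "entry M y z = M $$ (y - 1, z - 1)"

lemma corner_rank_le_iff:
  "corner_rank M i j \<le> r \<longleftrightarrow> factors_through (entry M) {1..i} {1..j} r"
proof -
  have "corner_rank M i j \<le> r \<longleftrightarrow>
      factors_through (\<lambda>y z. mat i j (\<lambda>(a, b). M $$ (a, b)) $$ (y, z)) {..<i} {..<j} r"
    unfolding corner_rank_def by (rule rank_le_iff_factors_through) simp
  also have "\<dots> \<longleftrightarrow> factors_through (\<lambda>y z. M $$ (y, z)) {..<i} {..<j} r"
    by (rule factors_through_cong) simp
  also have "\<dots> \<longleftrightarrow> factors_through (entry M) {1..i} {1..j} r"
  proof
    assume "factors_through (\<lambda>y z. M $$ (y, z)) {..<i} {..<j} r"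
    then obtain P Q where PQ: "\<And>y z. y \<in> {..<i} \<Longrightarrow> z \<in> {..<j} \<Longrightarrow> M $$ (y, z) = (\<Sum>l<r. P y l * Q l z)"
      by (rule factors_throughE) blast
    show "factors_through (entry M) {1..i} {1..j} r" unfolding factors_through_def entry_def
      by (intro exI[of _ "\<lambda>y. P (y - 1)"] exI[of _ "\<lambda>l z. Q l (z - 1)"] ballI PQ) auto
  next
    assume "factors_through (entry M) {1..i} {1..j} r"
    then obtain P Q where PQ: "\<And>y z. y \<in> {1..i} \<Longrightarrow> z \<in> {1..j} \<Longrightarrow> entry M y z = (\<Sum>l<r. P y l * Q l z)"
      by (rule factors_throughE) blast
    have "M $$ (y, z) = (\<Sum>l<r. P (Suc y) l * Q l (Suc z))" if "y < i" "z < j" for y z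
      using PQ[of "Suc y" "Suc z"] that by (simp add: entry_def)
    then show "factors_through (\<lambda>y z. M $$ (y, z)) {..<i} {..<j} r" unfolding factors_through_def
      by (intro exI[of _ "\<lambda>y. P (Suc y)"] exI[of _ "\<lambda>l z. Q l (Suc z)"]) auto
  qed
  finally show ?thesis .
qed

section \<open>Pfaffians\<close>

definition flip_sign :: "nat \<Rightarrow> nat \<Rightarrow> 'a::comm_ring_1" where
  "flip_sign x y = (if x < y then - 1 else 1)"

text \<open>With the ranks of \<open>x\<close> and \<open>y\<close> counted in \<open>S\<close>, and the
  sign flipped when \<open>x < y\<close>, this is antisymmetric in \<open>x\<close> and
  \<open>y\<close>. Therefore one formula gives the expansion of a Pfaffian along every element of
  \<open>S\<close>, not only along the least one.\<close>

definition expansion_sign :: "nat set \<Rightarrow> nat \<Rightarrow> nat \<Rightarrow> 'a::comm_ring_1" where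
  "expansion_sign S x y =
     flip_sign x y * (- 1) ^ card {s \<in> S. s < x} * (- 1) ^ card {s \<in> S. s < y}"

text \<open>The Pfaffian of the principal submatrix on \<open>S\<close>, expanded along its least index. The
  number \<open>n\<close> is half the size of \<open>S\<close>; carrying it along makes the
  recursion primitive.\<close>

primrec pfaffian :: "nat \<Rightarrow> (nat \<Rightarrow> nat \<Rightarrow> 'a::comm_ring_1) \<Rightarrow> nat set \<Rightarrow> 'a" where
  "pfaffian 0 f S = 1"
| "pfaffian (Suc n) f S = (\<Sum>y\<in>S - {Min S}.
     expansion_sign S (Min S) y * f (Min S) y * pfaffian n f (S - {Min S, y}))"

lemma flip_sign_swap: "x \<noteq> y \<Longrightarrow> flip_sign x y = - flip_sign y x"
  by (auto simp: flip_sign_def)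

lemma rank_parity_remove:
  assumes "finite S" "a \<in> S" "b \<in> S" "a \<noteq> b"
  shows "(- 1 :: 'a::comm_ring_1) ^ card {s \<in> S - {a, b}. s < x} =
    (- 1) ^ card {s \<in> S. s < x} * flip_sign a x * flip_sign b x"
proof -
  have one: "(- 1 :: 'a) ^ card {s \<in> T - {c}. s < x} = (- 1) ^ card {s \<in> T. s < x} * flip_sign c x"
    if "finite T" "c \<in> T" for T c
  proof (cases "c < x")
    case True
    have "{s \<in> T. s < x} = insert c {s \<in> T - {c}. s < x}" using that True by auto
    then have "card {s \<in> T. s < x} = Suc (card {s \<in> T - {c}. s < x})" using that(1) by simp
    then show ?thesis using True by (simp add: flip_sign_def)
  next
    case False
    then have "{s \<in> T. s < x} = {s \<in> T - {c}. s < x}" by auto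
    then show ?thesis using False by (simp add: flip_sign_def)
  qed
  have "S - {a, b} = S - {a} - {b}" by auto
  then show ?thesis using one[of "S - {a}" b] one[of S a] assms by simp
qed

lemma expansion_sign_remove:
  assumes "finite S" "a \<in> S" "b \<in> S" "a \<noteq> b"
  shows "expansion_sign (S - {a, b}) x y =
    expansion_sign S x y * flip_sign a x * flip_sign b x * flip_sign a y * flip_sign b y"
  unfolding expansion_sign_def rank_parity_remove[OF assms] by (simp only: mult_ac)

lemma sum_pairs_swap:
  fixes g :: "'b \<Rightarrow> 'b \<Rightarrow> 'a::comm_monoid_add"
  assumes "finite T"
  shows "(\<Sum>y\<in>T. \<Sum>z\<in>T - {y}. g y z) = (\<Sum>z\<in>T. \<Sum>y\<in>T - {z}. g y z)"
proof -
  have "(\<Sum>y\<in>T. \<Sum>z\<in>T - {y}. g y z) = (\<Sum>y\<in>T. \<Sum>z\<in>{z\<in>T. z \<noteq> y}. g y z)"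
    by (intro sum.cong) auto
  also have "\<dots> = (\<Sum>z\<in>T. \<Sum>y\<in>{y\<in>T. z \<noteq> y}. g y z)"
    using assms by (rule sum.swap_restrict) (rule assms)
  also have "\<dots> = (\<Sum>z\<in>T. \<Sum>y\<in>T - {z}. g y z)"
    by (intro sum.cong) auto
  finally show ?thesis .
qed

lemma sum_pairs_antisymmetric:
  fixes g :: "'b \<Rightarrow> 'b \<Rightarrow> 'a::ab_group_add"
  assumes "finite T" "\<And>y z. y \<in> T \<Longrightarrow> z \<in> T \<Longrightarrow> y \<noteq> z \<Longrightarrow> g y z = - g z y"
  shows "(\<Sum>y\<in>T. \<Sum>z\<in>T - {y}. g y z) = 0"
  using assms
proof (induction T rule: finite_induct)
  case (insert a T)
  have "(\<Sum>z\<in>insert a T - {y}. g y z) = g y a + (\<Sum>z\<in>T - {y}. g y z)" if "y \<in> T" for y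
  proof -
    have "insert a T - {y} = insert a (T - {y})" using insert.hyps that by auto
    then show ?thesis using insert.hyps by simp
  qed
  then have "(\<Sum>y\<in>insert a T. \<Sum>z\<in>insert a T - {y}. g y z) =
      (\<Sum>z\<in>T. g a z) + ((\<Sum>y\<in>T. g y a) + (\<Sum>y\<in>T. \<Sum>z\<in>T - {y}. g y z))"
    using insert.hyps by (simp add: sum.distrib)
  also have "(\<Sum>y\<in>T. \<Sum>z\<in>T - {y}. g y z) = 0"
    by (rule insert.IH, rule insert.prems) auto
  also have "(\<Sum>y\<in>T. g y a) = (\<Sum>y\<in>T. - g a y)"
    by (intro sum.cong refl insert.prems) (use insert.hyps in auto)
  finally show ?case by (simp add: sum_negf)
qed simp

text \<open>Expanding once more, along \<open>x\<close> in the expansion by the least index \<open>m\<close>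
  and along \<open>m\<close> in the expansion by \<open>x\<close>, gives the same sum over ordered
  pairs of partners of \<open>m\<close> and \<open>x\<close>. The signs agree because removing two
  elements from \<open>S\<close> changes \<open>expansion_sign\<close> by a product of flips.\<close>

lemma pfaffian_expand:
  fixes f :: "nat \<Rightarrow> nat \<Rightarrow> 'a::comm_ring_1"
  assumes skew: "\<And>x y. f y x = - f x y"
    and "finite S" "card S = 2 * Suc n" "x \<in> S"
  shows "pfaffian (Suc n) f S = (\<Sum>y\<in>S - {x}. expansion_sign S x y * f x y * pfaffian n f (S - {x, y}))"
  using assms(2-)
proof (induction n arbitrary: S x)
  case 0
  have "S \<noteq> {}" using 0 by auto
  define m where "m = Min S"
  have m: "m \<in> S" using \<open>S \<noteq> {}\<close> 0 by (simp add: m_def)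
  show ?case
  proof (cases "x = m")
    case True
    then show ?thesis by (simp add: m_def)
  next
    case False
    have "{m, x} = S"
      by (rule card_subset_eq) (use 0 m False in auto)
    then have sets: "S - {m} = {x}" "S - {x} = {m}" using False by auto
    have "pfaffian (Suc 0) f S = expansion_sign S m x * f m x"
      using sets(1) by (simp add: m_def[symmetric])
    also have "\<dots> = expansion_sign S x m * f x m"
      using skew[of m x] by (simp add: expansion_sign_def mult_ac flip_sign_swap[OF False])
    finally show ?thesis using sets(2) by simp
  qed
next
  case (Suc k)
  define m where "m = Min S"
  have "S \<noteq> {}" using Suc.prems by auto
  then have m: "m \<in> S" using Suc.prems by (simp add: m_def)
  show ?case
  proof (cases "x = m")
    case True
    then show ?thesis by (simp only: pfaffian.simps(2)[of "Suc k"] m_def)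
  next
    case False
    define T where "T = S - {m, x}"
    have fin: "finite T" using Suc.prems by (simp add: T_def)
    have Sm: "S - {m} = insert x T" "x \<notin> T" and Sx: "S - {x} = insert m T" "m \<notin> T"
      using m Suc.prems False by (auto simp: T_def)
    define g where "g y z = expansion_sign S m y * expansion_sign (S - {m, y}) x z *
        (f m y * f x z * pfaffian k f (S - {m, x, y, z}))" for y z
    have inner1: "expansion_sign S m y * f m y * pfaffian (Suc k) f (S - {m, y}) = (\<Sum>z\<in>T - {y}. g y z)"
      if y: "y \<in> T" for y
    proof -
      have "pfaffian (Suc k) f (S - {m, y}) = (\<Sum>z\<in>S - {m, y} - {x}.
          expansion_sign (S - {m, y}) x z * f x z * pfaffian k f (S - {m, y} - {x, z}))"
      proof (rule Suc.IH)
        have "card (S - {m, y}) = card S - card {m, y}"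
          using y m by (intro card_Diff_subset) (auto simp: T_def)
        moreover have "card {m, y} = 2" using y by (auto simp: T_def)
        ultimately show "card (S - {m, y}) = 2 * Suc k" using Suc.prems by simp
      qed (use y False Suc.prems in \<open>auto simp: T_def\<close>)
      moreover have "S - {m, y} - {x} = T - {y}" by (auto simp: T_def)
      moreover have "S - {m, y} - {x, z} = S - {m, x, y, z}" for z by auto
      ultimately show ?thesis by (simp add: g_def sum_distrib_left mult_ac)
    qed
    have inner2: "expansion_sign S x z * f x z * pfaffian (Suc k) f (S - {x, z}) = (\<Sum>y\<in>T - {z}. g y z)"
      if z: "z \<in> T" for z
    proof -
      have "Min (S - {x, z}) = m"
        unfolding m_def
        by (rule Min_eqI) (use Suc.prems z m False in \<open>auto simp: T_def m_def\<close>)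
      then have "pfaffian (Suc k) f (S - {x, z}) = (\<Sum>y\<in>S - {x, z} - {m}.
          expansion_sign (S - {x, z}) m y * f m y * pfaffian k f (S - {x, z} - {m, y}))" by simp
      moreover have "S - {x, z} - {m} = T - {z}" by (auto simp: T_def)
      moreover have "S - {x, z} - {m, y} = S - {m, x, y, z}" for y by auto
      ultimately have "expansion_sign S x z * f x z * pfaffian (Suc k) f (S - {x, z}) =
          (\<Sum>y\<in>T - {z}. expansion_sign S x z * expansion_sign (S - {x, z}) m y *
            (f m y * f x z * pfaffian k f (S - {m, x, y, z})))"
        by (simp add: sum_distrib_left mult_ac)
      moreover have "expansion_sign S x z * expansion_sign (S - {x, z}) m y =
          (expansion_sign S m y * expansion_sign (S - {m, y}) x z :: 'a)" if y: "y \<in> T - {z}" for y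
      proof -
        have S: "m \<in> S" "x \<in> S" "y \<in> S" "z \<in> S" "finite S" and
          ne: "m \<noteq> x" "m \<noteq> y" "m \<noteq> z" "x \<noteq> y" "x \<noteq> z" "y \<noteq> z"
          using y z m Suc.prems False by (auto simp: T_def)
        show ?thesis
          using ne
          by (simp add: expansion_sign_remove[OF S(5,1,3) ne(2)] expansion_sign_remove[OF S(5,2,4) ne(5)]
              flip_sign_swap[of x m] flip_sign_swap[of z m] flip_sign_swap[of x y] flip_sign_swap[of z y]
              mult_ac)
      qed
      ultimately show ?thesis by (simp only: g_def cong: sum.cong)
    qed
    have "pfaffian (Suc (Suc k)) f S = (\<Sum>y\<in>S - {m}.
        expansion_sign S m y * f m y * pfaffian (Suc k) f (S - {m, y}))"
      by (simp only: pfaffian.simps(2)[of "Suc k"] m_def)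
    also have "\<dots> = expansion_sign S m x * f m x * pfaffian (Suc k) f (S - {m, x}) +
        (\<Sum>y\<in>T. expansion_sign S m y * f m y * pfaffian (Suc k) f (S - {m, y}))"
      using Sm fin by (simp del: pfaffian.simps)
    also have "expansion_sign S m x * f m x = expansion_sign S x m * f x m"
      using skew[of m x] by (simp add: expansion_sign_def mult_ac flip_sign_swap[OF False])
    also have "S - {m, x} = S - {x, m}" by auto
    also have "(\<Sum>y\<in>T. expansion_sign S m y * f m y * pfaffian (Suc k) f (S - {m, y})) =
        (\<Sum>y\<in>T. \<Sum>z\<in>T - {y}. g y z)"
      using inner1 by (rule sum.cong[OF refl])
    also have "\<dots> = (\<Sum>z\<in>T. \<Sum>y\<in>T - {z}. g y z)" by (rule sum_pairs_swap[OF fin])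
    also have "\<dots> = (\<Sum>z\<in>T. expansion_sign S x z * f x z * pfaffian (Suc k) f (S - {x, z}))"
      using inner2 by (intro sum.cong refl) (simp del: pfaffian.simps)
    finally show ?thesis using Sx fin by (simp del: pfaffian.simps)
  qed
qed

text \<open>Here the row of \<open>z\<close> replaces that of \<open>x\<close>. Expanding the smaller
  Pfaffians along \<open>z\<close> leaves a sum over two partners that both belong to
  \<open>z\<close>; it is antisymmetric in them.\<close>

lemma pfaffian_alien_expansion:
  fixes f :: "nat \<Rightarrow> nat \<Rightarrow> 'a::comm_ring_1"
  assumes skew: "\<And>x y. f y x = - f x y" and diag: "\<And>x. f x x = 0"
    and S: "finite S" "card S = 2 * Suc n" "x \<in> S" "z \<in> S" "x \<noteq> z"
  shows "(\<Sum>y\<in>S - {x}. expansion_sign S x y * f z y * pfaffian n f (S - {x, y})) = 0"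
proof -
  define T where "T = S - {x, z}"
  have fin: "finite T" using S by (simp add: T_def)
  have "S - {x} = insert z T" "z \<notin> T" using S by (auto simp: T_def)
  then have eq: "(\<Sum>y\<in>S - {x}. expansion_sign S x y * f z y * pfaffian n f (S - {x, y})) =
      (\<Sum>y\<in>T. expansion_sign S x y * f z y * pfaffian n f (S - {x, y}))"
    using fin diag by simp
  show ?thesis
  proof (cases n)
    case 0
    have "card T = card S - card {x, z}" unfolding T_def using S by (intro card_Diff_subset) auto
    then have "card T = 0" using 0 S by simp
    then show ?thesis using fin eq by simp
  next
    case (Suc k)
    define g where "g y w = expansion_sign S x y * expansion_sign (S - {x, y}) z w *
        (f z y * f z w * pfaffian k f (S - {x, z, y, w}))" for y w
    have "expansion_sign S x y * f z y * pfaffian n f (S - {x, y}) = (\<Sum>w\<in>T - {y}. g y w)"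
      if y: "y \<in> T" for y
    proof -
      have "pfaffian (Suc k) f (S - {x, y}) = (\<Sum>w\<in>S - {x, y} - {z}.
          expansion_sign (S - {x, y}) z w * f z w * pfaffian k f (S - {x, y} - {z, w}))"
      proof (rule pfaffian_expand[of f, OF skew])
        have "card (S - {x, y}) = card S - card {x, y}"
          using y S by (intro card_Diff_subset) (auto simp: T_def)
        moreover have "card {x, y} = 2" using y by (auto simp: T_def)
        ultimately show "card (S - {x, y}) = 2 * Suc k" using S Suc by simp
      qed (use y S in \<open>auto simp: T_def\<close>)
      moreover have "S - {x, y} - {z} = T - {y}" by (auto simp: T_def)
      moreover have "S - {x, y} - {z, w} = S - {x, z, y, w}" for w by auto
      ultimately show ?thesis by (simp add: g_def sum_distrib_left mult_ac Suc)
    qed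
    then have "(\<Sum>y\<in>T. expansion_sign S x y * f z y * pfaffian n f (S - {x, y})) =
        (\<Sum>y\<in>T. \<Sum>w\<in>T - {y}. g y w)" by (rule sum.cong[OF refl])
    also have "\<dots> = 0"
    proof (rule sum_pairs_antisymmetric[OF fin])
      fix y w assume yw: "y \<in> T" "w \<in> T" "y \<noteq> w"
      have ne: "x \<noteq> y" "x \<noteq> w" "z \<noteq> y" "z \<noteq> w" "y \<in> S" "w \<in> S" using yw by (auto simp: T_def)
      have "expansion_sign S x y * expansion_sign (S - {x, y}) z w =
          (- (expansion_sign S x w * expansion_sign (S - {x, w}) z y) :: 'a)"
        unfolding expansion_sign_remove[OF S(1,3) ne(5,1)] expansion_sign_remove[OF S(1,3) ne(6,2)]
        using ne yw(3)
        by (simp add: flip_sign_swap[of z w] flip_sign_swap[of y z] flip_sign_swap[of y w]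
            expansion_sign_def mult_ac)
      moreover have "S - {x, z, y, w} = S - {x, z, w, y}" by auto
      ultimately show "g y w = - g w y" by (simp add: g_def mult_ac)
    qed
    finally show ?thesis using eq by simp
  qed
qed

text \<open>In the expansion along \<open>x\<close> the dependency replaces the row of \<open>x\<close> by a
  combination of the other rows, each of which contributes an alien expansion. This takes the
  place of the identity between the determinant and the square of the Pfaffian.\<close>

lemma pfaffian_singular:
  fixes f :: "nat \<Rightarrow> nat \<Rightarrow> 'a::idom"
  assumes skew: "\<And>x y. f y x = - f x y" and diag: "\<And>x. f x x = 0"
    and S: "finite S" "card S = 2 * n"
    and dep: "\<And>y. y \<in> S \<Longrightarrow> (\<Sum>z\<in>S. v z * f z y) = 0" and nz: "x \<in> S" "v x \<noteq> 0"
  shows "pfaffian n f S = 0"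
proof -
  have "card S \<noteq> 0" using S(1) nz(1) by (simp only: card_eq_0_iff) blast
  then obtain k where n: "n = Suc k" using S by (cases n) auto
  have "v x * pfaffian n f S = (\<Sum>y\<in>S - {x}. expansion_sign S x y * (v x * f x y) * pfaffian k f (S - {x, y}))"
    using pfaffian_expand[of f S k x, OF skew S(1) S(2)[unfolded n] nz(1)] by (simp add: n sum_distrib_left mult_ac del: pfaffian.simps)
  also have "\<dots> = (\<Sum>y\<in>S - {x}. expansion_sign S x y * (- (\<Sum>z\<in>S - {x}. v z * f z y)) * pfaffian k f (S - {x, y}))"
  proof (intro sum.cong refl)
    fix y assume "y \<in> S - {x}"
    then have "v x * f x y + (\<Sum>z\<in>S - {x}. v z * f z y) = 0"
      using dep[of y] sum.remove[OF S(1) nz(1), of "\<lambda>z. v z * f z y"] by simp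
    then have "v x * f x y = - (\<Sum>z\<in>S - {x}. v z * f z y)" by (simp only: eq_neg_iff_add_eq_0)
    then show "expansion_sign S x y * (v x * f x y) * pfaffian k f (S - {x, y}) =
        expansion_sign S x y * (- (\<Sum>z\<in>S - {x}. v z * f z y)) * pfaffian k f (S - {x, y})" by (simp only:)
  qed
  also have "\<dots> = - (\<Sum>y\<in>S - {x}. \<Sum>z\<in>S - {x}. v z * (expansion_sign S x y * f z y * pfaffian k f (S - {x, y})))"
    by (simp add: sum_negf sum_distrib_left sum_distrib_right mult_ac)
  also have "\<dots> = - (\<Sum>z\<in>S - {x}. v z * (\<Sum>y\<in>S - {x}. expansion_sign S x y * f z y * pfaffian k f (S - {x, y})))"
    by (subst sum.swap) (simp add: sum_distrib_left)
  also have "\<dots> = 0"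
    using pfaffian_alien_expansion[of f S k x, OF skew diag S(1) S(2)[unfolded n] nz(1)] by simp
  finally show ?thesis using nz(2) by simp
qed

lemma pfaffian_hom:
  assumes "comm_ring_hom h"
  shows "h (pfaffian n f S) = pfaffian n (\<lambda>x y. h (f x y)) S"
proof -
  interpret comm_ring_hom h by fact
  have "h (expansion_sign S x y) = expansion_sign S x y" for S x y
    by (simp add: expansion_sign_def flip_sign_def hom_distribs)
  then show ?thesis by (induction n arbitrary: S) (simp_all add: hom_distribs)
qed

section \<open>Separating vectors and updates of bounded rank\<close>

text \<open>Linear duality: a row that is not a combination of given rows is separated from them by a column
  vector. This vector is the source of the deformation direction below.\<close>

lemma span_or_separating_vector:
  fixes m :: "nat \<Rightarrow> nat \<Rightarrow> 'k::field"
  assumes "finite Y" "finite Z"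
  shows "(\<exists>e. \<forall>z\<in>Z. u z = (\<Sum>y\<in>Y. e y * m y z)) \<or>
    (\<exists>c. (\<forall>y\<in>Y. (\<Sum>z\<in>Z. m y z * c z) = 0) \<and> (\<Sum>z\<in>Z. u z * c z) \<noteq> 0)"
  using assms(1)
proof (induction Y arbitrary: u rule: finite_induct)
  case empty
  show ?case
  proof (cases "\<forall>z\<in>Z. u z = 0")
    case False
    then obtain z where z: "z \<in> Z" "u z \<noteq> 0" by blast
    then have "(\<Sum>s\<in>Z. u s * (if s = z then 1 else 0)) \<noteq> 0"
      using assms(2) by (simp add: if_distrib cong: if_cong)
    then show ?thesis by (intro disjI2 exI[of _ "\<lambda>s. if s = z then 1 else 0"]) simp
  qed simp
next
  case (insert y0 Y)
  show ?case
  proof (cases "\<exists>e. \<forall>z\<in>Z. u z = (\<Sum>y\<in>Y. e y * m y z)")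
    case True
    then obtain e where e: "\<forall>z\<in>Z. u z = (\<Sum>y\<in>Y. e y * m y z)" by blast
    have "(\<Sum>y\<in>insert y0 Y. (e(y0 := 0)) y * m y z) = (\<Sum>y\<in>Y. e y * m y z)" for z
    proof -
      have "(\<Sum>y\<in>insert y0 Y. (e(y0 := 0)) y * m y z) = (\<Sum>y\<in>Y. (e(y0 := 0)) y * m y z)"
        using insert.hyps by simp
      also have "\<dots> = (\<Sum>y\<in>Y. e y * m y z)" using insert.hyps by (intro sum.cong refl) auto
      finally show ?thesis .
    qed
    then show ?thesis using e by (intro disjI1 exI[of _ "e(y0 := 0)"]) simp
  next
    case False
    then obtain c where c: "\<forall>y\<in>Y. (\<Sum>z\<in>Z. m y z * c z) = 0" "(\<Sum>z\<in>Z. u z * c z) \<noteq> 0"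
      using insert.IH[of u] by blast
    define \<rho> where "\<rho> = (\<Sum>z\<in>Z. m y0 z * c z)"
    define \<mu> where "\<mu> = (\<Sum>z\<in>Z. u z * c z)"
    show ?thesis
    proof (cases "\<rho> = 0")
      case True
      then show ?thesis using c by (intro disjI2 exI[of _ c]) (simp add: \<rho>_def)
    next
      case nz: False
      define u' where "u' z = u z - \<mu> / \<rho> * m y0 z" for z
      show ?thesis
      proof (cases "\<exists>e. \<forall>z\<in>Z. u' z = (\<Sum>y\<in>Y. e y * m y z)")
        case True
        then obtain e where e: "\<forall>z\<in>Z. u' z = (\<Sum>y\<in>Y. e y * m y z)" by blast
        have "u z = (\<Sum>y\<in>insert y0 Y. (e(y0 := \<mu> / \<rho>)) y * m y z)" if "z \<in> Z" for z
        proof -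
          have "(\<Sum>y\<in>Y. (e(y0 := \<mu> / \<rho>)) y * m y z) = (\<Sum>y\<in>Y. e y * m y z)"
            using insert.hyps by (intro sum.cong refl) auto
          then have "(\<Sum>y\<in>insert y0 Y. (e(y0 := \<mu> / \<rho>)) y * m y z) = \<mu> / \<rho> * m y0 z + u' z"
            using insert.hyps e that by simp
          then show ?thesis by (simp add: u'_def)
        qed
        then show ?thesis by blast
      next
        case False
        then obtain c' where c': "\<forall>y\<in>Y. (\<Sum>z\<in>Z. m y z * c' z) = 0" "(\<Sum>z\<in>Z. u' z * c' z) \<noteq> 0"
          using insert.IH[of u'] by blast
        define t where "t = (\<Sum>z\<in>Z. m y0 z * c' z) / \<rho>"
        have lin: "(\<Sum>z\<in>Z. f z * (c' z - t * c z)) = (\<Sum>z\<in>Z. f z * c' z) - t * (\<Sum>z\<in>Z. f z * c z)" for f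
          by (simp add: right_diff_distrib sum_subtractf sum_distrib_left mult_ac)
        have "(\<Sum>z\<in>Z. m y z * (c' z - t * c z)) = 0" if "y \<in> insert y0 Y" for y
          using that c c' nz unfolding lin by (auto simp: t_def \<rho>_def)
        moreover have "(\<Sum>z\<in>Z. u z * (c' z - t * c z)) \<noteq> 0"
        proof -
          have "(\<Sum>z\<in>Z. u' z * c' z) = (\<Sum>z\<in>Z. u z * c' z) - \<mu> / \<rho> * (\<Sum>z\<in>Z. m y0 z * c' z)"
            by (simp only: u'_def left_diff_distrib sum_subtractf sum_distrib_left mult.assoc)
          also have "\<dots> = (\<Sum>z\<in>Z. u z * (c' z - t * c z))"
            unfolding lin by (simp add: t_def \<mu>_def[symmetric])
          finally show ?thesis using c'(2) by (simp only:) simp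
        qed
        ultimately show ?thesis by (intro disjI2 exI[of _ "\<lambda>z. c' z - t * c z"]) simp
      qed
    qed
  qed
qed

text \<open>The row of the pivot is independent of the rows \<open>Y'\<close>, which vanish in the pivot
  column, so discarding it lowers the rank.\<close>

lemma factors_through_pivot:
  assumes "factors_through m Y Z r" "Y' \<subseteq> Y" "y0 \<in> Y" "z0 \<in> Z" "m y0 z0 \<noteq> 0"
    and zero: "\<And>y. y \<in> Y' \<Longrightarrow> m y z0 = 0"
  shows "\<exists>r'. r = Suc r' \<and> factors_through m Y' Z r'"
proof -
  obtain P Q where PQ: "\<And>y z. y \<in> Y \<Longrightarrow> z \<in> Z \<Longrightarrow> m y z = (\<Sum>l<r. P y l * Q l z)"
    using assms(1) by (rule factors_throughE) blast
  have "\<exists>l0<r. Q l0 z0 \<noteq> 0"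
  proof (rule ccontr)
    assume "\<not> ?thesis"
    then have "m y0 z0 = 0" using PQ[OF assms(3,4)] by simp
    then show False using assms(5) by simp
  qed
  then obtain l0 where l0: "l0 < r" "Q l0 z0 \<noteq> 0" by blast
  have "m y z = (\<Sum>l\<in>{..<r} - {l0}. P y l * (Q l z - Q l z0 * Q l0 z / Q l0 z0))" if "y \<in> Y'" "z \<in> Z" for y z
  proof -
    have y: "y \<in> Y" using that assms(2) by blast
    have split: "m y s = P y l0 * Q l0 s + (\<Sum>l\<in>{..<r} - {l0}. P y l * Q l s)" if "s \<in> Z" for s
      using PQ[OF y that] sum.remove[of "{..<r}" l0 "\<lambda>l. P y l * Q l s"] l0(1) by simp
    have "P y l0 * Q l0 z0 = - (\<Sum>l\<in>{..<r} - {l0}. P y l * Q l z0)"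
      using split[OF assms(4)] zero[OF that(1)] by (simp only: eq_neg_iff_add_eq_0)
    then have P: "P y l0 = - (\<Sum>l\<in>{..<r} - {l0}. P y l * Q l z0) / Q l0 z0"
      using l0(2) by (metis eq_divide_imp)
    have "(\<Sum>l\<in>{..<r} - {l0}. P y l * (Q l z - Q l z0 * Q l0 z / Q l0 z0)) =
        (\<Sum>l\<in>{..<r} - {l0}. P y l * Q l z) - (\<Sum>l\<in>{..<r} - {l0}. P y l * Q l z0) / Q l0 z0 * Q l0 z"
      by (simp add: right_diff_distrib sum_subtractf sum_divide_distrib sum_distrib_left
          sum_distrib_right mult_ac)
    then show ?thesis using split[OF that(2)] P by simp
  qed
  then have "factors_through m Y' Z (r - 1)"
    by (intro factors_through_index_set[of "{..<r} - {l0}" _ _ _ _ P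
        "\<lambda>l z. Q l z - Q l z0 * Q l0 z / Q l0 z0"]) (use l0 in auto)
  then show ?thesis using l0(1) by (intro exI[of _ "r - 1"]) auto
qed

lemma factors_through_extend_rows:
  assumes "factors_through m Y Z r" "finite Y"
    and comb: "\<And>y. y \<in> Y' \<Longrightarrow> \<exists>e. \<forall>z\<in>Z. m y z = (\<Sum>s\<in>Y. e s * m s z)"
  shows "factors_through m (Y \<union> Y') Z r"
proof -
  obtain P Q where PQ: "\<And>y z. y \<in> Y \<Longrightarrow> z \<in> Z \<Longrightarrow> m y z = (\<Sum>l<r. P y l * Q l z)"
    using assms(1) by (rule factors_throughE) blast
  have "\<forall>y\<in>Y'. \<exists>e. \<forall>z\<in>Z. m y z = (\<Sum>s\<in>Y. e s * m s z)" using comb by blast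
  then obtain e where e: "\<forall>y\<in>Y'. \<forall>z\<in>Z. m y z = (\<Sum>s\<in>Y. e y s * m s z)"
    by (rule bchoice[THEN exE])
  define P' where "P' y l = (if y \<in> Y then P y l else \<Sum>s\<in>Y. e y s * P s l)" for y l
  have "m y z = (\<Sum>l<r. P' y l * Q l z)" if "y \<in> Y \<union> Y'" "z \<in> Z" for y z
  proof (cases "y \<in> Y")
    case True
    then show ?thesis using PQ[OF True that(2)] by (simp add: P'_def)
  next
    case False
    then have "m y z = (\<Sum>s\<in>Y. e y s * (\<Sum>l<r. P s l * Q l z))" using e that PQ by simp
    also have "\<dots> = (\<Sum>l<r. \<Sum>s\<in>Y. e y s * (P s l * Q l z))"
      by (subst sum.swap) (simp add: sum_distrib_left)
    also have "\<dots> = (\<Sum>l<r. P' y l * Q l z)"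
      using False by (simp add: P'_def sum_distrib_left sum_distrib_right mult_ac)
    finally show ?thesis .
  qed
  then show ?thesis
    by (intro factors_through_index_set[of "{..<r}" _ _ _ _ P' Q]) auto
qed

text \<open>The vector \<open>d\<close> already lies in the column space, so the update changes only the
  second factor.\<close>

lemma factors_through_column_update:
  assumes "factors_through m Y Z r" "\<And>y. y \<in> Y \<Longrightarrow> d y = (\<Sum>s\<in>Z. m y s * c s)"
  shows "factors_through (\<lambda>y z. m y z + d y * h z) Y Z r"
proof -
  obtain P Q where PQ: "\<And>y z. y \<in> Y \<Longrightarrow> z \<in> Z \<Longrightarrow> m y z = (\<Sum>l<r. P y l * Q l z)"
    using assms(1) by (rule factors_throughE) blast
  define Q' where "Q' l z = Q l z + (\<Sum>s\<in>Z. Q l s * c s) * h z" for l z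
  have "m y z + d y * h z = (\<Sum>l<r. P y l * Q' l z)" if "y \<in> Y" "z \<in> Z" for y z
  proof -
    have "d y = (\<Sum>s\<in>Z. (\<Sum>l<r. P y l * Q l s) * c s)" using assms(2) PQ that by simp
    also have "\<dots> = (\<Sum>l<r. \<Sum>s\<in>Z. P y l * (Q l s * c s))"
      by (subst sum.swap) (simp add: sum_distrib_left sum_distrib_right mult_ac)
    also have "\<dots> = (\<Sum>l<r. P y l * (\<Sum>s\<in>Z. Q l s * c s))" by (simp add: sum_distrib_left)
    finally show ?thesis using PQ[OF that]
      by (simp add: Q'_def distrib_left sum.distrib sum_distrib_left sum_distrib_right mult_ac)
  qed
  then show ?thesis
    by (intro factors_through_index_set[of "{..<r}" _ _ _ _ P Q']) auto
qed

lemma factors_through_row_update: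
  assumes "factors_through m Y Z r" "\<And>z. z \<in> Z \<Longrightarrow> h z = (\<Sum>s\<in>Y. c s * m s z)"
  shows "factors_through (\<lambda>y z. m y z + d y * h z) Y Z r"
proof -
  have "factors_through (\<lambda>z y. m y z + h z * d y) Z Y r"
    by (rule factors_through_column_update[OF factors_through_transpose[OF assms(1)], of h c d])
      (simp add: assms(2) mult.commute)
  from factors_through_transpose[OF this] show ?thesis by (simp add: mult.commute)
qed

lemma factors_through_rank_one_update:
  assumes "factors_through m Y Z r"
  shows "factors_through (\<lambda>y z. m y z + d y * h z) Y Z (Suc r)"
proof -
  obtain P Q where PQ: "\<And>y z. y \<in> Y \<Longrightarrow> z \<in> Z \<Longrightarrow> m y z = (\<Sum>l<r. P y l * Q l z)"
    using assms(1) by (rule factors_throughE) blast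
  define P' where "P' y l = (if l = r then d y else P y l)" for y l
  define Q' where "Q' l z = (if l = r then h z else Q l z)" for l z
  have "m y z + d y * h z = (\<Sum>l<Suc r. P' y l * Q' l z)" if "y \<in> Y" "z \<in> Z" for y z
    using PQ[OF that] by (simp add: P'_def Q'_def)
  then show ?thesis
    by (intro factors_through_index_set[of "{..<Suc r}" _ _ _ _ P' Q']) auto
qed

text \<open>The terms for \<open>(y, z)\<close> and \<open>(z, y)\<close> cancel. The diagonal is assumed to
  vanish, hence the characteristic may be two.\<close>

lemma alternating_form_zero:
  fixes m :: "nat \<Rightarrow> nat \<Rightarrow> 'k::comm_ring_1"
  assumes "finite Z" "\<And>y z. y \<in> Z \<Longrightarrow> z \<in> Z \<Longrightarrow> m z y = - m y z" "\<And>y. y \<in> Z \<Longrightarrow> m y y = 0"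
  shows "(\<Sum>y\<in>Z. c y * (\<Sum>z\<in>Z. m y z * c z)) = 0"
proof -
  have "(\<Sum>y\<in>Z. c y * (\<Sum>z\<in>Z. m y z * c z)) = (\<Sum>y\<in>Z. \<Sum>z\<in>Z - {y}. c y * m y z * c z)"
  proof (intro sum.cong refl)
    fix y assume y: "y \<in> Z"
    have "(\<Sum>z\<in>Z. m y z * c z) = (\<Sum>z\<in>Z - {y}. m y z * c z)"
      using sum.remove[OF assms(1) y, of "\<lambda>z. m y z * c z"] assms(3)[OF y] by simp
    then show "c y * (\<Sum>z\<in>Z. m y z * c z) = (\<Sum>z\<in>Z - {y}. c y * m y z * c z)"
      by (simp add: sum_distrib_left mult.assoc)
  qed
  also have "\<dots> = 0"
  proof (rule sum_pairs_antisymmetric[OF assms(1)])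
    fix y z assume "y \<in> Z" "z \<in> Z"
    then have "m y z = - m z y" by (rule assms(2)[rotated])
    then show "c y * m y z * c z = - (c z * m z y * c y)" by (simp only: mult_ac mult_minus_left mult_minus_right)
  qed
  finally show ?thesis .
qed

section \<open>Deformations of rank-dominated skew-symmetric matrices\<close>

definition skew_entries :: "nat \<Rightarrow> (nat \<Rightarrow> nat \<Rightarrow> 'k::field) \<Rightarrow> bool" where
  "skew_entries n m \<longleftrightarrow>
     (\<forall>y\<in>{1..n}. \<forall>z\<in>{1..n}. m z y = - m y z) \<and> (\<forall>y\<in>{1..n}. m y y = 0)"

text \<open>Membership in the matrix Schubert variety of \<open>w\<close>, for entry functions instead of
  matrices, so that a curve of matrices can be written pointwise.\<close>

definition rank_dominated ::
    "nat \<Rightarrow> (nat \<Rightarrow> nat \<Rightarrow> 'k::field) \<Rightarrow> (nat \<Rightarrow> nat \<Rightarrow> 'k) \<Rightarrow> bool" where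
  "rank_dominated n m w \<longleftrightarrow> (\<forall>i\<in>{1..n}. \<forall>j\<in>{1..n}. \<forall>r.
     factors_through w {1..i} {1..j} r \<longrightarrow> factors_through m {1..i} {1..j} r)"

lemma factors_through_skew_swap:
  assumes "skew_entries n m" "Y \<subseteq> {1..n}" "Z \<subseteq> {1..n}" "factors_through m Y Z r"
  shows "factors_through m Z Y r"
proof -
  obtain P Q where PQ: "\<And>y z. y \<in> Y \<Longrightarrow> z \<in> Z \<Longrightarrow> m y z = (\<Sum>l<r. P y l * Q l z)"
    using assms(4) by (rule factors_throughE) blast
  have "m z y = (\<Sum>l<r. Q l z * (- P y l))" if "y \<in> Y" "z \<in> Z" for y z
  proof -
    have "m z y = - m y z" using assms(1-3) that unfolding skew_entries_def by blast
    then show ?thesis using PQ[OF that] by (simp add: sum_negf mult.commute)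
  qed
  then show ?thesis
    by (intro factors_through_index_set[of "{..<r}" _ _ _ _ "\<lambda>z l. Q l z" "\<lambda>l y. - P y l"]) auto
qed

lemma factors_through_0_iff: "factors_through m Y Z 0 \<longleftrightarrow> (\<forall>y\<in>Y. \<forall>z\<in>Z. m y z = 0)"
  by (simp add: factors_through_def)

lemma dominated_zero_block:
  assumes "rank_dominated n m w" "i \<le> n" "j \<le> n"
    and "\<And>y z. y \<in> {1..i} \<Longrightarrow> z \<in> {1..j} \<Longrightarrow> w y z = 0" and "y \<in> {1..i}" "z \<in> {1..j}"
  shows "m y z = 0"
proof -
  have "factors_through w {1..i} {1..j} 0" unfolding factors_through_0_iff using assms(4) by blast
  then have "factors_through m {1..i} {1..j} 0"
    using assms(1-3,5,6) unfolding rank_dominated_def by auto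
  then show ?thesis using assms(5,6) unfolding factors_through_0_iff by blast
qed

text \<open>The matrix \<open>w\<close> has its pivot at \<open>(p, q)\<close>: the first nonzero entry of
  its first nonzero column. In a dominated \<open>m\<close> whose column \<open>q\<close> starts
  at \<open>x > p\<close>, or vanishes (then \<open>x = n + 1\<close>), the line \<open>m +
  \<epsilon> (d g\<^sup>T - g d\<^sup>T)\<close> stays dominated while its column \<open>q\<close>
  starts earlier.

  The vector \<open>g\<close> is column \<open>x\<close> of \<open>m\<close>. For
  \<open>d\<close>, let \<open>k\<close> be the least number such that, in the first
  \<open>k\<close> columns, some row of \<open>m\<close> in \<open>{p..<x}\<close> is not a
  combination of the rows above \<open>p\<close>; a separating vector \<open>c\<close> gives
  \<open>d = m c\<close>, zero above \<open>p\<close> and nonzero somewhere in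
  \<open>{p..<x}\<close>. If there is no such \<open>x\<close> or \<open>k\<close>, unit vectors
  serve.

  On a corner block with \<open>b\<close> rows and \<open>a\<close> columns the term \<open>d
  g\<^sup>T\<close> is a column operation if \<open>a \<ge> k\<close>, a row operation if \<open>b
  \<ge> x\<close>, and zero if \<open>b < p\<close> or \<open>a < q\<close>. In the remaining,
  bad, blocks it may raise the rank by one, but there the bound is slack: the pivot makes the rank
  of \<open>w\<close> exceed that of its rows above \<open>p\<close>, whereas the rows of
  \<open>m\<close> from \<open>p\<close> on add nothing to those above. The second term behaves in
  the same way with rows and columns exchanged, and a block that is bad for both has slack two.\<close>

lemma deformation_direction:
  fixes m w :: "nat \<Rightarrow> nat \<Rightarrow> 'k::field"
  assumes skm: "skew_entries n m" and skw: "skew_entries n w" and dom: "rank_dominated n m w"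
    and qp: "1 \<le> q" "q < p" "p \<le> n"
    and w_left: "\<And>y z. y \<in> {1..n} \<Longrightarrow> z \<in> {1..<q} \<Longrightarrow> w y z = 0"
    and w_top: "\<And>y. y \<in> {1..<p} \<Longrightarrow> w y q = 0" and w_pq: "w p q \<noteq> 0"
    and x: "p < x" "x \<le> Suc n" "\<And>y. y \<in> {1..<x} \<Longrightarrow> m y q = 0" "x \<le> n \<Longrightarrow> m x q \<noteq> 0"
  shows "\<exists>d g. (\<forall>\<epsilon>. skew_entries n (\<lambda>y z. m y z + \<epsilon> * (d y * g z - g y * d z)) \<and>
      rank_dominated n (\<lambda>y z. m y z + \<epsilon> * (d y * g z - g y * d z)) w) \<and>
    (\<exists>x'\<in>{p..<x}. d x' * g q - g x' * d q \<noteq> 0 \<and> (\<forall>y\<in>{1..<x'}. d y * g q - g y * d q = 0))"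
proof -
  have sk: "m z y = - m y z" if "y \<in> {1..n}" "z \<in> {1..n}" for y z
    using skm that unfolding skew_entries_def by blast
  have sk0: "m y y = 0" if "y \<in> {1..n}" for y
    using skm that unfolding skew_entries_def by blast
  have m_left: "m y z = 0" if "y \<in> {1..n}" "z \<in> {1..<q}" for y z
    by (rule dominated_zero_block[OF dom, of n "q - 1"]) (use w_left that qp in auto)
  define spanned where "spanned a \<longleftrightarrow> (\<forall>y\<in>{p..<x}. \<exists>e. \<forall>z\<in>{1..a}. m y z = (\<Sum>s\<in>{1..p - 1}. e s * m s z))" for a
  define k where "k = (if \<exists>a\<le>n. \<not> spanned a then LEAST a. \<not> spanned a else Suc n)"
  have below_k: "spanned a" if "a < k" "a \<le> n" for a
    using that not_less_Least[of a "\<lambda>a. \<not> spanned a"] unfolding k_def by (auto split: if_splits)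
  have "spanned q" unfolding spanned_def
  proof (intro ballI exI[of _ "\<lambda>_. 0"])
    fix y z assume "y \<in> {p..<x}" "z \<in> {1..q}"
    then show "m y z = (\<Sum>s\<in>{1..p - 1}. 0 * m s z)"
      using m_left[of y z] x(2) x(3)[of y] qp by (cases "z = q") auto
  qed
  have mono: "spanned a" if "spanned b" "a \<le> b" for a b
    unfolding spanned_def
  proof
    fix y assume "y \<in> {p..<x}"
    with that(1) have "\<exists>e. \<forall>z\<in>{1..b}. m y z = (\<Sum>s\<in>{1..p - 1}. e s * m s z)"
      unfolding spanned_def by (rule bspec)
    then obtain e where "\<forall>z\<in>{1..b}. m y z = (\<Sum>s\<in>{1..p - 1}. e s * m s z)" by (elim exE)
    then show "\<exists>e. \<forall>z\<in>{1..a}. m y z = (\<Sum>s\<in>{1..p - 1}. e s * m s z)"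
      using that(2) by (intro exI[of _ e]) auto
  qed
  have k_le: "k \<le> Suc n"
  proof (cases "\<exists>a\<le>n. \<not> spanned a")
    case True
    then obtain a where "a \<le> n" "\<not> spanned a" by blast
    have "k = (LEAST a. \<not> spanned a)" using True by (simp only: k_def if_True)
    then show ?thesis using Least_le[of "\<lambda>a. \<not> spanned a" a] \<open>a \<le> n\<close> \<open>\<not> spanned a\<close> by simp
  next
    case False
    then show ?thesis by (simp only: k_def if_False)
  qed
  have not_spanned_k: "\<not> spanned k" if "k \<le> n"
  proof -
    have "\<exists>a\<le>n. \<not> spanned a" using that by (auto simp: k_def split: if_splits)
    then have "k = (LEAST a. \<not> spanned a)" "\<exists>a. \<not> spanned a" by (auto simp only: k_def if_True)
    then show ?thesis using LeastI_ex[of "\<lambda>a. \<not> spanned a"] by simp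
  qed
  have qk: "q < k"
  proof (rule ccontr)
    assume "\<not> q < k"
    then have "spanned k" "k \<le> n" using mono[OF \<open>spanned q\<close>, of k] qp by auto
    then show False using not_spanned_k by blast
  qed
  \<comment> \<open>The value \<open>k = n + 1\<close> means that no row in \<open>{p..<x}\<close> is separated; then \<open>d\<close> need not come from the columns of \<open>m\<close>.\<close>
  have "\<exists>c d. (\<forall>y\<in>{1..<p}. d y = 0) \<and> (\<exists>y\<in>{p..<x}. d y \<noteq> 0) \<and>
      (k \<le> n \<longrightarrow> (\<forall>z. z \<notin> {1..k} \<longrightarrow> c z = 0) \<and> (\<forall>y. d y = (\<Sum>z\<in>{1..k}. m y z * c z)))"
  proof (cases "k \<le> n")
    case True
    then obtain y0 where y0: "y0 \<in> {p..<x}"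
      and "\<not> (\<exists>e. \<forall>z\<in>{1..k}. m y0 z = (\<Sum>s\<in>{1..p - 1}. e s * m s z))"
      using not_spanned_k unfolding spanned_def by blast
    then obtain c where c: "\<forall>y\<in>{1..p - 1}. (\<Sum>z\<in>{1..k}. m y z * c z) = 0"
        "(\<Sum>z\<in>{1..k}. m y0 z * c z) \<noteq> 0"
      using span_or_separating_vector[of "{1..p - 1}" "{1..k}" "m y0" m] by auto
    define c' where "c' z = (if z \<in> {1..k} then c z else 0)" for z
    have eq: "(\<Sum>z\<in>{1..k}. m y z * c' z) = (\<Sum>z\<in>{1..k}. m y z * c z)" for y
      by (intro sum.cong refl) (simp add: c'_def)
    show ?thesis
    proof (rule exI[of _ c'], rule exI[of _ "\<lambda>y. \<Sum>z\<in>{1..k}. m y z * c' z"], intro conjI impI)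
      show "\<forall>y\<in>{1..<p}. (\<Sum>z\<in>{1..k}. m y z * c' z) = 0" unfolding eq using c(1) by auto
      show "\<exists>y\<in>{p..<x}. (\<Sum>z\<in>{1..k}. m y z * c' z) \<noteq> 0" unfolding eq using c(2) y0 by blast
    qed (auto simp: c'_def)
  next
    case False
    then show ?thesis
      using x(1) by (rule_tac exI[of _ "\<lambda>_. 0"], rule_tac exI[of _ "\<lambda>y. if y = p then 1 else 0"]) auto
  qed
  then obtain c d where cd: "(\<forall>y\<in>{1..<p}. d y = 0) \<and> (\<exists>y\<in>{p..<x}. d y \<noteq> 0) \<and>
      (k \<le> n \<longrightarrow> (\<forall>z. z \<notin> {1..k} \<longrightarrow> c z = 0) \<and> (\<forall>y. d y = (\<Sum>z\<in>{1..k}. m y z * c z)))"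
    by (elim exE)
  have d_top: "d y = 0" if "y \<in> {1..<p}" for y using cd that by blast
  have d_ne: "\<exists>y\<in>{p..<x}. d y \<noteq> 0" using cd by blast
  have c: "c z = 0" if "k \<le> n" "z \<notin> {1..k}" for z using cd that by blast
  have d: "d y = (\<Sum>z\<in>{1..k}. m y z * c z)" if "k \<le> n" for y using cd that by blast
  define g where "g z = (if x \<le> n then m z x else if z = q then 1 else 0)" for z
  have g_left: "g z = 0" if "z \<in> {1..<q}" for z
  proof (cases "x \<le> n")
    case True
    then have "m z x = - m x z" "m x z = 0" using sk[of x z] m_left[of x z] that qp x(1) by auto
    then show ?thesis using True by (simp add: g_def)
  qed (use that in \<open>auto simp: g_def\<close>)
  have g_q: "g q \<noteq> 0"
  proof (cases "x \<le> n")
    case True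
    then have "m q x = - m x q" using sk[of x q] qp x(1) by auto
    then show ?thesis using True x(4) by (simp add: g_def)
  qed (simp add: g_def)
  have d_q: "d q = 0" using d_top qp by auto
  define bad where "bad b a \<longleftrightarrow> p \<le> b \<and> b < x \<and> q \<le> a \<and> a < k" for b a
  have slack: "\<exists>r0. factors_through m {1..b} {1..a} r0 \<and> r0 + of_bool (bad b a) + of_bool (bad a b) \<le> r"
    if w: "factors_through w {1..b} {1..a} r" and ba: "b \<in> {1..n}" "a \<in> {1..n}" for a b r
  proof -
    have step: "\<exists>r'. r = Suc r' \<and> factors_through w {1..p - 1} {1..a} r'"
      if "factors_through w {1..b} {1..a} r" "p \<le> b" "q \<le> a" for a b r
      by (rule factors_through_pivot[OF that(1), of _ p q]) (use that qp w_top w_pq in auto)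
    have dominated: "factors_through m {1..b} {1..a} r"
      if "factors_through w {1..b} {1..a} r" "b \<in> {1..n}" "a \<in> {1..n}" for a b r
      using dom that unfolding rank_dominated_def by blast
    have extend: "factors_through m {1..b} {1..a} r"
      if "factors_through m {1..p - 1} {1..a} r" "p \<le> b" "b < x" "a < k" "a \<le> n" for a b r
    proof -
      have "factors_through m ({1..p - 1} \<union> {p..b}) {1..a} r"
      proof (rule factors_through_extend_rows[OF that(1)])
        fix y assume "y \<in> {p..b}"
        then show "\<exists>e. \<forall>z\<in>{1..a}. m y z = (\<Sum>s\<in>{1..p - 1}. e s * m s z)"
          using below_k[OF that(4,5)] that(3) unfolding spanned_def by auto
      qed simp
      moreover have "{1..p - 1} \<union> {p..b} = {1..b}" using that(2) qp by auto
      ultimately show ?thesis by simp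
    qed
    \<comment> \<open>The pivot of \<open>w\<close> costs one rank when the rows from \<open>p\<close> on are dropped; for \<open>m\<close> they come back for free.\<close>
    have single: "\<exists>r0. factors_through m {1..b} {1..a} r0 \<and> Suc r0 \<le> r"
      if bad: "bad b a" and fac: "factors_through w {1..b} {1..a} r" and a: "a \<in> {1..n}" for a b r
    proof -
      obtain r' where r': "r = Suc r'" "factors_through w {1..p - 1} {1..a} r'"
        using step[OF fac] bad unfolding bad_def by blast
      have "factors_through m {1..p - 1} {1..a} r'"
        by (rule dominated) (use r'(2) qp a in auto)
      then have "factors_through m {1..b} {1..a} r'"
        by (rule extend) (use bad a in \<open>auto simp: bad_def\<close>)
      then show ?thesis using r'(1) by (intro exI[of _ r']) simp
    qed
    consider "\<not> bad b a" "\<not> bad a b" | "bad b a" "\<not> bad a b" | "\<not> bad b a" "bad a b" | "bad b a" "bad a b"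
      by blast
    then show ?thesis
    proof cases
      case 1
      then show ?thesis using dominated[OF w ba] by (intro exI[of _ r]) simp
    next
      case 2
      obtain r0 where "factors_through m {1..b} {1..a} r0" "Suc r0 \<le> r"
        using single[OF 2(1) w ba(2)] by blast
      then show ?thesis using 2 by (intro exI[of _ r0]) simp
    next
      case 3
      have "factors_through w {1..a} {1..b} r"
        by (rule factors_through_skew_swap[OF skw _ _ w]) (use ba in auto)
      from single[OF 3(2) this ba(1)] obtain r0 where
        r0: "factors_through m {1..a} {1..b} r0" "Suc r0 \<le> r" by blast
      have "factors_through m {1..b} {1..a} r0"
        by (rule factors_through_skew_swap[OF skm _ _ r0(1)]) (use ba in auto)
      then show ?thesis using r0(2) 3 by (intro exI[of _ r0]) simp
    next
      case 4
      then have pa: "p \<le> b" "p \<le> a" "b < x" "a < x" "a < k" "b < k" "p - 1 < k" "q \<le> p - 1"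
        using qp unfolding bad_def by auto
      have sub: "{1..p - 1} \<subseteq> {1..n}" "{1..b} \<subseteq> {1..n}" "{1..a} \<subseteq> {1..n}" using ba qp by auto
      \<comment> \<open>A doubly bad block extends beyond the pivot in rows and in columns, so the pivot and its mirror image both count.\<close>
      obtain r1 where r1: "r = Suc r1" "factors_through w {1..p - 1} {1..a} r1"
        using step[OF w] 4(1) unfolding bad_def by blast
      have "factors_through w {1..a} {1..p - 1} r1"
        by (rule factors_through_skew_swap[OF skw _ _ r1(2)]) (use ba qp in auto)
      then obtain r2 where r2: "r1 = Suc r2" "factors_through w {1..p - 1} {1..p - 1} r2"
        using step pa by blast
      have "factors_through m {1..p - 1} {1..p - 1} r2"
        by (rule dominated) (use r2(2) qp in auto)
      then have "factors_through m {1..b} {1..p - 1} r2"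
        by (rule extend) (use pa qp in auto)
      from factors_through_skew_swap[OF skm sub(2,1) this]
      have "factors_through m {1..p - 1} {1..b} r2" .
      then have "factors_through m {1..a} {1..b} r2"
        by (rule extend) (use pa ba in auto)
      from factors_through_skew_swap[OF skm sub(3,2) this]
      have "factors_through m {1..b} {1..a} r2" .
      then show ?thesis using r1(1) r2(1) 4 by (intro exI[of _ r2]) simp
    qed
  qed
  \<comment> \<open>The two rank-one terms are added one after the other; each raises the rank only in its bad blocks.\<close>
  have dom': "rank_dominated n (\<lambda>y z. m y z + \<epsilon> * (d y * g z - g y * d z)) w" for \<epsilon>
    unfolding rank_dominated_def
  proof (intro ballI allI impI)
    fix b a r assume ba: "b \<in> {1..n}" "a \<in> {1..n}" and "factors_through w {1..b} {1..a} r"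
    from slack[OF this(3) ba] obtain r0 where r0: "factors_through m {1..b} {1..a} r0"
      and le: "r0 + of_bool (bad b a) + of_bool (bad a b) \<le> r" by blast
    define m1 where "m1 y z = m y z + (\<epsilon> * d y) * g z" for y z
    have 1: "factors_through m1 {1..b} {1..a} (r0 + of_bool (bad b a))"
    proof (cases "bad b a")
      case True
      have "factors_through m1 {1..b} {1..a} (Suc r0)"
        unfolding m1_def by (rule factors_through_rank_one_update[OF r0])
      then show ?thesis using True by (simp only: of_bool_eq add_Suc_right add_0_right One_nat_def)
    next
      case False
      then consider "k \<le> a" | "x \<le> b" | "b < p" | "a < q" unfolding bad_def by linarith
      then have "factors_through m1 {1..b} {1..a} r0"
      proof cases
        case 1
        have "\<epsilon> * d y = (\<Sum>s\<in>{1..a}. m y s * (\<epsilon> * c s))" for y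
        proof -
          have "(\<Sum>s\<in>{1..a}. m y s * (\<epsilon> * c s)) = (\<Sum>s\<in>{1..k}. m y s * (\<epsilon> * c s))"
            using 1 ba c by (intro sum.mono_neutral_right) auto
          then show ?thesis using 1 ba d[of y] by (simp add: sum_distrib_left mult_ac)
        qed
        then show ?thesis unfolding m1_def
          by (rule factors_through_column_update[OF r0, of "\<lambda>y. \<epsilon> * d y" "\<lambda>s. \<epsilon> * c s"])
      next
        case 2
        have "g z = (\<Sum>s\<in>{1..b}. (if s = x then - 1 else 0) * m s z)" if "z \<in> {1..a}" for z
        proof -
          have "(\<Sum>s\<in>{1..b}. (if s = x then - 1 else 0) * m s z) = (\<Sum>s\<in>{1..b}. if s = x then - m x z else 0)"
            by (intro sum.cong refl) auto
          also have "\<dots> = - m x z" using 2 x(1) qp by simp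
          also have "\<dots> = m z x" using sk[of x z] that ba 2 x(1) by auto
          finally show ?thesis using 2 ba by (simp add: g_def)
        qed
        then show ?thesis unfolding m1_def
          by (rule factors_through_row_update[OF r0, of g "\<lambda>s. if s = x then - 1 else 0"])
      next
        case 3
        have "m1 y z = m y z" if "y \<in> {1..b}" for y z
          using that 3 d_top[of y] by (simp add: m1_def)
        then show ?thesis using r0 factors_through_cong[of "{1..b}" "{1..a}" m1 m] by blast
      next
        case 4
        have "m1 y z = m y z" if "z \<in> {1..a}" for y z
          using that 4 g_left[of z] by (simp add: m1_def)
        then show ?thesis using r0 factors_through_cong[of "{1..b}" "{1..a}" m1 m] by blast
      qed
      then show ?thesis using False by simp
    qed
    define N where "N y z = m1 y z + (- \<epsilon> * g y) * d z" for y z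
    have 2: "factors_through N {1..b} {1..a} (r0 + of_bool (bad b a) + of_bool (bad a b))"
    proof (cases "bad a b")
      case True
      have "factors_through N {1..b} {1..a} (Suc (r0 + of_bool (bad b a)))"
        unfolding N_def by (rule factors_through_rank_one_update[OF 1])
      then show ?thesis using True by (simp only: of_bool_eq add_Suc_right add_0_right One_nat_def)
    next
      case False
      then consider "k \<le> b" | "x \<le> a" | "a < p" | "b < q" unfolding bad_def by linarith
      then have "factors_through N {1..b} {1..a} (r0 + of_bool (bad b a))"
      proof cases
        case k: 1
        \<comment> \<open>The first term has already changed the rows; its effect on the combination by \<open>c\<close> is the alternating form at \<open>c\<close>.\<close>
        have zero: "(\<Sum>s\<in>{1..k}. c s * d s) = 0"
        proof -
          have "(\<Sum>y\<in>{1..k}. c y * (\<Sum>z\<in>{1..k}. m y z * c z)) = 0"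
          proof (rule alternating_form_zero)
            fix y z assume "y \<in> {1..k}" "z \<in> {1..k}"
            then show "m z y = - m y z" by (intro sk) (use k ba in auto)
          next
            fix y assume "y \<in> {1..k}"
            then show "m y y = 0" by (intro sk0) (use k ba in auto)
          qed simp
          moreover have "k \<le> n" using k ba by simp
          ultimately show ?thesis using d by simp
        qed
        have "d z = (\<Sum>s\<in>{1..b}. - c s * m1 s z)" if z: "z \<in> {1..a}" for z
        proof -
          have "(\<Sum>s\<in>{1..b}. - c s * m1 s z) = (\<Sum>s\<in>{1..k}. - c s * m1 s z)"
            using k ba c by (intro sum.mono_neutral_right) auto
          also have "\<dots> = (\<Sum>s\<in>{1..k}. m z s * c s - \<epsilon> * g z * (c s * d s))"
          proof (intro sum.cong refl)
            fix s assume "s \<in> {1..k}"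
            then have "m z s = - m s z" using sk[of s z] k ba z by auto
            then show "- c s * m1 s z = m z s * c s - \<epsilon> * g z * (c s * d s)"
              by (simp add: m1_def algebra_simps)
          qed
          also have "\<dots> = (\<Sum>s\<in>{1..k}. m z s * c s) - \<epsilon> * g z * (\<Sum>s\<in>{1..k}. c s * d s)"
            by (simp only: sum_subtractf sum_distrib_left)
          also have "\<dots> = d z" using zero d[of z] k ba by simp
          finally show ?thesis by (rule sym)
        qed
        then show ?thesis unfolding N_def
          by (rule factors_through_row_update[OF 1, of d "\<lambda>s. - c s"])
      next
        case xa: 2
        have "- \<epsilon> * g y = (\<Sum>s\<in>{1..a}. m1 y s * (if s = x then - \<epsilon> else 0))" for y
        proof -
          have "(\<Sum>s\<in>{1..a}. m1 y s * (if s = x then - \<epsilon> else 0)) = (\<Sum>s\<in>{1..a}. if s = x then - \<epsilon> * m1 y x else 0)"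
            by (intro sum.cong refl) auto
          also have "\<dots> = - \<epsilon> * m1 y x" using xa x(1) qp by simp
          also have "m1 y x = m y x" using sk0[of x] xa ba x(1) qp by (simp add: m1_def g_def)
          finally show ?thesis using xa ba by (simp add: g_def)
        qed
        then show ?thesis unfolding N_def
          by (rule factors_through_column_update[OF 1, of "\<lambda>y. - \<epsilon> * g y" "\<lambda>s. if s = x then - \<epsilon> else 0"])
      next
        case 3
        have "N y z = m1 y z" if "z \<in> {1..a}" for y z
          using that 3 d_top[of z] by (simp add: N_def)
        then show ?thesis using 1 factors_through_cong[of "{1..b}" "{1..a}" N m1] by blast
      next
        case 4
        have "N y z = m1 y z" if "y \<in> {1..b}" for y z
          using that 4 g_left[of y] by (simp add: N_def)
        then show ?thesis using 1 factors_through_cong[of "{1..b}" "{1..a}" N m1] by blast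
      qed
      then show ?thesis using False by simp
    qed
    have "N = (\<lambda>y z. m y z + \<epsilon> * (d y * g z - g y * d z))"
      by (intro ext) (simp add: N_def m1_def algebra_simps)
    then show "factors_through (\<lambda>y z. m y z + \<epsilon> * (d y * g z - g y * d z)) {1..b} {1..a} r"
      using factors_through_mono[OF 2 le order_refl order_refl] by simp
  qed
  have skew': "skew_entries n (\<lambda>y z. m y z + \<epsilon> * (d y * g z - g y * d z))" for \<epsilon>
    unfolding skew_entries_def
  proof (intro conjI ballI)
    fix y z assume "y \<in> {1..n}" "z \<in> {1..n}"
    then have "m z y = - m y z" by (rule sk)
    then show "m z y + \<epsilon> * (d z * g y - g z * d y) = - (m y z + \<epsilon> * (d y * g z - g y * d z))"
      by (simp add: algebra_simps)
  next
    fix y assume "y \<in> {1..n}"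
    then show "m y y + \<epsilon> * (d y * g y - g y * d y) = 0" using sk0 by simp
  qed
  define x' where "x' = (LEAST y. y \<in> {p..<x} \<and> d y \<noteq> 0)"
  have x': "x' \<in> {p..<x}" "d x' \<noteq> 0"
    using d_ne LeastI_ex[of "\<lambda>y. y \<in> {p..<x} \<and> d y \<noteq> 0"] unfolding x'_def by blast+
  have "d y = 0" if "y \<in> {1..<x'}" for y
  proof (cases "y < p")
    case True
    then show ?thesis using d_top that by simp
  next
    case False
    then show ?thesis
      using not_less_Least[of y "\<lambda>y. y \<in> {p..<x} \<and> d y \<noteq> 0"] that x'(1) unfolding x'_def by auto
  qed
  then have "\<forall>y\<in>{1..<x'}. d y * g q - g y * d q = 0" using d_q by simp
  moreover have "d x' * g q - g x' * d q \<noteq> 0" using x'(2) g_q d_q by simp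
  ultimately show ?thesis using dom' skew' x'(1) by (intro exI[of _ d] exI[of _ g]) blast
qed

text \<open>The start of column \<open>q\<close> moves upwards along each deformation, until it reaches the
  pivot row \<open>p\<close>; it cannot get above \<open>p\<close>, since there the column
  vanishes by domination. In geometric terms, the locus with nonzero pivot entry is dense.\<close>

lemma dominated_deformation_induct:
  fixes w :: "nat \<Rightarrow> nat \<Rightarrow> 'k::field" and Pr :: "(nat \<Rightarrow> nat \<Rightarrow> 'k) \<Rightarrow> bool"
  assumes skm: "skew_entries n m" and skw: "skew_entries n w" and dom: "rank_dominated n m w"
    and qp: "1 \<le> q" "q < p" "p \<le> n"
    and w_left: "\<And>y z. y \<in> {1..n} \<Longrightarrow> z \<in> {1..<q} \<Longrightarrow> w y z = 0"
    and w_top: "\<And>y. y \<in> {1..<p} \<Longrightarrow> w y q = 0" and w_pq: "w p q \<noteq> 0"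
    and generic: "\<And>m. skew_entries n m \<Longrightarrow> rank_dominated n m w \<Longrightarrow> m p q \<noteq> 0 \<Longrightarrow> Pr m"
    and limit: "\<And>m h. (\<And>\<epsilon>. \<epsilon> \<noteq> 0 \<Longrightarrow> Pr (\<lambda>y z. m y z + \<epsilon> * h y z)) \<Longrightarrow> Pr m"
  shows "Pr m"
proof -
  have main: "Pr m" if "skew_entries n m" "rank_dominated n m w" "p \<le> x" "x \<le> Suc n"
    "\<And>y. y \<in> {1..<x} \<Longrightarrow> m y q = 0" "x \<le> n \<Longrightarrow> m x q \<noteq> 0" for x m
    using that
  proof (induction x arbitrary: m rule: less_induct)
    case (less x)
    show ?case
    proof (cases "x = p")
      case True
      then show ?thesis using less.prems qp by (intro generic) auto
    next
      case False
      then have "p < x" using less.prems by simp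
      from deformation_direction[OF less.prems(1) skw less.prems(2) qp w_left w_top w_pq
          \<open>p < x\<close> less.prems(4,5,6)]
      obtain d g x' where
        N: "\<And>\<epsilon>. skew_entries n (\<lambda>y z. m y z + \<epsilon> * (d y * g z - g y * d z))"
          "\<And>\<epsilon>. rank_dominated n (\<lambda>y z. m y z + \<epsilon> * (d y * g z - g y * d z)) w"
        and x': "x' \<in> {p..<x}" "d x' * g q - g x' * d q \<noteq> 0"
          "\<And>y. y \<in> {1..<x'} \<Longrightarrow> d y * g q - g y * d q = 0"
        by blast
      show ?thesis
      proof (rule limit[of _ "\<lambda>y z. d y * g z - g y * d z"])
        fix \<epsilon> :: 'k assume "\<epsilon> \<noteq> 0"
        show "Pr (\<lambda>y z. m y z + \<epsilon> * (d y * g z - g y * d z))"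
        proof (rule less.IH[of x'])
          show "m y q + \<epsilon> * (d y * g q - g y * d q) = 0" if "y \<in> {1..<x'}" for y
            using x'(1) x'(3)[OF that] less.prems(5)[of y] that by simp
          show "m x' q + \<epsilon> * (d x' * g q - g x' * d q) \<noteq> 0"
            using x'(1,2) less.prems(5)[of x'] qp \<open>\<epsilon> \<noteq> 0\<close> by simp
        qed (use N x'(1) less.prems(4) in auto)
      qed
    qed
  qed
  define x where "x = (LEAST y. y = Suc n \<or> (1 \<le> y \<and> y \<le> n \<and> m y q \<noteq> 0))"
  have x: "x = Suc n \<or> (1 \<le> x \<and> x \<le> n \<and> m x q \<noteq> 0)"
    unfolding x_def by (rule LeastI[of _ "Suc n"]) simp
  have least: "m y q = 0" if "y \<in> {1..<x}" for y
    using not_less_Least[of y "\<lambda>y. y = Suc n \<or> (1 \<le> y \<and> y \<le> n \<and> m y q \<noteq> 0)"] that x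
    unfolding x_def[symmetric] by auto
  have "m y q = 0" if "y \<in> {1..p - 1}" for y
  proof (rule dominated_zero_block[OF dom, of "p - 1" q])
    fix y z assume "y \<in> {1..p - 1}" "z \<in> {1..q}"
    then show "w y z = 0" using w_left[of y z] w_top[of y] qp by (cases "z = q") auto
  qed (use that qp in auto)
  then have "\<not> x < p" using x qp by fastforce
  then show ?thesis using main[OF skm dom, of x] x least by auto
qed

section \<open>Polynomial evaluation and monomial ideals\<close>

definition mon_value :: "('x \<Rightarrow> 'k) \<Rightarrow> 'x mon \<Rightarrow> 'k::field" where
  "mon_value v m = (\<Prod>x\<in>Poly_Mapping.keys m. v x ^ Poly_Mapping.lookup m x)"

lemma mon_value_superset:
  assumes "finite S" "Poly_Mapping.keys m \<subseteq> S"
  shows "mon_value v m = (\<Prod>x\<in>S. v x ^ Poly_Mapping.lookup m x)"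
  unfolding mon_value_def
  by (rule prod.mono_neutral_left) (use assms in \<open>auto simp: in_keys_iff\<close>)

lemma mon_value_add: "mon_value v (a + b) = mon_value v a * mon_value v b"
proof -
  let ?S = "Poly_Mapping.keys a \<union> Poly_Mapping.keys b"
  have "mon_value v (a + b) = (\<Prod>x\<in>?S. v x ^ Poly_Mapping.lookup (a + b) x)"
    by (rule mon_value_superset) (use keys_add[of a b] in auto)
  then show ?thesis
    by (simp add: mon_value_superset[of ?S a] mon_value_superset[of ?S b] lookup_add power_add
        prod.distrib)
qed

lemma poly_eval_superset:
  assumes "finite S" "Poly_Mapping.keys p \<subseteq> S"
  shows "poly_eval v p = (\<Sum>m\<in>S. Poly_Mapping.lookup p m * mon_value v m)"
  unfolding poly_eval_def mon_value_def
  by (rule sum.mono_neutral_left) (use assms in \<open>auto simp: in_keys_iff\<close>)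

lemma poly_eval_add: "poly_eval v (p + q) = poly_eval v p + poly_eval v q"
proof -
  let ?S = "Poly_Mapping.keys p \<union> Poly_Mapping.keys q"
  have "poly_eval v (p + q) = (\<Sum>m\<in>?S. Poly_Mapping.lookup (p + q) m * mon_value v m)"
    by (rule poly_eval_superset) (use keys_add[of p q] in auto)
  then show ?thesis
    by (simp add: poly_eval_superset[of ?S p] poly_eval_superset[of ?S q] lookup_add
        distrib_right sum.distrib)
qed

lemma poly_eval_single: "poly_eval v (Poly_Mapping.single m c) = c * mon_value v m"
  by (subst poly_eval_superset[of "{m}"]) auto

lemma poly_eval_0: "poly_eval v 0 = 0"
  by (simp add: poly_eval_def)

lemma poly_eval_sum: "poly_eval v (\<Sum>i\<in>A. f i) = (\<Sum>i\<in>A. poly_eval v (f i))"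
  by (induction A rule: infinite_finite_induct) (simp_all add: poly_eval_0 poly_eval_add)

lemma sum_of_terms: "p = (\<Sum>m\<in>Poly_Mapping.keys p. Poly_Mapping.single m (Poly_Mapping.lookup p m))"
proof (rule poly_mapping_eqI)
  fix k
  have "Poly_Mapping.lookup (\<Sum>m\<in>Poly_Mapping.keys p. Poly_Mapping.single m (Poly_Mapping.lookup p m)) k =
      (\<Sum>m\<in>Poly_Mapping.keys p. if m = k then Poly_Mapping.lookup p k else 0)"
    unfolding lookup_sum by (intro sum.cong refl) (auto simp: lookup_single when_def)
  also have "\<dots> = Poly_Mapping.lookup p k"
    by (simp add: in_keys_iff)
  finally show "Poly_Mapping.lookup p k = Poly_Mapping.lookup
      (\<Sum>m\<in>Poly_Mapping.keys p. Poly_Mapping.single m (Poly_Mapping.lookup p m)) k" by simp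
qed

lemma poly_eval_mult: "poly_eval v (p * q) = poly_eval v p * poly_eval v q"
proof -
  have "p * q = (\<Sum>a\<in>Poly_Mapping.keys p. \<Sum>b\<in>Poly_Mapping.keys q.
      Poly_Mapping.single (a + b) (Poly_Mapping.lookup p a * Poly_Mapping.lookup q b))"
    by (subst (1) sum_of_terms[of p], subst (1) sum_of_terms[of q]) (simp add: sum_product mult_single)
  then have "poly_eval v (p * q) = (\<Sum>a\<in>Poly_Mapping.keys p. \<Sum>b\<in>Poly_Mapping.keys q.
      Poly_Mapping.lookup p a * Poly_Mapping.lookup q b * (mon_value v a * mon_value v b))"
    by (simp only: poly_eval_sum poly_eval_single mon_value_add)
  also have "\<dots> = poly_eval v p * poly_eval v q"
    unfolding poly_eval_superset[OF finite_keys order_refl] sum_product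
    by (simp only: mult_ac)
  finally show ?thesis .
qed

lemma poly_eval_const: "poly_eval v (const_poly c) = c"
  by (simp add: const_poly_def poly_eval_single mon_value_def)

lemma poly_eval_comm_ring_hom: "comm_ring_hom (poly_eval v)"
proof
  show "poly_eval v 1 = 1"
    using poly_eval_const[of v 1] by (simp add: const_poly_def)
qed (simp_all add: poly_eval_0 poly_eval_add poly_eval_mult)

lemma poly_eval_mon_poly: "poly_eval v (mon_poly m) = mon_value v m"
  by (simp add: mon_poly_def poly_eval_single)

lemma poly_eval_var: "poly_eval v (var_poly x) = v x"
  by (simp add: var_poly_def poly_eval_mon_poly mon_value_def)

lemma poly_eval_zero_point:
  fixes p :: "('x, 'k::field) mpoly"
  shows "poly_eval (\<lambda>x. 0) p = Poly_Mapping.lookup p 0"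
proof -
  have "mon_value (\<lambda>x. 0 :: 'k) m = (if m = 0 then 1 else 0)" for m :: "'x mon"
  proof (cases "m = 0")
    case False
    then obtain x where "x \<in> Poly_Mapping.keys m" by (metis ex_in_conv keys_eq_empty)
    then show ?thesis using False by (auto simp: mon_value_def in_keys_iff)
  qed (simp add: mon_value_def)
  then have "poly_eval (\<lambda>x. 0) p = (\<Sum>m\<in>insert 0 (Poly_Mapping.keys p). Poly_Mapping.lookup p m * (if m = 0 then 1 else 0))"
    using poly_eval_superset[of "insert 0 (Poly_Mapping.keys p)" p "\<lambda>x. 0"] by auto
  also have "\<dots> = Poly_Mapping.lookup p 0"
    by (simp add: if_distrib cong: if_cong)
  finally show ?thesis .
qed

lemma poly_eval_cong:
  assumes "p \<in> carrier (poly_ring X)" "\<And>x. x \<in> X \<Longrightarrow> v x = v' x"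
  shows "poly_eval v p = poly_eval v' p"
  unfolding poly_eval_def
proof (intro sum.cong refl arg_cong2[of _ _ _ _ "(*)"] prod.cong)
  fix m x assume "m \<in> Poly_Mapping.keys p" "x \<in> Poly_Mapping.keys m"
  then have "x \<in> X" using assms(1) by (auto simp: poly_ring_def mons_def)
  then show "v x ^ Poly_Mapping.lookup m x = v' x ^ Poly_Mapping.lookup m x" using assms(2) by simp
qed

text \<open>On a line in affine space a polynomial in many variables becomes a univariate one, whose roots
  can be counted.\<close>

lemma poly_eval_line_is_poly:
  "\<exists>P :: 'k::field poly. \<forall>\<epsilon>. poly P \<epsilon> = poly_eval (\<lambda>x. a x + \<epsilon> * b x) p"
proof -
  define P where "P = (\<Sum>m\<in>Poly_Mapping.keys p. [:Poly_Mapping.lookup p m:] *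
      (\<Prod>x\<in>Poly_Mapping.keys m. [:a x, b x:] ^ Poly_Mapping.lookup m x))"
  have "poly P \<epsilon> = poly_eval (\<lambda>x. a x + \<epsilon> * b x) p" for \<epsilon>
    by (simp add: P_def poly_eval_def poly_sum poly_prod poly_power)
  then show ?thesis by blast
qed

lemma poly_ring_sel:
  "monoid.mult (poly_ring X) = (*)" "one (poly_ring X) = 1" "zero (poly_ring X) = 0"
  "add (poly_ring X) = (+)"
  by (simp_all add: poly_ring_def)

lemma carrier_poly_ring: "p \<in> carrier (poly_ring X) \<longleftrightarrow> Poly_Mapping.keys p \<subseteq> mons X"
  by (simp add: poly_ring_def)

lemma single_in_carrier: "m \<in> mons X \<Longrightarrow> Poly_Mapping.single m c \<in> carrier (poly_ring X)"
  by (simp add: carrier_poly_ring)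

lemma carrier_0: "0 \<in> carrier (poly_ring X)" and carrier_1: "1 \<in> carrier (poly_ring X)"
  by (simp_all add: carrier_poly_ring zero_in_mons)

lemma carrier_add:
  "p \<in> carrier (poly_ring X) \<Longrightarrow> q \<in> carrier (poly_ring X) \<Longrightarrow> p + q \<in> carrier (poly_ring X)"
  using keys_add[of p q] by (auto simp: carrier_poly_ring)

lemma carrier_uminus: "p \<in> carrier (poly_ring X) \<Longrightarrow> - p \<in> carrier (poly_ring X)"
  by (auto simp: carrier_poly_ring in_keys_iff)

lemma carrier_mult:
  "p \<in> carrier (poly_ring X) \<Longrightarrow> q \<in> carrier (poly_ring X) \<Longrightarrow> p * q \<in> carrier (poly_ring X)"
  using keys_mult[of p q] add_in_mons by (fastforce simp: carrier_poly_ring)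

lemma carrier_sum:
  fixes f :: "'i \<Rightarrow> ('x, 'k::field) mpoly"
  shows "(\<And>a. a \<in> A \<Longrightarrow> f a \<in> carrier (poly_ring X)) \<Longrightarrow> sum f A \<in> carrier (poly_ring X)"
  by (induction A rule: infinite_finite_induct) (auto intro: carrier_0 carrier_add)

lemma carrier_prod:
  fixes f :: "'i \<Rightarrow> ('x, 'k::field) mpoly"
  shows "(\<And>a. a \<in> A \<Longrightarrow> f a \<in> carrier (poly_ring X)) \<Longrightarrow> prod f A \<in> carrier (poly_ring X)"
  by (induction A rule: infinite_finite_induct) (auto intro: carrier_1 carrier_mult)

lemma poly_idealI:
  fixes I :: "('x, 'k::field) mpoly set"
  assumes "I \<subseteq> carrier (poly_ring X)" "0 \<in> I"
    and "\<And>a b. a \<in> I \<Longrightarrow> b \<in> I \<Longrightarrow> a + b \<in> I"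
    and mult: "\<And>a c. a \<in> I \<Longrightarrow> c \<in> carrier (poly_ring X) \<Longrightarrow> c * a \<in> I"
  shows "ideal I (poly_ring X)"
proof -
  interpret R: cring "poly_ring X :: ('x, 'k) mpoly ring" by (rule cring_poly_ring)
  have neg: "inv\<^bsub>add_monoid (poly_ring X)\<^esub> a \<in> I" if "a \<in> I" for a
  proof -
    have a: "a \<in> carrier (poly_ring X)" using that assms(1) by blast
    have "\<ominus>\<^bsub>poly_ring X\<^esub> a = - a"
      by (rule R.minus_equality) (use a in \<open>simp_all add: poly_ring_sel carrier_uminus\<close>)
    moreover have "- 1 * a \<in> I" using that by (intro mult carrier_uminus carrier_1)
    ultimately show ?thesis by (simp add: a_inv_def)
  qed
  show ?thesis
  proof (intro idealI R.ring_axioms subgroup.intro)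
    fix a x :: "('x, 'k) mpoly" assume "a \<in> I" "x \<in> carrier (poly_ring X)"
    then show "x \<otimes>\<^bsub>poly_ring X\<^esub> a \<in> I" "a \<otimes>\<^bsub>poly_ring X\<^esub> x \<in> I"
      using mult[of a x] by (simp_all add: poly_ring_sel mult.commute)
  qed (use assms neg in \<open>simp_all add: poly_ring_sel\<close>)
qed

lemma
  fixes I :: "('x, 'k::field) mpoly set"
  assumes "ideal I (poly_ring X)"
  shows ideal_0: "0 \<in> I"
    and ideal_add: "a \<in> I \<Longrightarrow> b \<in> I \<Longrightarrow> a + b \<in> I"
    and ideal_mult: "a \<in> I \<Longrightarrow> c \<in> carrier (poly_ring X) \<Longrightarrow> c * a \<in> I"
proof -
  interpret ideal I "poly_ring X :: ('x, 'k) mpoly ring" by fact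
  show "0 \<in> I" using additive_subgroup.zero_closed[OF is_additive_subgroup]
    by (simp add: poly_ring_sel)
  show "a \<in> I \<Longrightarrow> b \<in> I \<Longrightarrow> a + b \<in> I"
    using additive_subgroup.a_closed[OF is_additive_subgroup, of a b] by (simp add: poly_ring_sel)
  show "a \<in> I \<Longrightarrow> c \<in> carrier (poly_ring X) \<Longrightarrow> c * a \<in> I"
    using I_l_closed[of a c] by (simp add: poly_ring_sel)
qed

lemma ideal_sum:
  assumes "ideal I (poly_ring X)" "\<And>i. i \<in> A \<Longrightarrow> f i \<in> I"
  shows "(\<Sum>i\<in>A. f i) \<in> I"
  using assms(2)
  by (induction A rule: infinite_finite_induct) (auto intro: ideal_0[OF assms(1)] ideal_add[OF assms(1)])

definition monomial_multiples :: "'x set \<Rightarrow> 'x mon set \<Rightarrow> 'x mon set" where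
  "monomial_multiples X N = {g + h | g h. g \<in> N \<and> h \<in> mons X}"

text \<open>The polynomials all of whose monomials are multiples of generators form an ideal, and each of
  them is a sum of such multiples.\<close>

lemma genideal_monomials:
  fixes X :: "'x set"
  assumes N: "N \<subseteq> mons X"
  shows "Idl\<^bsub>poly_ring X\<^esub> (mon_poly ` N) =
    {p :: ('x, 'k::field) mpoly. Poly_Mapping.keys p \<subseteq> monomial_multiples X N}" (is "?I = ?M")
proof -
  interpret R: cring "poly_ring X :: ('x, 'k) mpoly ring" by (rule cring_poly_ring)
  have sub: "monomial_multiples X N \<subseteq> mons X"
    using N add_in_mons unfolding monomial_multiples_def by blast
  have gens: "(mon_poly ` N :: ('x, 'k) mpoly set) \<subseteq> carrier (poly_ring X)"
    using N by (auto simp: mon_poly_def intro: single_in_carrier)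
  have id: "ideal ?M (poly_ring X)"
  proof (rule poly_idealI)
    show "?M \<subseteq> carrier (poly_ring X)" using sub by (auto simp: carrier_poly_ring)
    show "a + b \<in> ?M" if "a \<in> ?M" "b \<in> ?M" for a b using that keys_add[of a b] by auto
    show "c * a \<in> ?M" if a: "a \<in> ?M" and c: "c \<in> carrier (poly_ring X)" for a c
    proof
      show "Poly_Mapping.keys (c * a) \<subseteq> monomial_multiples X N"
      proof
        fix m assume "m \<in> Poly_Mapping.keys (c * a)"
        then obtain s t where st: "m = s + t" "s \<in> Poly_Mapping.keys c" "t \<in> Poly_Mapping.keys a"
          using keys_mult[of c a] by auto
        then obtain g h where "t = g + h" "g \<in> N" "h \<in> mons X"
          using a unfolding monomial_multiples_def by blast
        then have "m = g + (s + h)" "s + h \<in> mons X"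
          using st c add_in_mons[of s X h] by (auto simp: carrier_poly_ring add_ac)
        then show "m \<in> monomial_multiples X N"
          using \<open>g \<in> N\<close> unfolding monomial_multiples_def by blast
      qed
    qed
  qed simp
  show ?thesis
  proof
    have "mon_poly g \<in> ?M" if "g \<in> N" for g
    proof -
      have "g = g + 0" by simp
      then have "g \<in> monomial_multiples X N"
        using that zero_in_mons unfolding monomial_multiples_def by blast
      then show ?thesis by (simp add: mon_poly_def)
    qed
    then show "?I \<subseteq> ?M" using id by (intro R.genideal_minimal) auto
    have Iid: "ideal ?I (poly_ring X)" using gens by (rule R.genideal_ideal)
    show "?M \<subseteq> ?I"
    proof
      fix p :: "('x, 'k) mpoly" assume p: "p \<in> ?M"
      have "Poly_Mapping.single m (Poly_Mapping.lookup p m) \<in> ?I" if "m \<in> Poly_Mapping.keys p" for m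
      proof -
        obtain g h where gh: "m = g + h" "g \<in> N" "h \<in> mons X"
          using p \<open>m \<in> Poly_Mapping.keys p\<close> unfolding monomial_multiples_def by blast
        have "mon_poly g \<in> ?I" using R.genideal_self[OF gens] gh(2) by blast
        then have "Poly_Mapping.single h (Poly_Mapping.lookup p m) * mon_poly g \<in> ?I"
          by (rule ideal_mult[OF Iid]) (rule single_in_carrier[OF gh(3)])
        then show ?thesis by (simp add: mon_poly_def mult_single gh(1) add.commute)
      qed
      then have "(\<Sum>m\<in>Poly_Mapping.keys p. Poly_Mapping.single m (Poly_Mapping.lookup p m)) \<in> ?I"
        by (intro ideal_sum[OF Iid])
      then show "p \<in> ?I" using sum_of_terms[of p] by simp
    qed
  qed
qed

definition squarefree_mon :: "'x set \<Rightarrow> 'x mon" where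
  "squarefree_mon E = (\<Sum>x\<in>E. Poly_Mapping.single x 1)"

lemma lookup_squarefree_mon:
  assumes "finite E"
  shows "Poly_Mapping.lookup (squarefree_mon E) x = (if x \<in> E then 1 else 0)"
proof -
  have "Poly_Mapping.lookup (squarefree_mon E) x = (\<Sum>y\<in>E. if y = x then 1 else 0)"
    unfolding squarefree_mon_def lookup_sum by (intro sum.cong refl) (auto simp: lookup_single when_def)
  then show ?thesis using assms by simp
qed

lemma keys_squarefree_mon: "finite E \<Longrightarrow> Poly_Mapping.keys (squarefree_mon E) = E"
  by (auto simp: in_keys_iff lookup_squarefree_mon split: if_splits)

lemma prod_var_poly: "finite E \<Longrightarrow> (\<Prod>x\<in>E. var_poly x) = mon_poly (squarefree_mon E)"
proof (induction E rule: finite_induct)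
  case empty
  then show ?case by (simp add: mon_poly_def squarefree_mon_def)
next
  case (insert a E)
  then show ?case by (simp add: squarefree_mon_def var_poly_def mon_poly_def mult_single)
qed

lemma monomial_multiples_squarefree:
  assumes "\<And>E. E \<in> F \<Longrightarrow> finite E"
  shows "m \<in> monomial_multiples X (squarefree_mon ` F) \<inter> mons X \<longleftrightarrow>
    m \<in> mons X \<and> (\<exists>E\<in>F. E \<subseteq> Poly_Mapping.keys m)"
proof -
  have *: "(\<exists>h\<in>mons X. m = squarefree_mon E + h) \<longleftrightarrow> E \<subseteq> Poly_Mapping.keys m"
    if E: "finite E" and m: "m \<in> mons X" for E
  proof
    assume "\<exists>h\<in>mons X. m = squarefree_mon E + h"
    then show "E \<subseteq> Poly_Mapping.keys m" by (auto simp: in_keys_iff lookup_add lookup_squarefree_mon[OF E])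
  next
    assume sub: "E \<subseteq> Poly_Mapping.keys m"
    have "m = squarefree_mon E + (m - squarefree_mon E)"
    proof (rule poly_mapping_eqI)
      fix x
      show "Poly_Mapping.lookup m x = Poly_Mapping.lookup (squarefree_mon E + (m - squarefree_mon E)) x"
        using sub by (auto simp: lookup_add lookup_minus lookup_squarefree_mon[OF E] in_keys_iff subset_iff
            Suc_leI)
    qed
    moreover have "m - squarefree_mon E \<in> mons X"
      using m by (auto simp: mons_def in_keys_iff lookup_minus)
    ultimately show "\<exists>h\<in>mons X. m = squarefree_mon E + h" by blast
  qed
  have "m \<in> monomial_multiples X (squarefree_mon ` F) \<longleftrightarrow>
      (\<exists>E\<in>F. \<exists>h\<in>mons X. m = squarefree_mon E + h)"
    unfolding monomial_multiples_def by blast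
  also have "m \<in> mons X \<Longrightarrow> \<dots> \<longleftrightarrow> (\<exists>E\<in>F. E \<subseteq> Poly_Mapping.keys m)"
    using * assms by (intro bex_cong refl) simp
  finally show ?thesis by blast
qed

section \<open>Leading monomials in the reverse lexicographic order\<close>

lemma finite_has_greatest:
  assumes "finite S" "S \<noteq> {}"
    and trans: "\<And>a b c. R a b \<Longrightarrow> R b c \<Longrightarrow> R a c" and total: "\<And>a b. a \<noteq> b \<Longrightarrow> R a b \<or> R b a"
  shows "\<exists>m\<in>S. \<forall>m'\<in>S. m' \<noteq> m \<longrightarrow> R m' m"
  using assms(1,2)
proof (induction S rule: finite_ne_induct)
  case (insert a S)
  then obtain m where m: "m \<in> S" "\<forall>m'\<in>S. m' \<noteq> m \<longrightarrow> R m' m" by blast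
  have "a \<noteq> m" using m insert by blast
  then consider "R a m" | "R m a" using total by blast
  then show ?case
  proof cases
    case 1
    then show ?thesis using m by (intro bexI[of _ m] ballI impI) blast+
  next
    case 2
    have "R m' a" if "m' \<in> S" for m'
    proof (cases "m' = m")
      case False
      then show ?thesis using m(2) that trans[of m' m a] 2 by blast
    qed (use 2 in simp)
    then show ?thesis by (intro bexI[of _ a] ballI impI) blast+
  qed
qed simp

lemma mons_UNIV: "mons UNIV = UNIV"
  by (simp add: mons_def)

lemma revlex_irrefl: "\<not> revlex a a"
  and revlex_trans: "revlex a b \<Longrightarrow> revlex b c \<Longrightarrow> revlex a c"
  and revlex_total: "a \<noteq> b \<Longrightarrow> revlex a b \<or> revlex b a"
  and revlex_add: "revlex a b \<Longrightarrow> revlex (a + c) (b + c)"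
proof -
  note t = term_order_revlex[of UNIV, unfolded term_order_def mons_UNIV ball_UNIV]
  show "\<not> revlex a a" by (rule t[THEN conjunct1, rule_format])
  show "revlex a b \<Longrightarrow> revlex b c \<Longrightarrow> revlex a c"
    by (rule t[THEN conjunct2, THEN conjunct1, rule_format])
  show "a \<noteq> b \<Longrightarrow> revlex a b \<or> revlex b a"
    by (rule t[THEN conjunct2, THEN conjunct2, THEN conjunct1, rule_format])
  show "revlex a b \<Longrightarrow> revlex (a + c) (b + c)"
    by (rule t[THEN conjunct2, THEN conjunct2, THEN conjunct2, THEN conjunct2, rule_format])
qed

definition is_lead :: "(nat \<times> nat, 'k::field) mpoly \<Rightarrow> (nat \<times> nat) mon \<Rightarrow> bool" where
  "is_lead p m \<longleftrightarrow>
     m \<in> Poly_Mapping.keys p \<and> (\<forall>m'\<in>Poly_Mapping.keys p. m' \<noteq> m \<longrightarrow> revlex m' m)"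

lemma lead_exists:
  assumes "p \<noteq> 0"
  shows "\<exists>m. is_lead p m"
proof -
  have "\<exists>m\<in>Poly_Mapping.keys p. \<forall>m'\<in>Poly_Mapping.keys p. m' \<noteq> m \<longrightarrow> revlex m' m"
  proof (rule finite_has_greatest)
    show "revlex a c" if "revlex a b" "revlex b c" for a b c using that by (rule revlex_trans)
    show "revlex a b \<or> revlex b a" if "a \<noteq> b" for a b using that by (rule revlex_total)
  qed (use assms in simp_all)
  then show ?thesis unfolding is_lead_def by blast
qed

lemma init_eq_lead:
  assumes "is_lead p m"
  shows "init revlex p = mon_poly m"
proof -
  have "lead_mon revlex p = m" unfolding lead_mon_def
  proof (rule the_equality)
    show "m \<in> Poly_Mapping.keys p \<and> (\<forall>m'\<in>Poly_Mapping.keys p. m' \<noteq> m \<longrightarrow> revlex m' m)"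
      using assms unfolding is_lead_def .
    fix m2 assume m2: "m2 \<in> Poly_Mapping.keys p \<and> (\<forall>m'\<in>Poly_Mapping.keys p. m' \<noteq> m2 \<longrightarrow> revlex m' m2)"
    show "m2 = m"
    proof (rule ccontr)
      assume "m2 \<noteq> m"
      then have "revlex m m2" "revlex m2 m" using m2 assms unfolding is_lead_def by auto
      then show False using revlex_trans revlex_irrefl by blast
    qed
  qed
  moreover have "p \<noteq> 0" using assms unfolding is_lead_def by auto
  ultimately show ?thesis by (simp add: init_def)
qed

lemma lookup_single_mult:
  "Poly_Mapping.lookup (Poly_Mapping.single h 1 * p) (h + m) = Poly_Mapping.lookup p m"
  for p :: "('x, 'k::field) mpoly"
proof -
  have "Poly_Mapping.single h 1 * p = (\<Sum>a\<in>Poly_Mapping.keys p. Poly_Mapping.single (h + a) (Poly_Mapping.lookup p a))"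
    by (subst sum_of_terms[of p]) (simp add: sum_distrib_left mult_single)
  then have "Poly_Mapping.lookup (Poly_Mapping.single h 1 * p) (h + m) =
      (\<Sum>a\<in>Poly_Mapping.keys p. if a = m then Poly_Mapping.lookup p m else 0)"
    unfolding lookup_sum by (auto simp: lookup_sum lookup_single when_def intro!: sum.cong)
  then show ?thesis by (simp add: in_keys_iff)
qed

lemma is_lead_shift:
  assumes "is_lead p m"
  shows "is_lead (Poly_Mapping.single h 1 * p) (h + m)"
  unfolding is_lead_def
proof (intro conjI ballI impI)
  show "h + m \<in> Poly_Mapping.keys (Poly_Mapping.single h 1 * p)"
    using assms unfolding is_lead_def in_keys_iff lookup_single_mult by blast
  fix m' assume m': "m' \<in> Poly_Mapping.keys (Poly_Mapping.single h 1 * p)" "m' \<noteq> h + m"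
  then obtain t where t: "m' = h + t" "t \<in> Poly_Mapping.keys p"
    using keys_mult[of "Poly_Mapping.single h 1" p] by (auto split: if_splits)
  have "t \<noteq> m" using t(1) m'(2) by blast
  then have "revlex t m" using assms t(2) unfolding is_lead_def by blast
  then show "revlex m' (h + m)" using revlex_add[of t m h] t(1) by (simp add: add.commute)
qed

lemma is_lead_add_smaller:
  assumes "is_lead p m" "\<And>m'. m' \<in> Poly_Mapping.keys q \<Longrightarrow> revlex m' m"
  shows "is_lead (p + q) m"
  unfolding is_lead_def
proof (intro conjI ballI impI)
  have "m \<notin> Poly_Mapping.keys q" using assms(2) revlex_irrefl by blast
  then show "m \<in> Poly_Mapping.keys (p + q)"
    using assms(1) by (simp add: is_lead_def in_keys_iff lookup_add)
  fix m' assume "m' \<in> Poly_Mapping.keys (p + q)" "m' \<noteq> m"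
  then show "revlex m' m" using keys_add[of p q] assms unfolding is_lead_def by blast
qed

text \<open>This is the characteristic feature of the order: a large variable makes a monomial small.\<close>

lemma revlex_by_large_variable:
  assumes deg: "mon_deg m' \<le> mon_deg m" and x: "x \<in> Poly_Mapping.keys m'" "(e, x) \<in> less_than <*lex*> less_than"
    and m: "\<And>y. y \<in> Poly_Mapping.keys m \<Longrightarrow> (e, y) \<notin> less_than <*lex*> less_than"
  shows "revlex m' m"
proof (cases "mon_deg m' < mon_deg m")
  case False
  define r :: "((nat \<times> nat) \<times> (nat \<times> nat)) set" where "r = less_than <*lex*> less_than"
  have tr: "(a, c) \<in> r" if "(a, b) \<in> r" "(b, c) \<in> r" for a b c
    using that by (cases a; cases b; cases c) (auto simp: r_def)
  have tot: "(a, b) \<in> r \<or> (b, a) \<in> r" if "a \<noteq> b" for a b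
    using that by (cases a; cases b) (auto simp: r_def)
  have "\<exists>a\<in>{y \<in> Poly_Mapping.keys m'. (e, y) \<in> r}. \<forall>b\<in>{y \<in> Poly_Mapping.keys m'. (e, y) \<in> r}. b \<noteq> a \<longrightarrow> (b, a) \<in> r"
  proof (rule finite_has_greatest)
    show "{y \<in> Poly_Mapping.keys m'. (e, y) \<in> r} \<noteq> {}" using x unfolding r_def by blast
    show "(a, c) \<in> r" if "(a, b) \<in> r" "(b, c) \<in> r" for a b c using that by (rule tr)
    show "(a, b) \<in> r \<or> (b, a) \<in> r" if "a \<noteq> b" for a b using that by (rule tot)
  qed simp
  then obtain a where a: "a \<in> Poly_Mapping.keys m'" "(e, a) \<in> r"
    and max: "\<And>b. b \<in> Poly_Mapping.keys m' \<Longrightarrow> (e, b) \<in> r \<Longrightarrow> b \<noteq> a \<Longrightarrow> (b, a) \<in> r" by blast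
  have zero: "Poly_Mapping.lookup m y = 0" if "(e, y) \<in> r" for y
    using m[of y] that by (auto simp: r_def[symmetric] in_keys_iff)
  have "Poly_Mapping.lookup m a < Poly_Mapping.lookup m' a"
    using zero[OF a(2)] a(1) by (simp add: in_keys_iff)
  moreover have "Poly_Mapping.lookup m' y = Poly_Mapping.lookup m y" if "(a, y) \<in> r" for y
  proof -
    have ey: "(e, y) \<in> r" using tr[OF a(2) that] .
    have "y \<notin> Poly_Mapping.keys m'"
    proof
      assume "y \<in> Poly_Mapping.keys m'"
      moreover have "y \<noteq> a" using that by (cases a) (auto simp: r_def)
      ultimately have "(y, a) \<in> r" using max ey by blast
      then have "(a, a) \<in> r" using tr that by blast
      then show False by (cases a) (auto simp: r_def)
    qed
    then show ?thesis using zero[OF ey] by (simp add: in_keys_iff)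
  qed
  moreover have "mon_deg m' = mon_deg m" using False deg by simp
  ultimately show ?thesis unfolding revlex_def r_def by blast
qed (simp add: revlex_def)

text \<open>The entry \<open>(a, b)\<close> of the generic skew-symmetric matrix, whose variables live below
  the diagonal.\<close>

definition u_entry :: "nat \<Rightarrow> nat \<Rightarrow> (nat \<times> nat, 'k::field) mpoly" where
  "u_entry a b = (if b < a then var_poly (a, b) else if a < b then - var_poly (b, a) else 0)"

lemma u_entry_skew: "u_entry b a = - u_entry a b"
  by (auto simp: u_entry_def)

lemma u_entry_carrier: "a \<in> {1..n} \<Longrightarrow> b \<in> {1..n} \<Longrightarrow> u_entry a b \<in> carrier (poly_ring (ss_vars n))"
  by (auto simp: u_entry_def var_poly_def mon_poly_def mons_def ss_vars_def
      intro!: single_in_carrier carrier_uminus carrier_0)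

lemma keys_u_entry: "Poly_Mapping.keys (u_entry a b :: (nat \<times> nat, 'k::field) mpoly) \<subseteq> {Poly_Mapping.single (max a b, min a b) 1}"
  by (auto simp: u_entry_def var_poly_def mon_poly_def in_keys_iff lookup_single when_def
      split: if_splits)

lemma poly_eval_u_entry:
  assumes "M \<in> skew_mats n" "a \<in> {1..n}" "b \<in> {1..n}"
  shows "poly_eval (ss_point M) (u_entry a b) = entry M a b"
proof -
  interpret comm_ring_hom "poly_eval (ss_point M)" by (rule poly_eval_comm_ring_hom)
  have M: "M \<in> carrier_mat n n" "transpose_mat M = - M" "\<And>i. i < n \<Longrightarrow> M $$ (i, i) = 0"
    using assms(1) by (auto simp: skew_mats_def)
  have "M $$ (b - 1, a - 1) = transpose_mat M $$ (a - 1, b - 1)" using M(1) assms(2,3) by auto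
  also have "\<dots> = - M $$ (a - 1, b - 1)" unfolding M(2) using M(1) assms(2,3) by auto
  finally have "M $$ (b - 1, a - 1) = - M $$ (a - 1, b - 1)" .
  moreover have "ss_point M (a, b) = M $$ (a - 1, b - 1)" for a b by (simp add: ss_point_def)
  moreover have "poly_eval v (- p) = - poly_eval v p" for v :: "nat \<times> nat \<Rightarrow> 'a" and p
    using poly_eval_add[of v p "- p"] by (simp add: poly_eval_0 eq_neg_iff_add_eq_0 add.commute)
  moreover have "M $$ (a - 1, a - 1) = 0" using assms(2) by (intro M(3)) auto
  ultimately show ?thesis
    by (cases rule: linorder_cases[of a b]) (simp_all add: u_entry_def entry_def poly_eval_var poly_eval_0)
qed

lemma expansion_sign_cases:
  "expansion_sign S x y = (1 :: 'a::comm_ring_1) \<or> expansion_sign S x y = (- 1 :: 'a)"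
proof -
  have "(- 1 :: 'a) ^ k = 1 \<or> (- 1 :: 'a) ^ k = - 1" for k by (cases "even k") auto
  from this[of "card {s \<in> S. s < x}"] this[of "card {s \<in> S. s < y}"]
  show ?thesis by (auto simp: expansion_sign_def flip_sign_def)
qed

lemma keys_expansion_sign_mult:
  "Poly_Mapping.keys (expansion_sign S x y * p) = Poly_Mapping.keys (p :: ('x, 'k::field) mpoly)"
  using expansion_sign_cases[of S x y, where 'a = "('x, 'k) mpoly"]
proof
  assume "expansion_sign S x y = (- 1 :: ('x, 'k) mpoly)"
  then have "expansion_sign S x y * p = - p" by simp
  then show ?thesis by (auto simp: in_keys_iff)
qed simp

lemma mon_deg_single: "mon_deg (Poly_Mapping.single x 1) = 1"
  by (simp add: mon_deg_def)

lemma pfaffian_degree: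
  fixes U :: "nat \<Rightarrow> nat \<Rightarrow> (nat \<times> nat, 'k::field) mpoly"
  assumes U: "\<And>x y m. m \<in> Poly_Mapping.keys (U x y) \<Longrightarrow> mon_deg m \<le> 1"
  shows "m \<in> Poly_Mapping.keys (pfaffian n U S) \<Longrightarrow> mon_deg m \<le> n"
proof (induction n arbitrary: S m)
  case 0
  then show ?case by (simp add: mon_deg_def)
next
  case (Suc n)
  have "m \<in> (\<Union>y\<in>S - {Min S}. Poly_Mapping.keys (expansion_sign S (Min S) y * U (Min S) y * pfaffian n U (S - {Min S, y})))"
    using Suc.prems unfolding pfaffian.simps by (rule subsetD[OF keys_sum])
  then obtain y where "m \<in> Poly_Mapping.keys (expansion_sign S (Min S) y * U (Min S) y * pfaffian n U (S - {Min S, y}))"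
    by blast
  then have "m \<in> Poly_Mapping.keys (U (Min S) y * pfaffian n U (S - {Min S, y}))"
    by (simp add: mult.assoc keys_expansion_sign_mult)
  then obtain a b where "m = a + b" "a \<in> Poly_Mapping.keys (U (Min S) y)" "b \<in> Poly_Mapping.keys (pfaffian n U (S - {Min S, y}))"
    using keys_mult by blast
  then show ?case using U Suc.IH[of b] by (fastforce simp: mon_deg_add)
qed

lemma pfaffian_carrier:
  fixes U :: "nat \<Rightarrow> nat \<Rightarrow> ('x, 'k::field) mpoly"
  assumes U: "\<And>x y. x \<in> T \<Longrightarrow> y \<in> T \<Longrightarrow> U x y \<in> carrier (poly_ring X)"
  shows "finite S \<Longrightarrow> S \<subseteq> T \<Longrightarrow> pfaffian n U S \<in> carrier (poly_ring X)"
proof (induction n arbitrary: S)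
  case 0
  then show ?case by (simp add: carrier_1)
next
  case (Suc n)
  have summand: "expansion_sign S (Min S) y * U (Min S) y * pfaffian n U (S - {Min S, y}) \<in> carrier (poly_ring X)"
    if "y \<in> S - {Min S}" for y
  proof -
    have "Min S \<in> S" using Suc.prems that by (intro Min_in) auto
    then have "U (Min S) y * pfaffian n U (S - {Min S, y}) \<in> carrier (poly_ring X)"
      using Suc that by (intro carrier_mult U Suc.IH) auto
    then show ?thesis by (simp add: mult.assoc carrier_poly_ring keys_expansion_sign_mult)
  qed
  show ?case unfolding pfaffian.simps by (rule carrier_sum) (rule summand)
qed

section \<open>Masked Pfaffians\<close>

text \<open>The generic skew-symmetric matrix with rows and columns chosen, possibly repeatedly, by
  \<open>\<phi>\<close>, and with the block on \<open>Z\<close> replaced by zero. The mask removes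
  the terms of the Pfaffian that would spoil the leading monomial. It leaves the columns outside
  \<open>Z\<close> alone, and with them every dependency among these columns.\<close>

definition masked_entry ::
    "(nat \<Rightarrow> nat) \<Rightarrow> nat set \<Rightarrow> nat \<Rightarrow> nat \<Rightarrow> (nat \<times> nat, 'k::field) mpoly" where
  "masked_entry \<phi> Z x y = (if x \<in> Z \<and> y \<in> Z then 0 else u_entry (\<phi> x) (\<phi> y))"

text \<open>The arcs \<open>(\<phi> (2 i), \<phi> (2 i + 1))\<close> are listed from the lexicographically
  largest downwards. If \<open>2 k\<close> is matched with anything but \<open>2 k + 1\<close>,
  the entry is either masked or a variable larger than every variable of the claimed leading
  monomial, so the resulting monomials are smaller.\<close>

lemma pfaffian_lead:
  fixes \<phi> :: "nat \<Rightarrow> nat"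
  assumes arc: "\<And>i. i < N \<Longrightarrow> \<phi> (2 * i + 1) < \<phi> (2 * i) \<and> \<not> (2 * i \<in> Z \<and> 2 * i + 1 \<in> Z)"
    and later: "\<And>i y. i < N \<Longrightarrow> 2 * i + 1 < y \<Longrightarrow> y < 2 * N \<Longrightarrow>
      (2 * i \<in> Z \<and> y \<in> Z) \<or> \<phi> (2 * i + 1) < \<phi> y"
    and lex: "\<And>i j. i < j \<Longrightarrow> j < N \<Longrightarrow>
      ((\<phi> (2 * j), \<phi> (2 * j + 1)), (\<phi> (2 * i), \<phi> (2 * i + 1))) \<in> less_than <*lex*> less_than"
  shows "n + k = N \<Longrightarrow> is_lead (pfaffian n (masked_entry \<phi> Z) {2 * k..<2 * N} :: (nat \<times> nat, 'k::field) mpoly)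
    (\<Sum>i\<in>{k..<N}. Poly_Mapping.single (\<phi> (2 * i), \<phi> (2 * i + 1)) 1)"
proof (induction n arbitrary: k)
  case 0
  then show ?case by (simp add: is_lead_def)
next
  case (Suc n)
  define S where "S = {2 * k..<2 * N}"
  define U where "U = (masked_entry \<phi> Z :: nat \<Rightarrow> nat \<Rightarrow> (nat \<times> nat, 'k) mpoly)"
  define e where "e i = (\<phi> (2 * i), \<phi> (2 * i + 1))" for i
  define L where "L k = (\<Sum>i\<in>{k..<N}. Poly_Mapping.single (e i) (1::nat))" for k
  define T where "T y = expansion_sign S (2 * k) y * U (2 * k) y * pfaffian n U (S - {2 * k, y})" for y
  have kN: "k < N" using Suc.prems by simp
  have "Min S = 2 * k" unfolding S_def using kN by (intro Min_eqI) auto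
  then have pf: "pfaffian (Suc n) U S = (\<Sum>y\<in>S - {2 * k}. T y)" by (simp add: T_def)
  also have "\<dots> = T (2 * k + 1) + (\<Sum>y\<in>S - {2 * k} - {2 * k + 1}. T y)"
    by (rule sum.remove) (use kN in \<open>auto simp: S_def\<close>)
  finally have split: "pfaffian (Suc n) U S = T (2 * k + 1) + (\<Sum>y\<in>S - {2 * k} - {2 * k + 1}. T y)" .
  have "{k..<N} = insert k {Suc k..<N}" using kN by auto
  then have L: "L k = Poly_Mapping.single (e k) 1 + L (Suc k)" by (simp add: L_def)
  have degL: "mon_deg (L k) = Suc n"
  proof -
    have "mon_deg (sum g A) = sum (\<lambda>i. mon_deg (g i)) A" for g :: "nat \<Rightarrow> (nat \<times> nat) mon" and A
      by (induction A rule: infinite_finite_induct) (simp_all add: mon_deg_add, simp_all add: mon_deg_def)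
    then have "mon_deg (L k) = (\<Sum>i\<in>{k..<N}. 1)" by (simp only: L_def mon_deg_single)
    then show ?thesis using Suc.prems by simp
  qed
  have keysL: "(e k, y) \<notin> less_than <*lex*> less_than" if y: "y \<in> Poly_Mapping.keys (L k)" for y
  proof -
    have "\<exists>i\<in>{k..<N}. y = e i"
    proof (rule ccontr)
      assume "\<not> ?thesis"
      then have "Poly_Mapping.lookup (L k) y = 0"
        unfolding L_def lookup_sum by (intro sum.neutral) (auto simp: lookup_single when_def)
      then show False using y by (simp add: in_keys_iff)
    qed
    then obtain i where i: "k \<le> i" "i < N" "y = e i" by auto
    show ?thesis
    proof (cases "i = k")
      case True
      then show ?thesis using i(3) by (cases "e k") auto
    next
      case False
      then have "(y, e k) \<in> less_than <*lex*> less_than" using lex[of k i] i by (simp add: e_def)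
      then show ?thesis by (cases y; cases "e k") auto
    qed
  qed
  have lead1: "is_lead (T (2 * k + 1)) (L k)"
  proof -
    have "S - {2 * k, 2 * k + 1} = {2 * Suc k..<2 * N}" unfolding S_def by auto
    then have rest: "is_lead (pfaffian n U (S - {2 * k, 2 * k + 1})) (L (Suc k))"
      using Suc.IH[of "Suc k"] Suc.prems by (simp add: U_def L_def e_def)
    have U: "U (2 * k) (2 * k + 1) = Poly_Mapping.single (Poly_Mapping.single (e k) 1) 1"
      using arc[OF kN] by (auto simp: U_def masked_entry_def u_entry_def e_def var_poly_def mon_poly_def)
    have "is_lead (U (2 * k) (2 * k + 1) * pfaffian n U (S - {2 * k, 2 * k + 1})) (L k)"
      unfolding U L by (rule is_lead_shift[OF rest])
    then show ?thesis unfolding T_def is_lead_def mult.assoc keys_expansion_sign_mult .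
  qed
  have other: "revlex m (L k)" if m: "m \<in> Poly_Mapping.keys (T y)" and y: "y \<in> S - {2 * k} - {2 * k + 1}" for m y
  proof -
    have "m \<in> Poly_Mapping.keys (U (2 * k) y * pfaffian n U (S - {2 * k, y}))"
      using m unfolding T_def mult.assoc keys_expansion_sign_mult .
    then obtain a b where ab: "m = a + b" "a \<in> Poly_Mapping.keys (U (2 * k) y)"
        "b \<in> Poly_Mapping.keys (pfaffian n U (S - {2 * k, y}))"
      using keys_mult by blast
    have degU: "mon_deg t \<le> 1" if t: "t \<in> Poly_Mapping.keys (U p q)" for p q t
    proof -
      have "t \<in> Poly_Mapping.keys (u_entry (\<phi> p) (\<phi> q) :: (nat \<times> nat, 'k) mpoly)"
        using t by (auto simp: U_def masked_entry_def split: if_splits)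
      then have "t = Poly_Mapping.single (max (\<phi> p) (\<phi> q), min (\<phi> p) (\<phi> q)) 1"
        using keys_u_entry by blast
      then show ?thesis by (simp only: mon_deg_single)
    qed
    have "mon_deg b \<le> n" by (rule pfaffian_degree[OF _ ab(3)]) (rule degU)
    then have deg: "mon_deg m \<le> mon_deg (L k)"
      using degU[OF ab(2)] by (simp add: degL ab(1) mon_deg_add)
    have nz: "\<not> (2 * k \<in> Z \<and> y \<in> Z)"
      using ab(2) by (auto simp: U_def masked_entry_def)
    have "2 * k + 1 < y" "y < 2 * N" using y by (auto simp: S_def)
    then have gt: "\<phi> (2 * k + 1) < \<phi> y" using later[OF kN] nz by blast
    define x where "x = (max (\<phi> (2 * k)) (\<phi> y), min (\<phi> (2 * k)) (\<phi> y))"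
    have "a = Poly_Mapping.single x 1"
      using ab(2) nz keys_u_entry[of "\<phi> (2 * k)" "\<phi> y", where 'k = 'k] by (auto simp: U_def masked_entry_def x_def)
    then have "x \<in> Poly_Mapping.keys m" by (simp add: ab(1) in_keys_iff lookup_add)
    moreover have "(e k, x) \<in> less_than <*lex*> less_than"
      using gt arc[OF kN] by (auto simp: e_def x_def max_def min_def)
    ultimately show ?thesis using deg keysL by (intro revlex_by_large_variable[of m "L k" x "e k"])
  qed
  have "is_lead (pfaffian (Suc n) U S) (L k)"
    unfolding split
  proof (rule is_lead_add_smaller[OF lead1])
    fix m assume "m \<in> Poly_Mapping.keys (\<Sum>y\<in>S - {2 * k} - {2 * k + 1}. T y)"
    then have "m \<in> (\<Union>y\<in>S - {2 * k} - {2 * k + 1}. Poly_Mapping.keys (T y))"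
      by (rule subsetD[OF keys_sum])
    then show "revlex m (L k)" using other by blast
  qed
  then show ?case unfolding U_def S_def L_def e_def .
qed

text \<open>The rank bound gives a dependency among the columns \<open>\<phi> x\<close>, \<open>x \<in>
  F\<close>, valid in the rows up to \<open>i\<close>. All indices select such rows, and the mask
  does not touch the entries in the columns \<open>F\<close>; hence the masked matrix is singular.\<close>

lemma masked_pfaffian_vanishes:
  fixes M :: "'k::field mat"
  assumes M: "M \<in> skew_mats n" and ij: "i \<le> n" "j \<le> n"
    and rows: "\<And>x. x < 2 * N \<Longrightarrow> \<phi> x \<in> {1..i}"
    and F: "F \<subseteq> {..<2 * N}" "F \<inter> Z = {}" "\<phi> ` F \<subseteq> {1..j}" "r < card F"
    and rank: "corner_rank M i j \<le> r"
  shows "poly_eval (ss_point M) (pfaffian N (masked_entry \<phi> Z) {0..<2 * N}) = 0"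
proof -
  interpret comm_ring_hom "poly_eval (ss_point M)" by (rule poly_eval_comm_ring_hom)
  define f where "f x y = poly_eval (ss_point M) (masked_entry \<phi> Z x y)" for x y
  have finF: "finite F" using F(1) finite_subset by blast
  have "factors_through (entry M) {1..i} {1..j} r" using rank by (simp only: corner_rank_le_iff)
  from factors_through_dependency[OF this finF F(4,3)] obtain v where
    v: "\<exists>x\<in>F. v x \<noteq> 0" "\<forall>y\<in>{1..i}. (\<Sum>x\<in>F. v x * entry M y (\<phi> x)) = 0" by blast
  define v' where "v' x = (if x \<in> F then v x else 0)" for x
  have skew: "f y x = - f x y" for x y
  proof -
    have "poly_eval (ss_point M) (u_entry (\<phi> y) (\<phi> x)) = - poly_eval (ss_point M) (u_entry (\<phi> x) (\<phi> y))"
      unfolding u_entry_skew[of "\<phi> y" "\<phi> x"] by (rule hom_uminus)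
    then show ?thesis by (auto simp: f_def masked_entry_def)
  qed
  have ev: "f x y = - entry M (\<phi> y) (\<phi> x)" if "x \<in> F" "y < 2 * N" for x y
  proof -
    have "x \<notin> Z" "\<phi> x \<in> {1..n}" "\<phi> y \<in> {1..n}" using that F rows[of x] rows[of y] ij by auto
    then have "f y x = entry M (\<phi> y) (\<phi> x)"
      using poly_eval_u_entry[OF M] by (simp add: f_def masked_entry_def)
    moreover have "f x y = - f y x" by (rule skew)
    ultimately show ?thesis by (simp only:)
  qed
  obtain x0 where x0: "x0 \<in> F" "v x0 \<noteq> 0" using v(1) by blast
  have "pfaffian N f {0..<2 * N} = 0"
  proof (rule pfaffian_singular[of f, OF skew])
    show "f x x = 0" for x by (simp add: f_def masked_entry_def u_entry_def)
    show "x0 \<in> {0..<2 * N}" "v' x0 \<noteq> 0" using x0 F(1) by (auto simp: v'_def)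
    fix y assume y: "y \<in> {0..<2 * N}"
    have "(\<Sum>z\<in>{0..<2 * N}. v' z * f z y) = (\<Sum>z\<in>F. v' z * f z y)"
      using F(1) by (intro sum.mono_neutral_right) (auto simp: v'_def)
    also have "\<dots> = (\<Sum>z\<in>F. - (v z * entry M (\<phi> y) (\<phi> z)))"
      using y by (intro sum.cong refl) (simp add: v'_def ev)
    also have "\<dots> = 0" using v(2) rows[of y] y by (simp add: sum_negf)
    finally show "(\<Sum>z\<in>{0..<2 * N}. v' z * f z y) = 0" .
  qed simp_all
  then show ?thesis unfolding pfaffian_hom[OF poly_eval_comm_ring_hom] f_def .
qed

section \<open>Antidiagonal chains as initial monomials\<close>

text \<open>The pairs \<open>(a m, b m)\<close> form an antidiagonal chain: \<open>a\<close> increases and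
  \<open>b\<close> decreases. Folded below the diagonal they become arcs from \<open>max\<close>
  to \<open>min\<close>, called lower if \<open>b m < a m\<close> and upper otherwise; in the
  chain the upper arcs come first. Arcs of the same kind are nested, but a lower and an upper arc
  can coincide or overlap in either direction.

  The selected arcs will be matched in a masked Pfaffian. Both endpoints of an inner arc and one
  endpoint of every other selected arc stay unmasked, so \<open>card Sel + card Inner\<close>
  counts unmasked indices, all at most \<open>j\<close>, and has to reach \<open>K\<close>. If one
  arc dominates another in both endpoints, this is harmless when the dominating arc is lower, the
  dominated one is upper and neither is inner, for then the two endpoints concerned are masked;
  the last condition excludes all other cases.

  If a lower arc \<open>k\<close> lies weakly below an upper arc \<open>m\<close> in both
  endpoints (the relation \<open>R\<close>), take the extremal such pair. The lower arcs up to it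
  and the upper arcs from it on form two families; one keeps the larger family as inner arcs and
  drops the smaller, so that the count is not reduced.\<close>

lemma select_arcs:
  fixes a b :: "nat \<Rightarrow> nat"
  assumes "\<forall>m'<K. \<forall>m<m'. a m < a m'" and "\<forall>m'<K. \<forall>m<m'. b m' < b m"
    and "\<forall>m<K. a m \<noteq> b m" and "\<forall>m<K. b m \<le> j"
  shows "\<exists>Sel Inner. Inner \<subseteq> Sel \<and> Sel \<subseteq> {..<K} \<and> K \<le> card Sel + card Inner \<and>
    (\<forall>m\<in>Inner. a m \<le> j) \<and>
    (\<forall>m\<in>Sel. \<forall>m'\<in>Sel. m \<noteq> m' \<longrightarrow> max (a m) (b m) = max (a m') (b m') \<longrightarrow>
       min (a m) (b m) \<noteq> min (a m') (b m')) \<and>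
    (\<forall>m\<in>Sel. \<forall>m'\<in>Sel. min (a m) (b m) < max (a m') (b m')) \<and>
    (\<forall>m\<in>Sel. \<forall>m'\<in>Sel. m \<noteq> m' \<longrightarrow> max (a m') (b m') \<le> max (a m) (b m) \<longrightarrow>
       min (a m') (b m') \<le> min (a m) (b m) \<longrightarrow>
       m \<notin> Inner \<and> m' \<notin> Inner \<and> b m < a m \<and> a m' < b m')"
proof -
  have inc: "a m < a m'" and dec: "b m' < b m" if "m < m'" "m' < K" for m m'
    using assms(1,2) that by blast+
  have ne: "a m \<noteq> b m" and bj: "b m \<le> j" if "m < K" for m
    using assms(3,4) that by blast+
  have inc': "a m \<le> a m'" if "m \<le> m'" "m' < K" for m m'
    using inc[of m m'] that by (cases "m = m'") auto
  have dec': "b m' \<le> b m" if "m \<le> m'" "m' < K" for m m'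
    using dec[of m m'] that by (cases "m = m'") auto
  have upper_less_lower: "m < k" if "a m < b m" "b k < a k" "m < K" "k < K" for m k
    using inc'[of k m] dec'[of k m] that by (cases "m < k") auto
  define R where "R k m \<longleftrightarrow> k < K \<and> b k < a k \<and> m < K \<and> a m < b m \<and> b k \<le> a m \<and> a k \<le> b m" for k m
  have separated: "min (a m) (b m) < max (a m') (b m')" if m: "m < K" "m' < K" for m m'
    using inc[of m m'] dec[of m' m] ne[of m] m
    by (cases rule: linorder_cases[of m m']) (auto simp: max_def min_def)
  \<comment> \<open>Along the chain one endpoint grows and the other shrinks, so arcs of one kind never dominate each other.\<close>
  have nested: "\<not> (max (a m') (b m') \<le> max (a m) (b m) \<and> min (a m') (b m') \<le> min (a m) (b m))"
    if "m < K" "m' < K" "m \<noteq> m'" "(b m < a m) = (b m' < a m')" for m m'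
    using inc[of m m'] inc[of m' m] dec[of m m'] dec[of m' m] ne[of m] ne[of m'] that
    by (cases "m < m'"; cases "b m < a m") (auto simp: max_def min_def)
  have same_kind: "max (a m) (b m) = max (a m') (b m') \<Longrightarrow> min (a m) (b m) \<noteq> min (a m') (b m')"
    if "m < K" "m' < K" "m \<noteq> m'" "(b m < a m) = (b m' < a m')" for m m'
    using nested[OF that] by (metis order_refl)
  have finish: ?thesis if sub: "Inner \<subseteq> Sel" "Sel \<subseteq> {..<K}" "K \<le> card Sel + card Inner"
    "\<And>m. m \<in> Inner \<Longrightarrow> a m \<le> j"
    and outer: "\<And>k m. k \<in> Sel \<Longrightarrow> m \<in> Sel \<Longrightarrow> b k < a k \<Longrightarrow> a m < b m \<Longrightarrow> k \<notin> Inner \<Longrightarrow> m \<notin> Inner \<Longrightarrow> \<not> R k m"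
    and low: "\<And>k m. k \<in> Inner \<Longrightarrow> m \<in> Sel \<Longrightarrow> b k < a k \<Longrightarrow> a m < b m \<Longrightarrow> a m < b k \<and> a k < b m"
    and up: "\<And>k m. k \<in> Sel \<Longrightarrow> m \<in> Inner \<Longrightarrow> b k < a k \<Longrightarrow> a m < b m \<Longrightarrow> b k < a m \<and> b m < a k"
    for Sel Inner
  proof (rule exI[of _ Sel], rule exI[of _ Inner], intro conjI ballI impI)
    have K: "m < K" if "m \<in> Sel" for m using sub(2) that by auto
    show "min (a m) (b m) < max (a m') (b m')" if "m \<in> Sel" "m' \<in> Sel" for m m'
      using separated K that by blast
    have cross: "m \<notin> Inner \<and> m' \<notin> Inner \<and> b m < a m \<and> a m' < b m'"
      if m: "m \<in> Sel" "m' \<in> Sel" "m \<noteq> m'" "max (a m') (b m') \<le> max (a m) (b m)"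
        "min (a m') (b m') \<le> min (a m) (b m)" for m m'
    proof (cases "(b m < a m) = (b m' < a m')")
      case True
      then show ?thesis using nested[of m m'] K m by blast
    next
      case False
      show ?thesis
      proof (cases "b m < a m")
        case lower: True
        then have upper: "a m' < b m'" using False ne[OF K[OF m(2)]] by auto
        then have le: "a m' \<le> b m" "b m' \<le> a m" using m(4,5) lower by auto
        have "m \<notin> Inner"
        proof
          assume "m \<in> Inner"
          from low[OF this m(2) lower upper] show False using le by simp
        qed
        moreover have "m' \<notin> Inner"
        proof
          assume "m' \<in> Inner"
          from up[OF m(1) this lower upper] show False using le by simp
        qed
        ultimately show ?thesis using lower upper by blast
      next
        case upper: False
        then have up': "a m < b m" and lo': "b m' < a m'" using False ne[OF K[OF m(1)]] by auto
        then have le: "b m' \<le> a m" "a m' \<le> b m" using m(4,5) by auto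
        have "m' \<notin> Inner"
        proof
          assume "m' \<in> Inner"
          from low[OF this m(1) lo' up'] show False using le by simp
        qed
        moreover have "m \<notin> Inner"
        proof
          assume "m \<in> Inner"
          from up[OF m(2) this lo' up'] show False using le by simp
        qed
        ultimately have "\<not> R m' m" using outer[OF m(2,1) lo' up'] by blast
        then show ?thesis using le lo' up' K[OF m(1)] K[OF m(2)] unfolding R_def by blast
      qed
    qed
    show "m \<notin> Inner" "m' \<notin> Inner" "b m < a m" "a m' < b m'"
      if "m \<in> Sel" "m' \<in> Sel" "m \<noteq> m'" "max (a m') (b m') \<le> max (a m) (b m)"
        "min (a m') (b m') \<le> min (a m) (b m)" for m m'
      using cross[OF that] by blast+
    show "min (a m) (b m) \<noteq> min (a m') (b m')"
      if m: "m \<in> Sel" "m' \<in> Sel" "m \<noteq> m'" "max (a m) (b m) = max (a m') (b m')" for m m'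
    proof
      assume eq: "min (a m) (b m) = min (a m') (b m')"
      have "b m < a m" using cross[of m m'] m eq by simp
      moreover have "a m < b m" using cross[of m' m] m eq by simp
      ultimately show False by simp
    qed
  qed (use sub in auto)
  show ?thesis
  proof (cases "\<exists>k m. R k m")
    case False
    then show ?thesis by (intro finish[of "{}" "{..<K}"]) auto
  next
    case True
    define \<kappa> where "\<kappa> = (GREATEST k. \<exists>m. R k m)"
    have bound: "k \<le> K" if "\<exists>m. R k m" for k using that by (auto simp: R_def)
    have \<kappa>: "\<exists>m. R \<kappa> m" unfolding \<kappa>_def by (rule GreatestI_ex_nat[of _ K]) (use True bound in blast)+
    have \<kappa>max: "k \<le> \<kappa>" if "R k m" for k m
      unfolding \<kappa>_def by (rule Greatest_le_nat[of _ _ K]) (use that bound in blast)+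
    define \<mu> where "\<mu> = (LEAST m. R \<kappa> m)"
    have \<mu>: "R \<kappa> \<mu>" unfolding \<mu>_def using \<kappa> by (rule LeastI_ex)
    have \<mu>min: "\<not> R \<kappa> m" if "m < \<mu>" for m using that not_less_Least unfolding \<mu>_def by blast
    \<comment> \<open>Inner and outer, lower and upper arcs relative to the extremal pair. Outer arcs form no pair of \<open>R\<close>.\<close>
    define IL where "IL = {k. k \<le> \<kappa> \<and> b k < a k}"
    define IU where "IU = {m. \<mu> \<le> m \<and> m < K \<and> a m < b m}"
    define OL where "OL = {k. \<kappa> < k \<and> k < K \<and> b k < a k}"
    define OU where "OU = {m. m < \<mu> \<and> a m < b m}"
    note defs = IL_def IU_def OL_def OU_def
    have lim: "\<kappa> < K" "\<mu> < K" "b \<kappa> < a \<kappa>" "a \<mu> < b \<mu>" "b \<kappa> \<le> a \<mu>" "a \<kappa> \<le> b \<mu>"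
      using \<mu> by (auto simp: R_def)
    have fin: "finite IL" "finite IU" "finite OL" "finite OU"
      using lim by (auto simp: defs intro: finite_subset[of _ "{..<K}"])
    have cover: "{..<K} = OL \<union> OU \<union> IL \<union> IU"
    proof (intro equalityI subsetI)
      fix x assume x: "x \<in> {..<K}"
      then have "b x < a x \<or> a x < b x" using ne[of x] by auto
      moreover have "x \<le> \<kappa> \<or> \<kappa> < x" "x < \<mu> \<or> \<mu> \<le> x" by auto
      ultimately show "x \<in> OL \<union> OU \<union> IL \<union> IU" using x unfolding defs by blast
    qed (use lim in \<open>auto simp: defs\<close>)
    have "K = card (OL \<union> OU \<union> IL \<union> IU)" using cover card_lessThan[of K] by simp
    also have "\<dots> \<le> card OL + card OU + card IL + card IU"
      by (meson card_Un_le add_mono le_trans order_refl)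
    finally have count: "K \<le> card OL + card OU + card IL + card IU" .
    have OO: "OL \<inter> OU = {}" by (auto simp: defs)
    have inner_low: "a m < b k \<and> a k < b m" if "k \<in> IL" "m \<in> OU" for k m
    proof -
      have k: "k \<le> \<kappa>" "b k < a k" and m: "m < \<mu>" "a m < b m" using that by (auto simp: defs)
      have "a k \<le> a \<kappa>" "b \<kappa> \<le> b k" using inc'[OF k(1) lim(1)] dec'[OF k(1) lim(1)] by auto
      moreover have "b \<mu> < b m" using dec[OF m(1) lim(2)] .
      moreover have "\<not> R \<kappa> m" using \<mu>min m(1) by blast
      ultimately have "\<not> b \<kappa> \<le> a m" using lim m unfolding R_def by auto
      then show ?thesis
        using \<open>a k \<le> a \<kappa>\<close> \<open>b \<kappa> \<le> b k\<close> \<open>b \<mu> < b m\<close> lim by auto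
    qed
    have inner_up: "b k < a m \<and> b m < a k" if "k \<in> OL" "m \<in> IU" for k m
    proof -
      have k: "\<kappa> < k" "k < K" "b k < a k" and m: "\<mu> \<le> m" "m < K" "a m < b m" using that by (auto simp: defs)
      have "a \<mu> \<le> a m" using inc'[OF m(1,2)] .
      moreover have "b k < b \<kappa>" using dec[OF k(1,2)] .
      moreover have "\<not> R k m" using \<kappa>max[of k m] k(1) by auto
      ultimately have "\<not> a k \<le> b m" using lim m k unfolding R_def by auto
      then show ?thesis
        using \<open>a \<mu> \<le> a m\<close> \<open>b k < b \<kappa>\<close> lim by auto
    qed
    have outer: "\<not> R k m" if "k \<in> OL" for k m using that \<kappa>max[of k m] by (auto simp: defs)
    show ?thesis
    proof (cases "card IU \<le> card IL")
      case True
      have "(OL \<union> OU) \<inter> IL = {}" unfolding defs by auto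
      then have card: "card (OL \<union> OU \<union> IL) = card OL + card OU + card IL"
        using OO fin by (simp add: card_Un_disjoint)
      show ?thesis
      proof (rule finish[of IL "OL \<union> OU \<union> IL"])
        show "IL \<subseteq> OL \<union> OU \<union> IL" by blast
        show "OL \<union> OU \<union> IL \<subseteq> {..<K}" unfolding cover by blast
        show "K \<le> card (OL \<union> OU \<union> IL) + card IL" using card count True by linarith
        show "a m \<le> j" if "m \<in> IL" for m
          using that inc'[of m \<kappa>] lim bj[of \<mu>] unfolding defs by auto
        show "\<not> R k m" if "k \<in> OL \<union> OU \<union> IL" "b k < a k" "k \<notin> IL" for k m
        proof -
          have "k \<in> OL" using that unfolding defs by auto
          then show ?thesis by (rule outer)
        qed
        show "a m < b k \<and> a k < b m" if "k \<in> IL" "m \<in> OL \<union> OU \<union> IL" "a m < b m" for k m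
        proof -
          have "m \<in> OU" using that unfolding defs by auto
          with that(1) show ?thesis by (rule inner_low)
        qed
        show "b k < a m \<and> b m < a k" if "m \<in> IL" "a m < b m" for k m
          using that unfolding defs by auto
      qed
    next
      case False
      have "(OL \<union> OU) \<inter> IU = {}" unfolding defs by auto
      then have card: "card (OL \<union> OU \<union> IU) = card OL + card OU + card IU"
        using OO fin by (simp add: card_Un_disjoint)
      show ?thesis
      proof (rule finish[of IU "OL \<union> OU \<union> IU"])
        show "IU \<subseteq> OL \<union> OU \<union> IU" by blast
        show "OL \<union> OU \<union> IU \<subseteq> {..<K}" unfolding cover by blast
        show "K \<le> card (OL \<union> OU \<union> IU) + card IU" using card count False by linarith
        show "a m \<le> j" if "m \<in> IU" for m
          using that bj[of m] unfolding defs by auto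
        show "\<not> R k m" if "k \<in> OL \<union> OU \<union> IU" "b k < a k" for k m
        proof -
          have "k \<in> OL" using that unfolding defs by auto
          then show ?thesis by (rule outer)
        qed
        show "a m < b k \<and> a k < b m" if "k \<in> IU" "b k < a k" for k m
          using that unfolding defs by auto
        show "b k < a m \<and> b m < a k" if "k \<in> OL \<union> OU \<union> IU" "m \<in> IU" "b k < a k" for k m
        proof -
          have "k \<in> OL" using that unfolding defs by auto
          then show ?thesis using that(2) by (rule inner_up)
        qed
      qed
    qed
  qed
qed

text \<open>The arcs have to be listed in decreasing order for the Pfaffian expansion.\<close>

lemma sorted_enumeration:
  fixes key :: "nat \<Rightarrow> nat"
  assumes "finite S" "inj_on key S"
  shows "\<exists>s. bij_betw s {..<card S} S \<and> (\<forall>p q. p < q \<longrightarrow> q < card S \<longrightarrow> key (s q) < key (s p))"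
proof -
  define xs where "xs = rev (sorted_list_of_set (key ` S))"
  have len: "length xs = card S" using assms by (simp add: xs_def card_image)
  have set: "set xs = key ` S" "distinct xs" using assms by (simp_all add: xs_def)
  have dec: "xs ! q < xs ! p" if "p < q" "q < card S" for p q
    using sorted_wrt_nth_less[of "\<lambda>x y. y < x" xs p q] that len
    by (simp add: xs_def sorted_wrt_rev strict_sorted_list_of_set)
  define s where "s p = inv_into S key (xs ! p)" for p
  have key: "key (s p) = xs ! p" if "p < card S" for p
    using that len set by (simp add: s_def f_inv_into_f nth_mem[of p xs, unfolded set(1)])
  have "bij_betw s {..<card S} S"
  proof -
    have "bij_betw (\<lambda>p. xs ! p) {..<card S} (key ` S)"
      using bij_betw_nth[of xs "{..<card S}" "key ` S"] set len by simp
    moreover have "bij_betw (inv_into S key) (key ` S) S"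
      using assms(2) by (simp add: bij_betw_inv_into inj_on_imp_bij_betw)
    ultimately have "bij_betw (inv_into S key \<circ> (\<lambda>p. xs ! p)) {..<card S} S" by (rule bij_betw_trans)
    then show ?thesis by (simp add: comp_def s_def[abs_def])
  qed
  then show ?thesis using key dec by (intro exI[of _ s]) auto
qed

text \<open>For the arcs chosen by \<open>select_arcs\<close>, the mask \<open>Z\<close> contains, for each
  arc that is not inner, the endpoint coming from \<open>a\<close>; only the endpoints from
  \<open>b\<close> are known to be at most \<open>j\<close>. The leading monomial of the masked
  Pfaffian divides the monomial of the chain, and at least \<open>K\<close> unmasked indices make
  it vanish wherever the corner rank is smaller than \<open>K\<close>.\<close>

lemma chain_lead:
  fixes a b :: "nat \<Rightarrow> nat"
  assumes inc: "\<And>m m'. m < m' \<Longrightarrow> m' < K \<Longrightarrow> a m < a m'"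
    and dec: "\<And>m m'. m < m' \<Longrightarrow> m' < K \<Longrightarrow> b m' < b m"
    and ne: "\<And>m. m < K \<Longrightarrow> a m \<noteq> b m"
    and ai: "\<And>m. m < K \<Longrightarrow> a m \<in> {1..i}" and bj: "\<And>m. m < K \<Longrightarrow> b m \<in> {1..j}"
    and ji: "j \<le> i" "i \<le> n"
  shows "\<exists>P \<in> carrier (poly_ring (ss_vars n)). \<exists>E \<subseteq> {(max (a m) (b m), min (a m) (b m)) | m. m < K}.
    is_lead P (squarefree_mon E) \<and>
    (\<forall>M :: 'k::field mat. M \<in> skew_mats n \<longrightarrow> corner_rank M i j < K \<longrightarrow> poly_eval (ss_point M) P = 0)"
proof -
  define hi where "hi m = max (a m) (b m)" for m
  define lo where "lo m = min (a m) (b m)" for m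
  have bj': "b m \<le> j" if "m < K" for m using bj[OF that] by simp
  have "\<forall>m'<K. \<forall>m<m'. a m < a m'" "\<forall>m'<K. \<forall>m<m'. b m' < b m"
    "\<forall>m<K. a m \<noteq> b m" "\<forall>m<K. b m \<le> j"
    using inc dec ne bj' by blast+
  from select_arcs[OF this, folded hi_def lo_def]
  obtain Sel Inner where sel: "Inner \<subseteq> Sel" "Sel \<subseteq> {..<K}" "K \<le> card Sel + card Inner"
    and aj: "\<forall>m\<in>Inner. a m \<le> j"
    and inj: "\<forall>m\<in>Sel. \<forall>m'\<in>Sel. m \<noteq> m' \<longrightarrow> hi m = hi m' \<longrightarrow> lo m \<noteq> lo m'"
    and sep: "\<forall>m\<in>Sel. \<forall>m'\<in>Sel. lo m < hi m'"
    and cross: "\<forall>m\<in>Sel. \<forall>m'\<in>Sel. m \<noteq> m' \<longrightarrow> hi m' \<le> hi m \<longrightarrow> lo m' \<le> lo m \<longrightarrow>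
       m \<notin> Inner \<and> m' \<notin> Inner \<and> b m < a m \<and> a m' < b m'"
    by (elim exE conjE)
  have fin: "finite Sel" using sel(2) finite_subset by blast
  define N where "N = card Sel"
  have lo_n: "lo m < Suc n" "hi m \<in> {1..i}" "lo m \<in> {1..i}" if "m \<in> Sel" for m
  proof -
    have "m < K" using that sel(2) by blast
    then show "lo m < Suc n" "hi m \<in> {1..i}" "lo m \<in> {1..i}"
      using ai[of m] bj[of m] ji by (auto simp: lo_def hi_def min_def max_def)
  qed
  \<comment> \<open>The lexicographic order of the arcs, encoded in one number as \<open>lo m \<le> n\<close>.\<close>
  define key where "key m = hi m * Suc n + lo m" for m
  have key_less: "hi m < hi m' \<or> (hi m = hi m' \<and> lo m < lo m')" if "key m < key m'" "m \<in> Sel" "m' \<in> Sel" for m m'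
  proof (rule ccontr)
    assume neg: "\<not> ?thesis"
    have "key m' \<le> key m"
    proof (cases "hi m = hi m'")
      case True
      then show ?thesis using neg by (simp add: key_def)
    next
      case False
      then have "hi m' + 1 \<le> hi m" using neg by simp
      then have "(hi m' + 1) * Suc n \<le> hi m * Suc n" by (rule mult_le_mono1)
      then show ?thesis using lo_n(1)[OF that(3)] by (simp add: key_def)
    qed
    then show False using that by simp
  qed
  have "inj_on key Sel"
  proof (rule inj_onI, rule ccontr)
    fix m m' assume m: "m \<in> Sel" "m' \<in> Sel" "key m = key m'" "m \<noteq> m'"
    have "hi m * Suc n + lo m = hi m' * Suc n + lo m'" using m(3) by (simp only: key_def)
    moreover have "(hi m * Suc n + lo m) div Suc n = hi m" "(hi m' * Suc n + lo m') div Suc n = hi m'"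
      using lo_n(1)[OF m(1)] lo_n(1)[OF m(2)] by (simp_all only: div_mult_self3 div_less add_0_right)
    ultimately have "hi m = hi m'" by metis
    then show False using inj m by (auto simp: key_def)
  qed
  from sorted_enumeration[OF fin this] obtain s where
    bij: "bij_betw s {..<N} Sel" and sorted: "\<And>p q. p < q \<Longrightarrow> q < N \<Longrightarrow> key (s q) < key (s p)"
    unfolding N_def by blast
  have sSel: "s p \<in> Sel" if "p < N" for p using bij that by (auto simp: bij_betw_def)
  define \<phi> where "\<phi> x = (if even x then hi (s (x div 2)) else lo (s (x div 2)))" for x
  define Z where "Z = {x. x < 2 * N \<and> s (x div 2) \<notin> Inner \<and>
    (if even x then b (s (x div 2)) < a (s (x div 2)) else a (s (x div 2)) < b (s (x div 2)))}"
  have \<phi>: "\<phi> (2 * p) = hi (s p)" "\<phi> (2 * p + 1) = lo (s p)" for p by (simp_all add: \<phi>_def)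
  have Z: "2 * p \<in> Z \<longleftrightarrow> p < N \<and> s p \<notin> Inner \<and> b (s p) < a (s p)"
    "2 * p + 1 \<in> Z \<longleftrightarrow> p < N \<and> s p \<notin> Inner \<and> a (s p) < b (s p)" for p
    by (auto simp: Z_def)
  have lex: "hi (s q) < hi (s p) \<or> (hi (s q) = hi (s p) \<and> lo (s q) < lo (s p))" if "p < q" "q < N" for p q
    using key_less[OF sorted[OF that]] sSel that by simp
  define P :: "(nat \<times> nat, 'k) mpoly" where "P = pfaffian N (masked_entry \<phi> Z) {2 * 0..<2 * N}"
  define E where "E = (\<lambda>m. (hi m, lo m)) ` Sel"
  have "is_lead P (\<Sum>p\<in>{0..<N}. Poly_Mapping.single (\<phi> (2 * p), \<phi> (2 * p + 1)) 1)"
    unfolding P_def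
  proof (rule pfaffian_lead)
    fix p assume p: "p < N"
    show "\<phi> (2 * p + 1) < \<phi> (2 * p) \<and> \<not> (2 * p \<in> Z \<and> 2 * p + 1 \<in> Z)"
      using sep sSel[OF p] unfolding \<phi> Z by auto
    fix y assume y: "2 * p + 1 < y" "y < 2 * N"
    define q where "q = y div 2"
    have q: "p < q" "q < N" using y by (auto simp: q_def)
    have pq: "s p \<in> Sel" "s q \<in> Sel" using sSel p q by auto
    show "2 * p \<in> Z \<and> y \<in> Z \<or> \<phi> (2 * p + 1) < \<phi> y"
    proof (cases "even y")
      case True
      then have "y = 2 * q" by (simp add: q_def)
      then show ?thesis using sep pq by (simp add: \<phi> del: One_nat_def)
    next
      case False
      then have y2: "y = 2 * q + 1" unfolding q_def by presburger
      show ?thesis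
      proof (cases "lo (s q) \<le> lo (s p)")
        case True
        have "s p \<noteq> s q" using sorted[OF q] by auto
        moreover have "hi (s q) \<le> hi (s p)" using lex[OF q] by auto
        ultimately have "s p \<notin> Inner \<and> s q \<notin> Inner \<and> b (s p) < a (s p) \<and> a (s q) < b (s q)"
          using cross pq True by blast
        then show ?thesis using p q unfolding y2 Z by blast
      next
        case False
        then show ?thesis unfolding y2 \<phi> by simp
      qed
    qed
  next
    fix p q assume "p < q" "q < N"
    then show "((\<phi> (2 * q), \<phi> (2 * q + 1)), \<phi> (2 * p), \<phi> (2 * p + 1)) \<in> less_than <*lex*> less_than"
      using lex[of p q] unfolding \<phi> by auto
  qed simp
  also have "(\<Sum>p\<in>{0..<N}. Poly_Mapping.single (\<phi> (2 * p), \<phi> (2 * p + 1)) 1) =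
      (\<Sum>p\<in>{..<N}. Poly_Mapping.single (hi (s p), lo (s p)) (1::nat))"
    by (simp add: \<phi> atLeast0LessThan del: One_nat_def)
  also have "\<dots> = (\<Sum>m\<in>Sel. Poly_Mapping.single (hi m, lo m) 1)"
    by (rule sum.reindex_bij_betw[OF bij])
  also have "\<dots> = squarefree_mon E"
  proof -
    have "inj_on (\<lambda>m. (hi m, lo m)) Sel" using inj by (auto simp: inj_on_def)
    then show ?thesis unfolding squarefree_mon_def E_def by (simp add: sum.reindex)
  qed
  finally have lead: "is_lead P (squarefree_mon E)" .
  have range: "\<phi> x \<in> {1..i}" if "x < 2 * N" for x
  proof -
    have "s (x div 2) \<in> Sel" using sSel that by simp
    then show ?thesis using lo_n by (simp add: \<phi>_def)
  qed
  have car: "P \<in> carrier (poly_ring (ss_vars n))"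
    unfolding P_def
  proof (rule pfaffian_carrier[of "{2 * 0..<2 * N}"])
    fix x y assume "x \<in> {2 * 0..<2 * N}" "y \<in> {2 * 0..<2 * N}"
    then have "\<phi> x \<in> {1..n}" "\<phi> y \<in> {1..n}" using range[of x] range[of y] ji by auto
    then show "masked_entry \<phi> Z x y \<in> carrier (poly_ring (ss_vars n))"
      unfolding masked_entry_def using u_entry_carrier carrier_0 by auto
  qed auto
  have vanish: "poly_eval (ss_point M) P = 0" if M: "M \<in> skew_mats n" "corner_rank M i j < K" for M :: "'k mat"
  proof -
    define F where "F = {..<2 * N} - Z"
    \<comment> \<open>Every arc that is not inner loses just one endpoint to the mask.\<close>
    have "Z \<subseteq> (\<lambda>p. if b (s p) < a (s p) then 2 * p else 2 * p + 1) ` {p. p < N \<and> s p \<notin> Inner}"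
    proof
      fix x assume x: "x \<in> Z"
      then have "x = (if b (s (x div 2)) < a (s (x div 2)) then 2 * (x div 2) else 2 * (x div 2) + 1)"
        by (auto simp: Z_def split: if_splits)
      moreover have "x div 2 < N" "s (x div 2) \<notin> Inner" using x by (auto simp: Z_def)
      ultimately show "x \<in> (\<lambda>p. if b (s p) < a (s p) then 2 * p else 2 * p + 1) ` {p. p < N \<and> s p \<notin> Inner}"
        by (intro image_eqI[of _ _ "x div 2"]) auto
    qed
    then have "card Z \<le> card {p. p < N \<and> s p \<notin> Inner}"
      by (rule surj_card_le[rotated]) simp
    also have "\<dots> = card (s ` {p. p < N \<and> s p \<notin> Inner})"
      using bij by (intro card_image[symmetric]) (auto simp: bij_betw_def inj_on_def)
    also have "s ` {p. p < N \<and> s p \<notin> Inner} = Sel - Inner"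
      using bij by (auto simp: bij_betw_def)
    also have "card (Sel - Inner) = N - card Inner"
      using sel(1) fin by (simp add: N_def card_Diff_subset finite_subset)
    finally have "card Z \<le> N - card Inner" .
    moreover have "card F = 2 * N - card Z"
      unfolding F_def by (subst card_Diff_subset) (auto simp: Z_def intro: finite_subset[of _ "{..<2 * N}"])
    moreover have "card Inner \<le> N" using sel(1) fin by (simp add: N_def card_mono)
    ultimately have cardF: "K \<le> card F" using sel(3) by (simp add: N_def)
    have "\<phi> ` F \<subseteq> {1..j}"
    proof
      fix y assume "y \<in> \<phi> ` F"
      then obtain x where x: "x < 2 * N" "x \<notin> Z" "y = \<phi> x" by (auto simp: F_def)
      define m where "m = s (x div 2)"
      have m: "m \<in> Sel" using sSel x(1) by (simp add: m_def)
      then have mK: "m < K" using sel(2) by auto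
      have "m \<in> Inner \<or> (if even x then \<not> b m < a m else \<not> a m < b m)"
        using x(1,2) by (auto simp: Z_def m_def)
      then show "y \<in> {1..j}"
        using ai[OF mK] bj[OF mK] aj unfolding x(3) \<phi>_def m_def[symmetric] hi_def lo_def by auto
    qed
    then show ?thesis
      unfolding P_def mult_0_right using M ji range cardF
      by (intro masked_pfaffian_vanishes[of M n i j N \<phi> F Z "K - 1"]) (auto simp: F_def)
  qed
  show ?thesis
  proof (intro bexI[OF _ car] exI[of _ E] conjI allI impI lead vanish)
    show "E \<subseteq> {(max (a m) (b m), min (a m) (b m)) | m. m < K}"
      using sel(2) by (auto simp: E_def hi_def lo_def)
  qed
qed

section \<open>Exchange properties of antidiagonal chains\<close>

text \<open>An antidiagonal chain of length \<open>s\<close> in \<open>E\<close> within the corner with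
  \<open>i\<close> rows and \<open>j\<close> columns.\<close>

definition strict_chain :: "(nat \<times> nat) set \<Rightarrow> nat \<Rightarrow> nat \<Rightarrow> nat \<Rightarrow> (nat \<Rightarrow> nat) \<Rightarrow> (nat \<Rightarrow> nat) \<Rightarrow> bool" where
  "strict_chain E i j s x y \<longleftrightarrow>
     (\<forall>t<s. (x t, y t) \<in> E \<and> x t \<in> {1..i} \<and> y t \<in> {1..j}) \<and>
     (\<forall>u<s. \<forall>t<u. x t < x u \<and> y u < y t)"

definition has_chain :: "(nat \<times> nat) set \<Rightarrow> nat \<Rightarrow> nat \<Rightarrow> nat \<Rightarrow> bool" where
  "has_chain E i j s \<longleftrightarrow> (\<exists>x y. strict_chain E i j s x y)"

lemma has_chainI: "strict_chain E i j s x y \<Longrightarrow> has_chain E i j s"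
  unfolding has_chain_def by blast

lemma strict_chainD:
  assumes "strict_chain E i j s x y"
  shows "t < s \<Longrightarrow> (x t, y t) \<in> E" "t < s \<Longrightarrow> x t \<in> {1..i}" "t < s \<Longrightarrow> y t \<in> {1..j}"
    "t < u \<Longrightarrow> u < s \<Longrightarrow> x t < x u" "t < u \<Longrightarrow> u < s \<Longrightarrow> y u < y t"
    "t \<le> u \<Longrightarrow> u < s \<Longrightarrow> x t \<le> x u" "t \<le> u \<Longrightarrow> u < s \<Longrightarrow> y u \<le> y t"
proof -
  show lt: "t < u \<Longrightarrow> u < s \<Longrightarrow> x t < x u" "t < u \<Longrightarrow> u < s \<Longrightarrow> y u < y t"
    using assms unfolding strict_chain_def by blast+
  show "t \<le> u \<Longrightarrow> u < s \<Longrightarrow> x t \<le> x u" "t \<le> u \<Longrightarrow> u < s \<Longrightarrow> y u \<le> y t"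
    using lt by (cases "t = u"; simp add: less_imp_le)+
qed (use assms in \<open>auto simp: strict_chain_def\<close>)

lemma strict_chainI:
  assumes "\<And>t. t < s \<Longrightarrow> (x t, y t) \<in> E" "\<And>t. t < s \<Longrightarrow> x t \<in> {1..i}" "\<And>t. t < s \<Longrightarrow> y t \<in> {1..j}"
    "\<And>t u. t < u \<Longrightarrow> u < s \<Longrightarrow> x t < x u" "\<And>t u. t < u \<Longrightarrow> u < s \<Longrightarrow> y u < y t"
  shows "strict_chain E i j s x y"
  unfolding strict_chain_def using assms by simp

lemma has_chain_mono:
  assumes "has_chain E i j s" "i \<le> i'" "j \<le> j'" "s' \<le> s" "E \<subseteq> E'"
  shows "has_chain E' i' j' s'"
proof -
  obtain x y where c: "strict_chain E i j s x y" using assms(1) unfolding has_chain_def by blast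
  have "strict_chain E' i' j' s' x y"
  proof (rule strict_chainI)
    fix t assume "t < s'"
    then have t: "t < s" using assms(4) by simp
    show "(x t, y t) \<in> E'" using strict_chainD(1)[OF c t] assms(5) by blast
    show "x t \<in> {1..i'}" "y t \<in> {1..j'}" using strict_chainD(2,3)[OF c t] assms(2,3) by auto
  qed (use strict_chainD(4,5)[OF c] assms(4) in auto)
  then show ?thesis by (rule has_chainI)
qed

lemma has_chain_0: "has_chain E i j 0"
  by (rule has_chainI) (rule strict_chainI; simp)

lemma has_chain_length: "has_chain E i j s \<Longrightarrow> s \<le> i"
proof (induction s arbitrary: i)
  case (Suc s)
  then obtain x y where c: "strict_chain E i j (Suc s) x y" unfolding has_chain_def by blast
  have "i \<noteq> 0" using strict_chainD(2)[OF c, of s] by auto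
  then obtain i' where i: "i = Suc i'" by (cases i) auto
  have "strict_chain E i' j s x y"
  proof (rule strict_chainI)
    fix t assume "t < s"
    then show "x t \<in> {1..i'}"
      using strict_chainD(4)[OF c, of t s] strict_chainD(2)[OF c, of t] strict_chainD(2)[OF c, of s] i by auto
  qed (use strict_chainD[OF c] in auto)
  then show ?case using Suc.IH[of i'] has_chainI i by blast
qed simp

lemma has_chain_drop_row:
  assumes "has_chain E (Suc i) j (Suc s)"
  shows "has_chain E i j s"
proof -
  obtain x y where c: "strict_chain E (Suc i) j (Suc s) x y" using assms unfolding has_chain_def by blast
  have "strict_chain E i j s x y"
  proof (rule strict_chainI)
    fix t assume "t < s"
    then show "x t \<in> {1..i}"
      using strict_chainD(4)[OF c, of t s] strict_chainD(2)[OF c, of t] strict_chainD(2)[OF c, of s] by auto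
  qed (use strict_chainD[OF c] in auto)
  then show ?thesis by (rule has_chainI)
qed

lemma strict_chain_transpose:
  assumes "sym E" "strict_chain E i j s x y"
  shows "strict_chain E j i s (\<lambda>t. y (s - 1 - t)) (\<lambda>t. x (s - 1 - t))"
proof (rule strict_chainI)
  fix t assume "t < s"
  then have "s - 1 - t < s" by simp
  then show "(y (s - 1 - t), x (s - 1 - t)) \<in> E"
    using strict_chainD(1)[OF assms(2)] symD[OF assms(1)] by blast
qed (use strict_chainD[OF assms(2)] in auto)

lemma has_chain_transpose: "sym E \<Longrightarrow> has_chain E i j s \<Longrightarrow> has_chain E j i s"
  unfolding has_chain_def using strict_chain_transpose by blast

text \<open>A chain that needs column \<open>j + 1\<close> starts there, and a chain that needs row \<open>i
  + 1\<close> ends there. If at some place the first can be continued by the second without loss,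
  the result is longer by one. Otherwise the two cross, and switching at the crossing from the
  second to the first yields a chain of the same length that needs neither.\<close>

lemma has_chain_supermodular:
  assumes c: "has_chain E i (Suc j) (Suc k)" and d: "has_chain E (Suc i) j (Suc k)"
    and no: "\<not> has_chain E i j (Suc k)"
  shows "has_chain E (Suc i) (Suc j) (Suc (Suc k))"
proof -
  obtain xc yc where c: "strict_chain E i (Suc j) (Suc k) xc yc" using c unfolding has_chain_def by blast
  obtain xd yd where d: "strict_chain E (Suc i) j (Suc k) xd yd" using d unfolding has_chain_def by blast
  note C = strict_chainD[OF c] and D = strict_chainD[OF d]
  have c0: "yc 0 = Suc j"
  proof (rule ccontr)
    assume "yc 0 \<noteq> Suc j"
    then have "yc 0 \<le> j" using C(3)[of 0] by simp
    then have "yc t \<in> {1..j}" if "t < Suc k" for t using C(7)[of 0 t] C(3)[of t] that by simp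
    then have "strict_chain E i j (Suc k) xc yc" by (intro strict_chainI C)
    then show False using no has_chainI by blast
  qed
  have dk: "xd k = Suc i"
  proof (rule ccontr)
    assume "xd k \<noteq> Suc i"
    then have "xd k \<le> i" using D(2)[of k] by simp
    then have "xd t \<in> {1..i}" if "t < Suc k" for t using D(6)[of t k] D(2)[of t] that by simp
    then have "strict_chain E i j (Suc k) xd yd" by (intro strict_chainI D)
    then show False using no has_chainI by blast
  qed
  show ?thesis
  proof (cases "\<exists>s\<le>k. xc s < xd s \<and> yd s < yc s")
    case True
    then obtain s where s: "s \<le> k" "xc s < xd s" "yd s < yc s" by blast
    have "strict_chain E (Suc i) (Suc j) (Suc (Suc k))
        (\<lambda>t. if t \<le> s then xc t else xd (t - 1)) (\<lambda>t. if t \<le> s then yc t else yd (t - 1))"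
    proof (rule strict_chainI)
      fix t assume t: "t < Suc (Suc k)"
      show "(if t \<le> s then xc t else xd (t - 1), if t \<le> s then yc t else yd (t - 1)) \<in> E"
        using C(1)[of t] D(1)[of "t - 1"] t s(1) by auto
      show "(if t \<le> s then xc t else xd (t - 1)) \<in> {1..Suc i}"
        using C(2)[of t] D(2)[of "t - 1"] t s(1) by auto
      show "(if t \<le> s then yc t else yd (t - 1)) \<in> {1..Suc j}"
        using C(3)[of t] D(3)[of "t - 1"] t s(1) by (auto intro: le_SucI)
    next
      fix t u assume tu: "t < u" "u < Suc (Suc k)"
      consider "u \<le> s" | "t \<le> s" "s < u" | "s < t" using tu by linarith
      then show "(if t \<le> s then xc t else xd (t - 1)) < (if u \<le> s then xc u else xd (u - 1))"
      proof cases
        case 2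
        then have "xc t \<le> xc s" "xd s \<le> xd (u - 1)" using C(6)[of t s] D(6)[of s "u - 1"] s(1) tu by auto
        then show ?thesis using 2 s(2) by simp
      qed (use C(4)[of t u] D(4)[of "t - 1" "u - 1"] tu s(1) in auto)
      consider "u \<le> s" | "t \<le> s" "s < u" | "s < t" using tu by linarith
      then show "(if u \<le> s then yc u else yd (u - 1)) < (if t \<le> s then yc t else yd (t - 1))"
      proof cases
        case 2
        then have "yc s \<le> yc t" "yd (u - 1) \<le> yd s" using C(7)[of t s] D(7)[of s "u - 1"] s(1) tu by auto
        then show ?thesis using 2 s(3) by simp
      qed (use C(5)[of t u] D(5)[of "t - 1" "u - 1"] tu s(1) in auto)
    qed
    then show ?thesis by (rule has_chainI)
  next
    case False
    define Q where "Q s \<longleftrightarrow> xd s \<le> xc s" for s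
    have "yd 0 < yc 0" using c0 D(3)[of 0] by simp
    then have "Q 0" using False unfolding Q_def by (metis le0 not_le)
    moreover have "\<not> Q k" using dk C(2)[of k] unfolding Q_def by simp
    ultimately obtain s where s: "s < k" "Q s" "\<not> Q (Suc s)"
    proof -
      assume *: "\<And>s. s < k \<Longrightarrow> Q s \<Longrightarrow> \<not> Q (Suc s) \<Longrightarrow> thesis"
      have "Q t" if "\<And>s. s < k \<Longrightarrow> Q s \<Longrightarrow> Q (Suc s)" "t \<le> k" for t
        using that(2) by (induction t) (use \<open>Q 0\<close> that(1) in auto)
      then show thesis using * \<open>\<not> Q k\<close> by blast
    qed
    have xs: "xd s \<le> xc s" using s(2) unfolding Q_def .
    have "xc (Suc s) < xd (Suc s)" using s(3) unfolding Q_def by simp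
    then have ys: "yc (Suc s) \<le> yd (Suc s)" using False s(1) by (metis Suc_leI not_le)
    have "strict_chain E i j (Suc k)
        (\<lambda>t. if t \<le> s then xd t else xc t) (\<lambda>t. if t \<le> s then yd t else yc t)"
    proof (rule strict_chainI)
      fix t assume t: "t < Suc k"
      show "(if t \<le> s then xd t else xc t, if t \<le> s then yd t else yc t) \<in> E"
        using C(1)[of t] D(1)[of t] t by auto
      have "xd t \<le> i" if "t \<le> s"
        using D(6)[OF that] xs C(2)[of s] s(1) by simp
      then show "(if t \<le> s then xd t else xc t) \<in> {1..i}"
        using C(2)[of t] D(2)[of t] t by auto
      have "yc t \<le> j" if "\<not> t \<le> s"
        using C(7)[of "Suc s" t] that t ys D(3)[of "Suc s"] s(1) by simp
      then show "(if t \<le> s then yd t else yc t) \<in> {1..j}"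
        using C(3)[of t] D(3)[of t] t by auto
    next
      fix t u assume tu: "t < u" "u < Suc k"
      consider "u \<le> s" | "t \<le> s" "s < u" | "s < t" using tu by linarith
      then show "(if t \<le> s then xd t else xc t) < (if u \<le> s then xd u else xc u)"
      proof cases
        case 2
        then have "xd t \<le> xd s" "xc s < xc u" using D(6)[of t s] C(4)[of s u] s(1) tu by auto
        then show ?thesis using 2 xs by simp
      qed (use C(4)[of t u] D(4)[of t u] tu in auto)
      consider "u \<le> s" | "t \<le> s" "s < u" | "s < t" using tu by linarith
      then show "(if u \<le> s then yd u else yc u) < (if t \<le> s then yd t else yc t)"
      proof cases
        case 2
        then have "yd (Suc s) < yd t" "yc u \<le> yc (Suc s)"
          using D(5)[of t "Suc s"] C(7)[of "Suc s" u] s(1) tu by auto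
        then show ?thesis using 2 ys by simp
      qed (use C(5)[of t u] D(5)[of t u] tu in auto)
    qed
    then show ?thesis using no has_chainI by blast
  qed
qed

text \<open>The part of a chain above the diagonal continues with its own mirror image.\<close>

lemma fold_half_chain:
  assumes E: "sym E" and c: "strict_chain E i i s x y" and t0: "t0 \<le> s"
    and upper: "\<And>t. t < t0 \<Longrightarrow> x t < y t"
  shows "has_chain E i i (2 * t0)"
proof (rule has_chainI)
  note C = strict_chainD[OF c]
  have low: "x t < y u" if "t < t0" "u < t0" for t u
  proof -
    have "x t \<le> x (t0 - 1)" by (rule C(6)) (use that t0 in auto)
    also have "\<dots> < y (t0 - 1)" by (rule upper) (use that in auto)
    also have "\<dots> \<le> y u" by (rule C(7)) (use that t0 in auto)
    finally show ?thesis .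
  qed
  show "strict_chain E i i (2 * t0) (\<lambda>t. if t < t0 then x t else y (2 * t0 - 1 - t))
      (\<lambda>t. if t < t0 then y t else x (2 * t0 - 1 - t))"
  proof (rule strict_chainI)
    fix t assume t: "t < 2 * t0"
    show "(if t < t0 then x t else y (2 * t0 - 1 - t), if t < t0 then y t else x (2 * t0 - 1 - t)) \<in> E"
      using C(1)[of t] C(1)[of "2 * t0 - 1 - t"] symD[OF E] t t0 by auto
    show "(if t < t0 then x t else y (2 * t0 - 1 - t)) \<in> {1..i}"
      using C(2)[of t] C(3)[of "2 * t0 - 1 - t"] t t0 by auto
    show "(if t < t0 then y t else x (2 * t0 - 1 - t)) \<in> {1..i}"
      using C(3)[of t] C(2)[of "2 * t0 - 1 - t"] t t0 by auto
  next
    fix t u assume tu: "t < u" "u < 2 * t0"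
    consider "u < t0" | "t < t0" "t0 \<le> u" | "t0 \<le> t" using tu by linarith
    then show "(if t < t0 then x t else y (2 * t0 - 1 - t)) < (if u < t0 then x u else y (2 * t0 - 1 - u))"
    proof cases
      case 2
      then show ?thesis using low[of t "2 * t0 - 1 - u"] tu by auto
    qed (use C(4)[of t u] C(5)[of "2 * t0 - 1 - u" "2 * t0 - 1 - t"] tu t0 in auto)
    consider "u < t0" | "t < t0" "t0 \<le> u" | "t0 \<le> t" using tu by linarith
    then show "(if u < t0 then y u else x (2 * t0 - 1 - u)) < (if t < t0 then y t else x (2 * t0 - 1 - t))"
    proof cases
      case 2
      then show ?thesis using low[of "2 * t0 - 1 - u" t] tu by auto
    qed (use C(5)[of t u] C(4)[of "2 * t0 - 1 - u" "2 * t0 - 1 - t"] tu t0 in auto)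
  qed
qed

text \<open>A chain has its entries above the diagonal first and those below it last. Doubling the longer of
  the two parts by reflection gives a chain of even length that is at least as long.\<close>

lemma square_chain_even:
  assumes E: "sym E" "irrefl E" and c: "has_chain E i i s"
  shows "\<exists>t. s \<le> 2 * t \<and> has_chain E i i (2 * t)"
proof -
  obtain x y where c: "strict_chain E i i s x y" using c unfolding has_chain_def by blast
  note C = strict_chainD[OF c]
  have ne: "x t \<noteq> y t" if "t < s" for t using C(1)[OF that] E(2) by (auto simp: irrefl_def)
  define t0 where "t0 = (LEAST t. t = s \<or> y t < x t)"
  have t0: "t0 = s \<or> y t0 < x t0" unfolding t0_def by (rule LeastI[of _ s]) simp
  have le: "t0 \<le> s" unfolding t0_def by (rule Least_le) simp
  have upper: "x t < y t" if "t < t0" for t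
    using not_less_Least[of t "\<lambda>t. t = s \<or> y t < x t"] that ne[of t] le unfolding t0_def[symmetric] by auto
  have lower: "y t < x t" if "t0 \<le> t" "t < s" for t
    using C(6)[OF that] C(7)[OF that] t0 that by (cases "t0 = s") auto
  show ?thesis
  proof (cases "s \<le> 2 * t0")
    case True
    then show ?thesis using fold_half_chain[OF E(1) c le upper] by blast
  next
    case False
    have "has_chain E i i (2 * (s - t0))"
      by (rule fold_half_chain[OF E(1) strict_chain_transpose[OF E(1) c]]) (use lower in auto)
    then show ?thesis using False le by (intro exI[of _ "s - t0"]) simp
  qed
qed

section \<open>The skew-symmetric matrix of a set of positions\<close>

definition chain_rank :: "(nat \<times> nat) set \<Rightarrow> nat \<Rightarrow> nat \<Rightarrow> nat" where
  "chain_rank E i j = (GREATEST s. has_chain E i j s)"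

lemma has_chain_iff: "has_chain E i j s \<longleftrightarrow> s \<le> chain_rank E i j"
proof
  show "has_chain E i j s \<Longrightarrow> s \<le> chain_rank E i j"
    unfolding chain_rank_def by (rule Greatest_le_nat[of _ _ i]) (auto intro: has_chain_length)
  have "has_chain E i j (chain_rank E i j)"
    unfolding chain_rank_def
    by (rule GreatestI_nat[of _ 0 i]) (auto intro: has_chain_length has_chain_0)
  then show "s \<le> chain_rank E i j \<Longrightarrow> has_chain E i j s"
    by (rule has_chain_mono) auto
qed

lemma chain_rank_0: "chain_rank E 0 j = 0"
  using has_chain_iff[of E 0 j "chain_rank E 0 j"] has_chain_length by force

lemma chain_rank_mono: "i \<le> i' \<Longrightarrow> j \<le> j' \<Longrightarrow> chain_rank E i j \<le> chain_rank E i' j'"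
  by (rule has_chain_iff[THEN iffD1], rule has_chain_mono[of E i j "chain_rank E i j"])
    (simp_all add: has_chain_iff)

lemma chain_rank_Suc_le: "chain_rank E (Suc i) j \<le> Suc (chain_rank E i j)"
proof (cases "chain_rank E (Suc i) j")
  case (Suc s)
  then have "has_chain E (Suc i) j (Suc s)" by (simp add: has_chain_iff)
  then have "has_chain E i j s" by (rule has_chain_drop_row)
  then show ?thesis using Suc by (simp add: has_chain_iff)
qed simp

lemma chain_rank_sym:
  assumes "sym E"
  shows "chain_rank E i j = chain_rank E j i"
proof -
  have "chain_rank E i j \<le> chain_rank E j i" for i j
  proof -
    have "has_chain E i j (chain_rank E i j)" by (simp add: has_chain_iff)
    then have "has_chain E j i (chain_rank E i j)" by (rule has_chain_transpose[OF assms])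
    then show ?thesis by (simp only: has_chain_iff)
  qed
  from this[of i j] this[of j i] show ?thesis by (rule antisym)
qed

text \<open>Row \<open>i\<close> contributes to the rank of the first \<open>j\<close> columns.\<close>

definition row_step :: "(nat \<times> nat) set \<Rightarrow> nat \<Rightarrow> nat \<Rightarrow> bool" where
  "row_step E i j \<longleftrightarrow> chain_rank E i j = Suc (chain_rank E (i - 1) j)"

lemma row_step_cases:
  assumes "1 \<le> i"
  shows "chain_rank E i j = chain_rank E (i - 1) j + of_bool (row_step E i j)"
  using chain_rank_Suc_le[of E "i - 1" j] chain_rank_mono[of "i - 1" i j j E] assms
  by (auto simp: row_step_def)

text \<open>If row \<open>i\<close> contributed in the first \<open>j\<close> columns only, then
  supermodularity would make the rank grow by two from column \<open>j\<close> to column \<open>j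
  + 1\<close>.\<close>

lemma row_step_mono_Suc:
  assumes E: "sym E" and "1 \<le> i" "row_step E i j"
  shows "row_step E i (Suc j)"
proof (rule ccontr)
  obtain i' where i: "i = Suc i'" using assms(2) by (cases i) auto
  define k where "k = chain_rank E i' j"
  assume "\<not> row_step E i (Suc j)"
  then have eq: "chain_rank E i (Suc j) = chain_rank E i' (Suc j)"
    using row_step_cases[OF assms(2), of E "Suc j"] i by simp
  have d: "chain_rank E i j = Suc k" using assms(3) by (simp add: row_step_def k_def i)
  have "has_chain E i' (Suc j) (Suc k)"
    unfolding has_chain_iff eq[symmetric] using d chain_rank_mono[of i i j "Suc j" E] by simp
  moreover have "has_chain E (Suc i') j (Suc k)" unfolding has_chain_iff using d i by simp
  moreover have "\<not> has_chain E i' j (Suc k)" unfolding has_chain_iff by (simp add: k_def)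
  ultimately have "has_chain E (Suc i') (Suc j) (Suc (Suc k))" by (rule has_chain_supermodular)
  then have "has_chain E i' (Suc j) (Suc (Suc k))" unfolding has_chain_iff using eq i by simp
  then have big: "Suc (Suc k) \<le> chain_rank E i' (Suc j)" unfolding has_chain_iff .
  moreover have "chain_rank E i' (Suc j) \<le> Suc k"
    using chain_rank_Suc_le[of E j i'] chain_rank_sym[OF E, of i'] by (simp add: k_def)
  ultimately show False by simp
qed

lemma row_step_mono:
  assumes "sym E" "1 \<le> i" "row_step E i j" "j \<le> j'"
  shows "row_step E i j'"
  using assms(4,3) by (induction j' rule: dec_induct) (auto intro: row_step_mono_Suc[OF assms(1,2)])

lemma not_row_step_0: "sym E \<Longrightarrow> \<not> row_step E i 0"
  by (simp add: row_step_def chain_rank_sym[of E i 0] chain_rank_0)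

text \<open>The positions of the nonzero entries of the partial permutation matrix whose corner ranks are
  \<open>chain_rank E\<close>.\<close>

definition rank_dot :: "(nat \<times> nat) set \<Rightarrow> nat \<Rightarrow> nat \<Rightarrow> bool" where
  "rank_dot E i j \<longleftrightarrow> row_step E i j \<and> \<not> row_step E i (j - 1)"

lemma rank_dot_unique:
  assumes "sym E" "1 \<le> i" "rank_dot E i j" "rank_dot E i j'"
  shows "j = j'"
proof (rule ccontr)
  have neq: False if "rank_dot E i j" "rank_dot E i j'" "j < j'" for j j'
    using row_step_mono[OF assms(1,2), of j "j' - 1"] that unfolding rank_dot_def by simp
  assume "j \<noteq> j'"
  then show False using neq[of j j'] neq[of j' j] assms(3,4) by (cases "j < j'") auto
qed

lemma row_step_dot:
  assumes "sym E" "row_step E i j"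
  shows "\<exists>j'\<in>{1..j}. rank_dot E i j'"
proof -
  define j0 where "j0 = (LEAST j. row_step E i j)"
  have j0: "row_step E i j0" unfolding j0_def using assms(2) by (rule LeastI)
  have "j0 \<noteq> 0" using j0 not_row_step_0[OF assms(1)] by metis
  moreover have "\<not> row_step E i (j0 - 1)"
    using not_less_Least[of "j0 - 1" "row_step E i"] \<open>j0 \<noteq> 0\<close> unfolding j0_def[symmetric] by simp
  moreover have "j0 \<le> j" unfolding j0_def using assms(2) by (rule Least_le)
  ultimately show ?thesis using j0 by (intro bexI[of _ j0]) (simp_all add: rank_dot_def)
qed

text \<open>The form of the condition as a mixed second difference is symmetric in rows and columns.\<close>

lemma rank_dot_iff:
  assumes "1 \<le> i"
  shows "rank_dot E i j \<longleftrightarrow> chain_rank E i j + chain_rank E (i - 1) (j - 1) =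
    Suc (chain_rank E (i - 1) j + chain_rank E i (j - 1))"
  using row_step_cases[OF assms, of E j] row_step_cases[OF assms, of E "j - 1"]
  by (auto simp: rank_dot_def of_bool_def split: if_splits)

lemma rank_dot_sym:
  assumes "sym E" "1 \<le> i" "1 \<le> j"
  shows "rank_dot E i j \<longleftrightarrow> rank_dot E j i"
  unfolding rank_dot_iff[OF assms(2)] rank_dot_iff[OF assms(3)]
  using chain_rank_sym[OF assms(1), of i j] chain_rank_sym[OF assms(1), of "i - 1" "j - 1"]
    chain_rank_sym[OF assms(1), of "i - 1" j] chain_rank_sym[OF assms(1), of i "j - 1"]
  by (simp add: add.commute)

lemma chain_rank_square_even:
  assumes "sym E" "irrefl E"
  shows "even (chain_rank E i i)"
proof -
  have "has_chain E i i (chain_rank E i i)" by (simp add: has_chain_iff)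
  then obtain t where "chain_rank E i i \<le> 2 * t" "has_chain E i i (2 * t)"
    using square_chain_even[OF assms] by blast
  then have "chain_rank E i i = 2 * t" by (simp add: has_chain_iff)
  then show ?thesis by simp
qed

text \<open>On the diagonal the mixed second difference is even, because corner ranks of square blocks are.\<close>

lemma no_diagonal_dot:
  assumes "sym E" "irrefl E" "1 \<le> i"
  shows "\<not> rank_dot E i i"
proof
  assume "rank_dot E i i"
  then have "chain_rank E i i + chain_rank E (i - 1) (i - 1) = Suc (2 * chain_rank E (i - 1) i)"
    unfolding rank_dot_iff[OF assms(3)] using chain_rank_sym[OF assms(1), of i "i - 1"] by simp
  moreover have "even (chain_rank E i i + chain_rank E (i - 1) (i - 1))"
    using chain_rank_square_even[OF assms(1,2)] by simp
  ultimately show False by simp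
qed

lemma chain_rank_count: "chain_rank E i j = card {y \<in> {1..i}. row_step E y j}"
proof (induction i)
  case (Suc i)
  have "{y \<in> {1..Suc i}. row_step E y j} =
      (if row_step E (Suc i) j then insert (Suc i) {y \<in> {1..i}. row_step E y j} else {y \<in> {1..i}. row_step E y j})"
    by (auto simp: le_Suc_eq)
  then show ?case using Suc row_step_cases[of "Suc i" E j] by simp
qed (simp add: chain_rank_0)

text \<open>The dots form a symmetric partial permutation without fixed points; signs make it
  skew-symmetric.\<close>

definition chain_matrix :: "nat \<Rightarrow> (nat \<times> nat) set \<Rightarrow> 'k::field mat" where
  "chain_matrix n E = mat n n (\<lambda>(y, z).
     if rank_dot E (Suc y) (Suc z) then (if z < y then 1 else - 1) else 0)"

lemma entry_chain_matrix:
  assumes "y \<in> {1..n}" "z \<in> {1..n}"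
  shows "entry (chain_matrix n E) y z = (if rank_dot E y z then (if z < y then 1 else - 1) else 0)"
proof -
  obtain y' z' where "y = Suc y'" "z = Suc z'" using assms by (cases y; cases z) auto
  then show ?thesis using assms by (auto simp: entry_def chain_matrix_def)
qed

lemma chain_matrix_skew:
  assumes E: "sym E" "irrefl E"
  shows "chain_matrix n E \<in> (skew_mats n :: 'k::field mat set)"
  unfolding skew_mats_def
proof (intro CollectI conjI allI impI)
  show "chain_matrix n E \<in> (carrier_mat n n :: 'k mat set)" by (simp add: chain_matrix_def)
  have nd: "\<not> rank_dot E (Suc i) (Suc i)" for i by (rule no_diagonal_dot[OF E]) simp
  show "transpose_mat (chain_matrix n E) = - (chain_matrix n E :: 'k mat)"
  proof (rule eq_matI)
    fix i j assume "i < dim_row (- (chain_matrix n E :: 'k mat))" "j < dim_col (- (chain_matrix n E :: 'k mat))"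
    then have ij: "i < n" "j < n" by (simp_all add: chain_matrix_def)
    have "rank_dot E (Suc j) (Suc i) \<longleftrightarrow> rank_dot E (Suc i) (Suc j)" by (rule rank_dot_sym[OF E(1)]) simp_all
    then show "transpose_mat (chain_matrix n E) $$ (i, j) = (- (chain_matrix n E :: 'k mat)) $$ (i, j)"
      using ij nd[of i] by (cases "i = j") (auto simp: chain_matrix_def)
  qed (simp_all add: chain_matrix_def)
  show "chain_matrix n E $$ (i, i) = (0 :: 'k)" if "i < n" for i
    using that nd[of i] by (simp add: chain_matrix_def)
qed

text \<open>Each row and each column holds at most one nonzero entry, so the rank of a corner is the number
  of its nonzero rows, and these are the rows that contribute to \<open>chain_rank\<close>.\<close>

lemma corner_rank_chain_matrix:
  assumes E: "sym E" "irrefl E" and ij: "i \<le> n" "j \<le> n"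
  shows "corner_rank (chain_matrix n E :: 'k::field mat) i j = chain_rank E i j"
proof -
  let ?v = "chain_matrix n E :: 'k mat"
  define R where "R = {y \<in> {1..i}. row_step E y j}"
  have R: "finite R" "card R = chain_rank E i j" by (simp_all add: R_def chain_rank_count)
  have "factors_through (entry ?v) {1..i} {1..j} (card R)"
  proof (rule factors_through_index_set[OF R(1) order_refl])
    fix y z assume yz: "y \<in> {1..i}" "z \<in> {1..j}"
    have "entry ?v y z = (if y \<in> R then entry ?v y z else 0)"
    proof (cases "rank_dot E y z")
      case True
      then have "row_step E y j"
        using row_step_mono[OF E(1), of y z j] yz unfolding rank_dot_def by auto
      then show ?thesis using yz by (simp add: R_def)
    next
      case False
      have "y \<in> {1..n}" "z \<in> {1..n}" using yz ij by auto
      then show ?thesis using False by (simp add: entry_chain_matrix)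
    qed
    also have "\<dots> = (\<Sum>l\<in>R. (if l = y then 1 else 0) * entry ?v l z)"
      using R(1) by (simp add: if_distrib if_distribR cong: if_cong)
    finally show "entry ?v y z = (\<Sum>l\<in>R. (if l = y then 1 else 0) * entry ?v l z)" .
  qed
  then have le: "corner_rank ?v i j \<le> chain_rank E i j" unfolding corner_rank_le_iff R(2) .
  have "\<not> corner_rank ?v i j < chain_rank E i j"
  proof
    assume "corner_rank ?v i j < chain_rank E i j"
    then have lt: "corner_rank ?v i j < card R" by (simp add: R(2))
    have "\<forall>y\<in>R. \<exists>z. z \<in> {1..j} \<and> rank_dot E y z" using row_step_dot[OF E(1)] unfolding R_def by blast
    then obtain \<phi> where \<phi>: "\<forall>y\<in>R. \<phi> y \<in> {1..j} \<and> rank_dot E y (\<phi> y)" by (rule bchoice[THEN exE])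
    have "factors_through (entry ?v) {1..i} {1..j} (corner_rank ?v i j)"
      using corner_rank_le_iff[of ?v i j] by blast
    moreover have "\<phi> ` R \<subseteq> {1..j}" using \<phi> by blast
    ultimately obtain v where
      v: "\<exists>f\<in>R. v f \<noteq> 0" "\<forall>y\<in>{1..i}. (\<Sum>f\<in>R. v f * entry ?v y (\<phi> f)) = 0"
      by (elim factors_through_dependency[OF _ R(1) lt, THEN exE] conjE)
    obtain y where y: "y \<in> R" "v y \<noteq> 0" using v(1) by blast
    have y1: "y \<in> {1..i}" "1 \<le> y" using y(1) by (auto simp: R_def)
    have "(\<Sum>f\<in>R. v f * entry ?v y (\<phi> f)) = (\<Sum>f\<in>R. if f = y then v y * entry ?v y (\<phi> y) else 0)"
    proof (intro sum.cong refl)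
      fix f assume f: "f \<in> R"
      show "v f * entry ?v y (\<phi> f) = (if f = y then v y * entry ?v y (\<phi> y) else 0)"
      proof (cases "f = y")
        case False
        have "\<not> rank_dot E y (\<phi> f)"
        proof
          assume "rank_dot E y (\<phi> f)"
          then have "rank_dot E (\<phi> f) y" using rank_dot_sym[OF E(1) y1(2)] \<phi> f by auto
          moreover have "rank_dot E (\<phi> f) f"
            using rank_dot_sym[OF E(1), of f "\<phi> f"] \<phi> f by (auto simp: R_def)
          ultimately show False using rank_dot_unique[OF E(1), of "\<phi> f" y f] \<phi> f False by auto
        qed
        moreover have "\<phi> f \<in> {1..n}" "y \<in> {1..n}" using \<phi> f y1 ij by auto
        ultimately show ?thesis using False by (simp add: entry_chain_matrix)
      qed simp
    qed
    also have "\<dots> = v y * entry ?v y (\<phi> y)" using R(1) y(1) by simp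
    finally have "v y * entry ?v y (\<phi> y) = 0" using v(2) y1(1) by simp
    moreover have "entry ?v y (\<phi> y) \<noteq> 0"
    proof -
      have "\<phi> y \<in> {1..n}" "y \<in> {1..n}" "rank_dot E y (\<phi> y)" using \<phi> y y1 ij by auto
      then show ?thesis by (simp add: entry_chain_matrix)
    qed
    ultimately show False using y(2) by simp
  qed
  then show ?thesis using le by simp
qed

section \<open>Minors detect the corner ranks\<close>

text \<open>Choosing \<open>r + 1\<close> independent columns, and then as many independent rows of these.\<close>

lemma nonvanishing_minor:
  fixes m :: "nat \<Rightarrow> nat \<Rightarrow> 'a::field"
  assumes "\<not> factors_through m Y Z r" "finite Y" "finite Z"
  shows "\<exists>ys zs. (\<forall>p<Suc r. ys p \<in> Y \<and> zs p \<in> Z) \<and>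
    det (mat (Suc r) (Suc r) (\<lambda>(p, q). m (ys q) (zs p))) \<noteq> 0"
proof -
  have select: "\<exists>T\<subseteq>Z. card T = Suc r \<and> indep_columns m Y T"
    if nf: "\<not> factors_through m Y Z r" and Z: "finite Z" for m :: "nat \<Rightarrow> nat \<Rightarrow> 'a" and Y Z
  proof -
    from column_basis[OF Z, of m Y] obtain S where
      S: "S \<subseteq> Z" "indep_columns m Y S" "factors_through m Y Z (card S)" by (elim exE conjE)
    have fin: "finite S" using S(1) Z by (rule finite_subset)
    have "\<not> card S \<le> r"
    proof
      assume "card S \<le> r"
      from factors_through_mono[OF S(3) this order_refl order_refl] nf show False by (rule notE[rotated])
    qed
    then have "Suc r \<le> card S" by simp
    then obtain T where T: "T \<subseteq> S" "card T = Suc r" by (rule obtain_subset_with_card_n)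
    have "indep_columns m Y T" by (rule indep_columns_subset[OF S(2) T(1) fin])
    then show ?thesis using T(2) order_trans[OF T(1) S(1)] by (intro exI[of _ T] conjI)
  qed
  obtain T where T: "T \<subseteq> Z" "card T = Suc r" "indep_columns m Y T"
    using select[OF assms(1,3)] by (elim exE conjE)
  have finT: "finite T" using T(1) assms(3) finite_subset by blast
  have "\<not> factors_through m Y T r"
  proof
    assume "factors_through m Y T r"
    from indep_columns_card[OF T(3) order_refl finT this] show False using T(2) by simp
  qed
  then have "\<not> factors_through (\<lambda>z y. m y z) T Y r"
    using factors_through_transpose[of "\<lambda>z y. m y z" T Y r] by (rule contrapos_nn)
  from select[OF this assms(2)]
  obtain T' where T': "T' \<subseteq> Y" "card T' = Suc r" "indep_columns (\<lambda>z y. m y z) T T'"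
    by (elim exE conjE)
  have finT': "finite T'" using T'(1) assms(2) finite_subset by blast
  obtain zs where zs: "bij_betw zs {..<Suc r} T"
    using ex_bij_betw_nat_finite[OF finT] T(2) by (auto simp: atLeast0LessThan)
  obtain ys where ys: "bij_betw ys {..<Suc r} T'"
    using ex_bij_betw_nat_finite[OF finT'] T'(2) by (auto simp: atLeast0LessThan)
  let ?A = "mat (Suc r) (Suc r) (\<lambda>(p, q). m (ys q) (zs p))"
  have "det ?A \<noteq> 0"
  proof
    assume "det ?A = 0"
    then obtain v where v: "v \<in> carrier_vec (Suc r)" "v \<noteq> 0\<^sub>v (Suc r)" "?A *\<^sub>v v = 0\<^sub>v (Suc r)"
      using det_0_iff_vec_prod_zero_field[of ?A "Suc r"] by auto
    define c where "c y = v $ (inv_into {..<Suc r} ys y)" for y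
    have c: "c (ys q) = v $ q" if "q < Suc r" for q
      using ys that by (simp add: c_def bij_betw_def inv_into_f_f)
    have "(\<Sum>y\<in>T'. c y * m y z) = 0" if z: "z \<in> T" for z
    proof -
      obtain p where p: "p < Suc r" "z = zs p" using zs z by (auto simp: bij_betw_def)
      have "(\<Sum>y\<in>T'. c y * m y z) = (\<Sum>q\<in>{..<Suc r}. c (ys q) * m (ys q) z)"
        by (rule sum.reindex_bij_betw[OF ys, symmetric])
      also have "\<dots> = (\<Sum>q\<in>{0..<Suc r}. m (ys q) (zs p) * v $ q)"
        using c p by (intro sum.cong) auto
      also have "\<dots> = (?A *\<^sub>v v) $ p"
        using p v(1) by (simp add: scalar_prod_def)
      also have "\<dots> = 0" using v(3) p by simp
      finally show ?thesis .
    qed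
    then have zero: "\<forall>y\<in>T'. c y = 0" using T'(3) unfolding indep_columns_def by blast
    have "v = 0\<^sub>v (Suc r)"
    proof (rule eq_vecI)
      fix q assume "q < dim_vec (0\<^sub>v (Suc r))"
      then have q: "q < Suc r" by simp
      then have "ys q \<in> T'" using ys by (auto simp: bij_betw_def)
      then show "v $ q = 0\<^sub>v (Suc r) $ q" using zero c[OF q] q by simp
    qed (use v(1) in simp)
    then show False using v(2) by simp
  qed
  moreover have "\<forall>p<Suc r. ys p \<in> Y \<and> zs p \<in> Z"
    using ys zs T(1) T'(1) by (auto simp: bij_betw_def)
  ultimately show ?thesis by (intro exI[of _ ys] exI[of _ zs]) simp
qed

lemma vanishing_minor:
  fixes m :: "nat \<Rightarrow> nat \<Rightarrow> 'a::field"
  assumes "factors_through m Y Z r" "\<And>p. p < Suc r \<Longrightarrow> ys p \<in> Y" "\<And>p. p < Suc r \<Longrightarrow> zs p \<in> Z"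
  shows "det (mat (Suc r) (Suc r) (\<lambda>(p, q). m (ys q) (zs p))) = 0" (is "det ?A = 0")
proof -
  have "ys ` {..<Suc r} \<subseteq> Y" using assms(2) by auto
  from factors_through_dependency[OF factors_through_transpose[OF assms(1)] _ _ this]
  obtain v where v: "\<exists>q\<in>{..<Suc r}. v q \<noteq> 0" "\<forall>z\<in>Z. (\<Sum>q\<in>{..<Suc r}. v q * m (ys q) z) = 0"
    by auto
  have "?A *\<^sub>v vec (Suc r) v = 0\<^sub>v (Suc r)"
  proof (rule eq_vecI)
    fix p assume "p < dim_vec (0\<^sub>v (Suc r) :: 'a vec)"
    then have p: "p < Suc r" by simp
    then have "(?A *\<^sub>v vec (Suc r) v) $ p = (\<Sum>q\<in>{0..<Suc r}. m (ys q) (zs p) * v q)"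
      by (simp add: scalar_prod_def)
    also have "\<dots> = (\<Sum>q\<in>{..<Suc r}. v q * m (ys q) (zs p))"
      by (intro sum.cong) (auto simp: mult.commute)
    finally show "(?A *\<^sub>v vec (Suc r) v) $ p = 0\<^sub>v (Suc r) $ p"
      using v(2) assms(3)[OF p] p by simp
  qed simp
  moreover have "vec (Suc r) v \<noteq> 0\<^sub>v (Suc r)"
  proof
    assume eq: "vec (Suc r) v = 0\<^sub>v (Suc r)"
    have "v q = 0" if "q < Suc r" for q
      using arg_cong[OF eq, of "\<lambda>u. u $ q"] that by simp
    then show False using v(1) by auto
  qed
  ultimately show ?thesis
    using det_0_iff_vec_prod_zero_field[of ?A "Suc r"] by (auto intro!: exI[of _ "vec (Suc r) v"])
qed

lemma det_carrier:
  fixes u :: "nat \<Rightarrow> nat \<Rightarrow> ('x, 'k::field) mpoly"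
  assumes "\<And>p q. p < N \<Longrightarrow> q < N \<Longrightarrow> u p q \<in> carrier (poly_ring X)"
  shows "det (mat N N (\<lambda>(p, q). u p q)) \<in> carrier (poly_ring X)"
proof -
  have "signof \<pi> * (\<Prod>i = 0..<N. mat N N (\<lambda>(p, q). u p q) $$ (i, \<pi> i)) \<in> carrier (poly_ring X)"
    if "\<pi> permutes {0..<N}" for \<pi>
  proof -
    have "u i (\<pi> i) \<in> carrier (poly_ring X)" if "i \<in> {0..<N}" for i
      using assms permutes_in_image[OF \<open>\<pi> permutes {0..<N}\<close>] that by auto
    moreover have "mat N N (\<lambda>(p, q). u p q) $$ (i, \<pi> i) = u i (\<pi> i)" if "i \<in> {0..<N}" for i
      using permutes_in_image[OF \<open>\<pi> permutes {0..<N}\<close>, of i] that by auto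
    ultimately have "(\<Prod>i = 0..<N. mat N N (\<lambda>(p, q). u p q) $$ (i, \<pi> i)) \<in> carrier (poly_ring X)"
      by (intro carrier_prod) simp
    moreover have "(signof \<pi> :: ('x, 'k) mpoly) \<in> carrier (poly_ring X)"
      by (simp add: sign_def carrier_1 carrier_uminus)
    ultimately show ?thesis by (intro carrier_mult)
  qed
  then show ?thesis unfolding det_def'[OF mat_carrier] by (intro carrier_sum) simp
qed

lemma poly_eval_det:
  "poly_eval v (det (mat N N (\<lambda>(p, q). u p q))) = det (mat N N (\<lambda>(p, q). poly_eval v (u p q)))"
proof -
  interpret comm_ring_hom "poly_eval v" by (rule poly_eval_comm_ring_hom)
  have "map_mat (poly_eval v) (mat N N (\<lambda>(p, q). u p q)) = mat N N (\<lambda>(p, q). poly_eval v (u p q))"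
    by (rule eq_matI) auto
  then show ?thesis by (metis hom_det)
qed

lemma skew_mats_entries: "M \<in> skew_mats n \<Longrightarrow> skew_entries n (entry M)"
proof -
  assume M: "M \<in> skew_mats n"
  interpret comm_ring_hom "poly_eval (ss_point M)" by (rule poly_eval_comm_ring_hom)
  have "entry M z y = - entry M y z" if "y \<in> {1..n}" "z \<in> {1..n}" for y z
    using arg_cong[OF u_entry_skew[of z y], of "poly_eval (ss_point M)"] that
    by (simp only: hom_uminus poly_eval_u_entry[OF M])
  moreover have "entry M y y = 0" if "y \<in> {1..n}" for y
    using M that by (auto simp: skew_mats_def entry_def)
  ultimately show ?thesis unfolding skew_entries_def by blast
qed

lemma MSV_ss_iff:
  "M \<in> MSV_ss n w \<longleftrightarrow> M \<in> skew_mats n \<and> rank_dominated n (entry M) (entry w)"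
proof -
  have "corner_rank M i j \<le> corner_rank w i j \<longleftrightarrow>
      (\<forall>r. factors_through (entry w) {1..i} {1..j} r \<longrightarrow> factors_through (entry M) {1..i} {1..j} r)" for i j
    unfolding corner_rank_le_iff[symmetric] by (meson order_refl order_trans)
  then show ?thesis unfolding MSV_ss_def rank_dominated_def by simp
qed

lemma MSV_ss_self: "w \<in> skew_mats n \<Longrightarrow> w \<in> MSV_ss n w"
  by (simp add: MSV_ss_def)

text \<open>A corner rank of \<open>w\<close> that exceeded the one of \<open>w'\<close> would be witnessed
  by a minor, and this minor is a polynomial that vanishes on the variety of \<open>w'\<close> but
  not at \<open>w\<close>.\<close>

lemma vanishing_ideal_rank_le:
  fixes w w' :: "'k::field mat"
  assumes w: "w \<in> skew_mats n" and w': "w' \<in> skew_mats n"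
    and sub: "vanishing_ideal n (MSV_ss n w') \<subseteq> vanishing_ideal n (MSV_ss n w)"
    and ij: "i \<in> {1..n}" "j \<in> {1..n}"
  shows "corner_rank w i j \<le> corner_rank w' i j"
proof (rule ccontr)
  define r where "r = corner_rank w' i j"
  assume "\<not> corner_rank w i j \<le> corner_rank w' i j"
  then have "\<not> factors_through (entry w) {1..i} {1..j} r" unfolding corner_rank_le_iff r_def .
  then obtain ys zs where yz: "\<forall>p<Suc r. ys p \<in> {1..i} \<and> zs p \<in> {1..j}"
    and nz: "det (mat (Suc r) (Suc r) (\<lambda>(p, q). entry w (ys q) (zs p))) \<noteq> 0"
    using nonvanishing_minor[of "entry w" "{1..i}" "{1..j}" r] by auto
  define P :: "(nat \<times> nat, 'k) mpoly" where
    "P = det (mat (Suc r) (Suc r) (\<lambda>(p, q). u_entry (ys q) (zs p)))"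
  have range: "ys p \<in> {1..n}" "zs p \<in> {1..n}" if "p < Suc r" for p
  proof -
    have "ys p \<in> {1..i}" "zs p \<in> {1..j}" using yz that by blast+
    then show "ys p \<in> {1..n}" "zs p \<in> {1..n}" using ij by auto
  qed
  have eval: "poly_eval (ss_point M) P = det (mat (Suc r) (Suc r) (\<lambda>(p, q). entry M (ys q) (zs p)))"
    if M: "M \<in> skew_mats n" for M
  proof -
    have "mat (Suc r) (Suc r) (\<lambda>(p, q). poly_eval (ss_point M) (u_entry (ys q) (zs p))) =
        mat (Suc r) (Suc r) (\<lambda>(p, q). entry M (ys q) (zs p))"
      by (rule eq_matI) (use range poly_eval_u_entry[OF M] in auto)
    then show ?thesis unfolding P_def poly_eval_det by simp
  qed
  have "P \<in> vanishing_ideal n (MSV_ss n w')"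
    unfolding vanishing_ideal_def
  proof (intro CollectI conjI ballI)
    show "P \<in> carrier (poly_ring (ss_vars n))"
      unfolding P_def using range by (intro det_carrier u_entry_carrier) auto
    fix M assume M: "M \<in> MSV_ss n w'"
    then have "corner_rank M i j \<le> r" using ij by (simp add: MSV_ss_def r_def)
    then have "factors_through (entry M) {1..i} {1..j} r" unfolding corner_rank_le_iff .
    then have "det (mat (Suc r) (Suc r) (\<lambda>(p, q). entry M (ys q) (zs p))) = 0"
      by (rule vanishing_minor) (use yz in blast)+
    then show "poly_eval (ss_point M) P = 0" using M eval by (simp add: MSV_ss_def)
  qed
  then have "poly_eval (ss_point w) P = 0"
    using sub MSV_ss_self[OF w] by (auto simp: vanishing_ideal_def)
  then show False using nz eval[OF w] by simp
qed

section \<open>Chains in the support of a monomial\<close>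

text \<open>The pairs of a chain folded below the diagonal, where the variables are.\<close>

definition arcs :: "(nat \<Rightarrow> nat) \<Rightarrow> (nat \<Rightarrow> nat) \<Rightarrow> nat \<Rightarrow> (nat \<times> nat) set" where
  "arcs x y s = (\<lambda>t. (max (x t) (y t), min (x t) (y t))) ` {..<s}"

definition sym_pairs :: "(nat \<times> nat) set \<Rightarrow> (nat \<times> nat) set" where
  "sym_pairs D = D \<union> D\<inverse>"

lemma sorted_list_of_increasing:
  fixes x :: "nat \<Rightarrow> nat"
  assumes "\<forall>u<s. \<forall>t<u. x t < x u"
  shows "sorted_list_of_set (x ` {..<s}) = map x [0..<s]"
proof -
  have "sorted_wrt (<) (map x [0..<s])"
    using assms by (simp add: sorted_wrt_iff_nth_less)
  moreover have "set (map x [0..<s]) = x ` {..<s}" by (simp add: atLeast0LessThan)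
  ultimately show ?thesis
    using strict_sorted_equal[of "sorted_list_of_set (x ` {..<s})" "map x [0..<s]"]
    by (simp add: strict_sorted_list_of_set)
qed

text \<open>Listing \<open>A\<close> increasingly and \<open>B\<close> decreasingly turns \<open>boxplus A
  B\<close> into the arcs of an antidiagonal chain.\<close>

lemma boxplus_of_chain:
  assumes "\<forall>u<s. \<forall>t<u. x t < x u \<and> y u < y t"
  shows "card (x ` {..<s}) = s" "card (y ` {..<s}) = s"
    "boxplus (x ` {..<s}) (y ` {..<s}) = arcs x y s"
proof -
  define y' where "y' t = y (s - 1 - t)" for t
  have y': "y' ` {..<s} = y ` {..<s}"
  proof (intro equalityI subsetI)
    fix z assume "z \<in> y ` {..<s}"
    then obtain t where "t < s" "z = y t" by blast
    then show "z \<in> y' ` {..<s}" by (intro image_eqI[of _ _ "s - 1 - t"]) (auto simp: y'_def)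
  qed (auto simp: y'_def)
  have incx: "\<forall>u<s. \<forall>t<u. x t < x u" using assms by blast
  have incy: "\<forall>u<s. \<forall>t<u. y' t < y' u" using assms by (auto simp: y'_def)
  note lx = sorted_list_of_increasing[OF incx] and ly = sorted_list_of_increasing[OF incy, unfolded y']
  show cx: "card (x ` {..<s}) = s"
    using arg_cong[OF lx, of length] by simp
  show cy: "card (y ` {..<s}) = s"
    using arg_cong[OF ly, of length] by simp
  have "odot (x ` {..<s}) (y ` {..<s}) = {(x t, y t) | t. t < s}"
  proof (intro equalityI subsetI)
    fix p assume "p \<in> odot (x ` {..<s}) (y ` {..<s})"
    then obtain i j where ij: "i + j + 1 = s" "p = (map x [0..<s] ! i, map y' [0..<s] ! j)"
      unfolding odot_def lx ly cx by blast
    then have "p = (x i, y i)" by (auto simp: y'_def)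
    then show "p \<in> {(x t, y t) | t. t < s}" using ij(1) by auto
  next
    fix p assume "p \<in> {(x t, y t) | t. t < s}"
    then obtain t where t: "t < s" "p = (x t, y t)" by blast
    then have "p = (map x [0..<s] ! t, map y' [0..<s] ! (s - 1 - t))" by (auto simp: y'_def)
    moreover have "t + (s - 1 - t) + 1 = s" using t(1) by simp
    ultimately show "p \<in> odot (x ` {..<s}) (y ` {..<s})" unfolding odot_def lx ly cx by blast
  qed
  moreover have "odot (y ` {..<s}) (x ` {..<s}) = {(y t, x t) | t. t < s}"
  proof (intro equalityI subsetI)
    fix p assume "p \<in> odot (y ` {..<s}) (x ` {..<s})"
    then obtain i j where ij: "i + j + 1 = s" "p = (map y' [0..<s] ! i, map x [0..<s] ! j)"
      unfolding odot_def lx ly cy by blast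
    then have "p = (y j, x j)" by (auto simp: y'_def)
    then show "p \<in> {(y t, x t) | t. t < s}" using ij(1) by auto
  next
    fix p assume "p \<in> {(y t, x t) | t. t < s}"
    then obtain t where t: "t < s" "p = (y t, x t)" by blast
    then have "p = (map y' [0..<s] ! (s - 1 - t), map x [0..<s] ! t)" by (auto simp: y'_def)
    moreover have "(s - 1 - t) + t + 1 = s" using t(1) by simp
    ultimately show "p \<in> odot (y ` {..<s}) (x ` {..<s})" unfolding odot_def lx ly cy by blast
  qed
  ultimately have bp: "boxplus (x ` {..<s}) (y ` {..<s}) =
      {(i, j) \<in> {(x t, y t) | t. t < s}. j \<le> i} \<union> {(i, j) \<in> {(y t, x t) | t. t < s}. j \<le> i}"
    unfolding boxplus_def by (simp only:)
  show "boxplus (x ` {..<s}) (y ` {..<s}) = arcs x y s"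
  proof (intro equalityI subsetI)
    fix p assume "p \<in> boxplus (x ` {..<s}) (y ` {..<s})"
    then obtain t where t: "t < s" "p = (x t, y t) \<and> y t \<le> x t \<or> p = (y t, x t) \<and> x t \<le> y t"
      unfolding bp by auto
    then have "p = (max (x t) (y t), min (x t) (y t))" by auto
    then show "p \<in> arcs x y s" using t(1) by (simp add: arcs_def)
  next
    fix p assume "p \<in> arcs x y s"
    then obtain t where t: "t < s" "p = (max (x t) (y t), min (x t) (y t))" by (auto simp: arcs_def)
    then have "p = (x t, y t) \<and> y t \<le> x t \<or> p = (y t, x t) \<and> x t \<le> y t" by auto
    then show "p \<in> boxplus (x ` {..<s}) (y ` {..<s})" using t(1) unfolding bp by auto
  qed
qed

lemma chain_of_sets:
  fixes A B :: "nat set"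
  assumes "finite A" "finite B" "card A = s" "card B = s"
  shows "\<exists>x y. A = x ` {..<s} \<and> B = y ` {..<s} \<and> (\<forall>u<s. \<forall>t<u. x t < x u \<and> y u < y t)"
proof -
  define x where "x t = sorted_list_of_set A ! t" for t
  define y where "y t = sorted_list_of_set B ! (s - 1 - t)" for t
  have inc: "sorted_list_of_set C ! t < sorted_list_of_set C ! u"
    if "t < u" "u < s" "finite C" "card C = s" for C :: "nat set" and t u
    using sorted_wrt_nth_less[OF strict_sorted_list_of_set[of C], of t u] that by simp
  have im: "C = (\<lambda>t. sorted_list_of_set C ! t) ` {..<s}" if "finite C" "card C = s" for C :: "nat set"
  proof -
    have "C = set (sorted_list_of_set C)" using that(1) by simp
    also have "\<dots> = (\<lambda>t. sorted_list_of_set C ! t) ` {..<s}"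
      using that(2) by (auto simp: set_conv_nth)
    finally show ?thesis .
  qed
  have "B = y ` {..<s}"
  proof (intro equalityI subsetI)
    fix z assume "z \<in> B"
    then obtain t where "t < s" "z = sorted_list_of_set B ! t" using im[OF assms(2,4)] by blast
    then show "z \<in> y ` {..<s}" by (intro image_eqI[of _ _ "s - 1 - t"]) (auto simp: y_def)
  next
    fix z assume "z \<in> y ` {..<s}"
    then obtain t where "t < s" "z = sorted_list_of_set B ! (s - 1 - t)" by (auto simp: y_def)
    then show "z \<in> B" using assms(2,4) nth_mem[of "s - 1 - t" "sorted_list_of_set B"] by simp
  qed
  moreover have "A = x ` {..<s}" using im[OF assms(1,3)] by (simp add: x_def[abs_def])
  moreover have "x t < x u \<and> y u < y t" if "u < s" "t < u" for t u
    using inc[OF that(2,1) assms(1,3)] inc[of "s - 1 - u" "s - 1 - t" B] that assms(2,4)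
    by (simp add: x_def y_def)
  ultimately show ?thesis by blast
qed

definition arc_sets :: "nat \<Rightarrow> 'k::field mat \<Rightarrow> (nat \<times> nat) set set" where
  "arc_sets n w = {arcs x y s | x y s. \<exists>i\<in>{1..n}. \<exists>j\<in>{1..i}. s = Suc (corner_rank w i j) \<and>
     (\<forall>t<s. x t \<in> {1..i} \<and> y t \<in> {1..j} \<and> x t \<noteq> y t) \<and> (\<forall>u<s. \<forall>t<u. x t < x u \<and> y u < y t)}"

lemma arc_setsE:
  assumes "S \<in> arc_sets n w"
  obtains x y s i j where "S = arcs x y s" "i \<in> {1..n}" "j \<in> {1..i}" "s = Suc (corner_rank w i j)"
    "\<forall>t<s. x t \<in> {1..i} \<and> y t \<in> {1..j} \<and> x t \<noteq> y t" "\<forall>u<s. \<forall>t<u. x t < x u \<and> y u < y t"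
  using assms unfolding arc_sets_def mem_Collect_eq by (elim exE bexE conjE)

lemma arc_setsI:
  assumes "i \<in> {1..n}" "j \<in> {1..i}" "s = Suc (corner_rank w i j)"
    "\<forall>t<s. x t \<in> {1..i} \<and> y t \<in> {1..j} \<and> x t \<noteq> y t" "\<forall>u<s. \<forall>t<u. x t < x u \<and> y u < y t"
  shows "arcs x y s \<in> arc_sets n w"
proof -
  have "\<exists>i\<in>{1..n}. \<exists>j\<in>{1..i}. s = Suc (corner_rank w i j) \<and>
     (\<forall>t<s. x t \<in> {1..i} \<and> y t \<in> {1..j} \<and> x t \<noteq> y t) \<and> (\<forall>u<s. \<forall>t<u. x t < x u \<and> y u < y t)"
    by (rule bexI[OF _ assms(1)], rule bexI[OF _ assms(2)], intro conjI assms(3-5))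
  then show ?thesis unfolding arc_sets_def mem_Collect_eq
    by (rule_tac exI[of _ x], rule_tac exI[of _ y], rule_tac exI[of _ s]) (rule conjI[OF refl])
qed

lemma finite_arcs: "finite (arcs x y s)"
  by (simp add: arcs_def)

lemma arc_sets_finite: "S \<in> arc_sets n w \<Longrightarrow> finite S"
  by (auto simp: arc_sets_def finite_arcs)

lemma arc_sets_vars: "S \<in> arc_sets n w \<Longrightarrow> S \<subseteq> ss_vars n"
  by (fastforce simp: arc_sets_def arcs_def ss_vars_def max_def min_def)

lemma u_ss_of_chain:
  assumes "\<forall>u<s. \<forall>t<u. x t < x u \<and> y u < y t"
  shows "u_ss (x ` {..<s}) (y ` {..<s}) =
    (if \<forall>t<s. x t \<noteq> y t then mon_poly (squarefree_mon (arcs x y s)) else 0)"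
proof -
  have "(\<forall>(p, q)\<in>arcs x y s. p \<noteq> q) \<longleftrightarrow> (\<forall>t<s. x t \<noteq> y t)"
  proof -
    have "max (x t) (y t) \<noteq> min (x t) (y t) \<longleftrightarrow> x t \<noteq> y t" for t by (auto simp: max_def min_def)
    then show ?thesis
      by (simp only: arcs_def ball_simps(9) prod.case lessThan_iff Ball_def[of "{..<s}"])
  qed
  then show ?thesis
    unfolding u_ss_def boxplus_of_chain(3)[OF assms] by (simp only: prod_var_poly[OF finite_arcs])
qed

lemma J_ss_eq: "J_ss n w = Idl\<^bsub>poly_ring (ss_vars n)\<^esub> (mon_poly ` squarefree_mon ` arc_sets n (w :: 'k::field mat))"
proof -
  let ?R = "poly_ring (ss_vars n) :: (nat \<times> nat, 'k) mpoly ring"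
  interpret R: cring ?R by (rule cring_poly_ring)
  let ?N = "mon_poly ` squarefree_mon ` arc_sets n w :: (nat \<times> nat, 'k) mpoly set"
  let ?G = "{u_ss A B | A B i j. i \<in> {1..n} \<and> j \<in> {1..n} \<and> i \<ge> j \<and> A \<subseteq> {1..i} \<and> B \<subseteq> {1..j} \<and>
        card A = 1 + corner_rank w i j \<and> card B = 1 + corner_rank w i j} :: (nat \<times> nat, 'k) mpoly set"
  have Nc: "?N \<subseteq> carrier ?R"
    using arc_sets_vars arc_sets_finite
    by (fastforce simp: mon_poly_def mons_def keys_squarefree_mon intro!: single_in_carrier)
  have G0: "?G \<subseteq> insert 0 ?N"
  proof
    fix g assume "g \<in> ?G"
    then obtain A B i j where AB: "g = u_ss A B" "i \<in> {1..n}" "j \<in> {1..n}" "j \<le> i" "A \<subseteq> {1..i}" "B \<subseteq> {1..j}"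
      "card A = Suc (corner_rank w i j)" "card B = Suc (corner_rank w i j)" by auto
    define s where "s = Suc (corner_rank w i j)"
    have "finite A" "finite B" using AB(5,6) finite_subset by auto
    then obtain x y where xy: "A = x ` {..<s}" "B = y ` {..<s}" "\<forall>u<s. \<forall>t<u. x t < x u \<and> y u < y t"
      using chain_of_sets[of A B s] AB(7,8) by (auto simp: s_def)
    show "g \<in> insert 0 ?N"
    proof (cases "\<forall>t<s. x t \<noteq> y t")
      case True
      have "x t \<in> {1..i} \<and> y t \<in> {1..j} \<and> x t \<noteq> y t" if "t < s" for t
        using AB(5,6) xy(1,2) True that by blast
      then have "arcs x y s \<in> arc_sets n w"
        using AB(2-4) xy(3) by (intro arc_setsI[of i n j]) (auto simp: s_def)
      moreover have "g = mon_poly (squarefree_mon (arcs x y s))"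
        unfolding AB(1) xy(1,2) u_ss_of_chain[OF xy(3)] using True by (rule if_P)
      ultimately show ?thesis by blast
    next
      case False
      then have "g = 0" unfolding AB(1) xy(1,2) u_ss_of_chain[OF xy(3)] by (rule if_not_P)
      then show ?thesis by blast
    qed
  qed
  have N0: "?N \<subseteq> ?G"
  proof
    fix g assume "g \<in> ?N"
    then obtain S where S: "S \<in> arc_sets n w" "g = mon_poly (squarefree_mon S)" by blast
    from arc_setsE[OF S(1)] obtain x y s i j where g': "S = arcs x y s" "i \<in> {1..n}" "j \<in> {1..i}"
      "s = Suc (corner_rank w i j)" "\<forall>t<s. x t \<in> {1..i} \<and> y t \<in> {1..j} \<and> x t \<noteq> y t"
      "\<forall>u<s. \<forall>t<u. x t < x u \<and> y u < y t" .
    have g1: "g = mon_poly (squarefree_mon (arcs x y s))" using S(2) g'(1) by simp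
    note g = g1 g'(2-6)
    have "\<forall>t<s. x t \<noteq> y t" using g(5) by blast
    then have "g = u_ss (x ` {..<s}) (y ` {..<s})"
      unfolding g(1) u_ss_of_chain[OF g(6)] by (rule if_P[symmetric])
    moreover have "x ` {..<s} \<subseteq> {1..i}" "y ` {..<s} \<subseteq> {1..j}"
      using g(5) by (simp_all only: image_subset_iff lessThan_iff) blast+
    moreover have "card (x ` {..<s}) = 1 + corner_rank w i j" "card (y ` {..<s}) = 1 + corner_rank w i j"
      unfolding boxplus_of_chain(1,2)[OF g(6)] unfolding g(4) by (rule Suc_eq_plus1_left)+
    moreover have "j \<in> {1..n}" "j \<le> i" using g(2,3) by auto
    ultimately have "g = u_ss (x ` {..<s}) (y ` {..<s}) \<and> i \<in> {1..n} \<and> j \<in> {1..n} \<and> j \<le> i \<and>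
        x ` {..<s} \<subseteq> {1..i} \<and> y ` {..<s} \<subseteq> {1..j} \<and>
        card (x ` {..<s}) = 1 + corner_rank w i j \<and> card (y ` {..<s}) = 1 + corner_rank w i j"
      using g(2) by (intro conjI)
    then show "g \<in> ?G" unfolding mem_Collect_eq by (intro exI)
  qed
  have "insert 0 ?N \<subseteq> carrier ?R" using Nc carrier_0 by (rule insert_subsetI[rotated])
  with G0 have Gc: "?G \<subseteq> carrier ?R" by (rule subset_trans)
  have idN: "ideal (Idl\<^bsub>?R\<^esub> ?N) ?R" by (rule R.genideal_ideal[OF Nc])
  have idG: "ideal (Idl\<^bsub>?R\<^esub> ?G) ?R" by (rule R.genideal_ideal[OF Gc])
  have "Idl\<^bsub>?R\<^esub> ?G \<subseteq> Idl\<^bsub>?R\<^esub> ?N"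
  proof (rule R.genideal_minimal[OF idN])
    have "insert 0 ?N \<subseteq> Idl\<^bsub>?R\<^esub> ?N" using R.genideal_self[OF Nc] ideal_0[OF idN] by (rule insert_subsetI[rotated])
    with G0 show "?G \<subseteq> Idl\<^bsub>?R\<^esub> ?N" by (rule subset_trans)
  qed
  moreover have "Idl\<^bsub>?R\<^esub> ?N \<subseteq> Idl\<^bsub>?R\<^esub> ?G"
    by (rule R.genideal_minimal[OF idG]) (rule subset_trans[OF N0 R.genideal_self[OF Gc]])
  ultimately show ?thesis unfolding J_ss_def by (rule equalityI)
qed

text \<open>The squarefree monomial on \<open>D\<close> is a multiple of a generator of \<open>J_ss n
  w\<close> exactly in this case.\<close>

definition excess_chain :: "nat \<Rightarrow> 'k::field mat \<Rightarrow> (nat \<times> nat) set \<Rightarrow> bool" where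
  "excess_chain n w D \<longleftrightarrow>
     (\<exists>i\<in>{1..n}. \<exists>j\<in>{1..i}. has_chain (sym_pairs D) i j (Suc (corner_rank w i j)))"

lemma sym_sym_pairs: "sym (sym_pairs D)"
  by (auto simp: sym_pairs_def sym_def)

lemma irrefl_sym_pairs: "D \<subseteq> ss_vars n \<Longrightarrow> irrefl (sym_pairs D)"
  by (auto simp: sym_pairs_def irrefl_def ss_vars_def)

lemma arc_in_iff:
  assumes "D \<subseteq> ss_vars n" "a \<noteq> b"
  shows "(max a b, min a b) \<in> D \<longleftrightarrow> (a, b) \<in> sym_pairs D"
  using assms by (auto simp: sym_pairs_def ss_vars_def max_def min_def)

lemma excess_chain_iff:
  assumes D: "D \<subseteq> ss_vars n"
  shows "(\<exists>S\<in>arc_sets n w. S \<subseteq> D) \<longleftrightarrow> excess_chain n w D"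
proof
  assume "\<exists>S\<in>arc_sets n w. S \<subseteq> D"
  then obtain S where S: "S \<in> arc_sets n w" "S \<subseteq> D" by blast
  from arc_setsE[OF S(1)] obtain x y s i j where g': "S = arcs x y s" "i \<in> {1..n}" "j \<in> {1..i}"
    "s = Suc (corner_rank w i j)" "\<forall>t<s. x t \<in> {1..i} \<and> y t \<in> {1..j} \<and> x t \<noteq> y t"
    "\<forall>u<s. \<forall>t<u. x t < x u \<and> y u < y t" .
  have g1: "arcs x y s \<subseteq> D" using S(2) g'(1) by simp
  note g = g1 g'(2-6)
  have "(x t, y t) \<in> sym_pairs D" if "t < s" for t
  proof -
    have "(max (x t) (y t), min (x t) (y t)) \<in> D" using g(1) that by (auto simp: arcs_def)
    then show ?thesis using arc_in_iff[OF D] g(5) that by blast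
  qed
  then have "strict_chain (sym_pairs D) i j s x y" using g(5,6) unfolding strict_chain_def by blast
  then show "excess_chain n w D" unfolding excess_chain_def using g(2,3,4) has_chainI by blast
next
  assume "excess_chain n w D"
  then obtain i j x y where g: "i \<in> {1..n}" "j \<in> {1..i}"
    and c: "strict_chain (sym_pairs D) i j (Suc (corner_rank w i j)) x y"
    unfolding excess_chain_def has_chain_def by blast
  define s where "s = Suc (corner_rank w i j)"
  have ne: "x t \<noteq> y t" if "t < s" for t
    using strict_chainD(1)[OF c, of t] irrefl_sym_pairs[OF D] that by (auto simp: irrefl_def s_def)
  have "arcs x y s \<in> arc_sets n w"
  proof (rule arc_setsI[OF g s_def])
    show "\<forall>t<s. x t \<in> {1..i} \<and> y t \<in> {1..j} \<and> x t \<noteq> y t"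
      using strict_chainD(2,3)[OF c] ne unfolding s_def by blast
    show "\<forall>u<s. \<forall>t<u. x t < x u \<and> y u < y t" using c unfolding strict_chain_def s_def by blast
  qed
  moreover have "arcs x y s \<subseteq> D"
  proof
    fix p assume "p \<in> arcs x y s"
    then obtain t where t: "t < s" "p = (max (x t) (y t), min (x t) (y t))" by (auto simp: arcs_def)
    then show "p \<in> D" using arc_in_iff[OF D ne[OF t(1)]] strict_chainD(1)[OF c, of t] by (simp add: s_def)
  qed
  ultimately show "\<exists>S\<in>arc_sets n w. S \<subseteq> D" by blast
qed

lemma squarefree_arc_sets_mons: "squarefree_mon ` arc_sets n w \<subseteq> mons (ss_vars n)"
  using arc_sets_vars arc_sets_finite by (fastforce simp: mons_def keys_squarefree_mon)

text \<open>This description of the ideal by supports carries all later arguments on the monomial side.\<close>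

lemma J_ss_iff:
  "p \<in> J_ss n w \<longleftrightarrow> p \<in> carrier (poly_ring (ss_vars n)) \<and>
     (\<forall>m\<in>Poly_Mapping.keys p. excess_chain n w (Poly_Mapping.keys m))"
proof -
  have sub: "monomial_multiples (ss_vars n) (squarefree_mon ` arc_sets n w) \<subseteq> mons (ss_vars n)"
    using squarefree_arc_sets_mons add_in_mons unfolding monomial_multiples_def by blast
  have "m \<in> monomial_multiples (ss_vars n) (squarefree_mon ` arc_sets n w) \<longleftrightarrow>
      excess_chain n w (Poly_Mapping.keys m)" if "m \<in> mons (ss_vars n)" for m
    using monomial_multiples_squarefree[of "arc_sets n w" m "ss_vars n"] arc_sets_finite that
      excess_chain_iff[of "Poly_Mapping.keys m" n w] by (auto simp: mons_def)
  then show ?thesis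
    unfolding J_ss_eq genideal_monomials[OF squarefree_arc_sets_mons] carrier_poly_ring
    using sub by blast
qed

section \<open>The initial and the vanishing ideal of one matrix\<close>

text \<open>A monomial of \<open>J_ss n w\<close> contains a chain that is too long for \<open>w\<close>.
  The polynomial that \<open>chain_lead\<close> attaches to this chain vanishes on the variety,
  and multiplying it by the complementary monomial gives the required initial monomial.\<close>

lemma J_ss_subset_init:
  fixes w :: "'k::field mat"
  shows "J_ss n w \<subseteq> init_ideal revlex (vanishing_ideal n (MSV_ss n w))"
proof
  fix p :: "(nat \<times> nat, 'k) mpoly" assume p: "p \<in> J_ss n w"
  interpret vector_space "\<lambda>(c::'k) (p::(nat \<times> nat, 'k) mpoly). const_poly c * p"
    by (rule vector_space_mpoly)
  let ?I = "vanishing_ideal n (MSV_ss n w) :: (nat \<times> nat, 'k) mpoly set"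
  have mon: "mon_poly m \<in> init revlex ` ?I" if m: "m \<in> Poly_Mapping.keys p" for m
  proof -
    have mons: "m \<in> mons (ss_vars n)" using p m unfolding J_ss_iff carrier_poly_ring by blast
    then have D: "Poly_Mapping.keys m \<subseteq> ss_vars n" by (simp add: mons_def)
    have "excess_chain n w (Poly_Mapping.keys m)" using p m unfolding J_ss_iff by blast
    then obtain S where S: "S \<in> arc_sets n w" "S \<subseteq> Poly_Mapping.keys m"
      using excess_chain_iff[OF D] by blast
    from arc_setsE[OF S(1)] obtain x y s i j where c: "S = arcs x y s" "i \<in> {1..n}" "j \<in> {1..i}"
      "s = Suc (corner_rank w i j)" "\<forall>t<s. x t \<in> {1..i} \<and> y t \<in> {1..j} \<and> x t \<noteq> y t"
      "\<forall>u<s. \<forall>t<u. x t < x u \<and> y u < y t" .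
    have "\<exists>P \<in> carrier (poly_ring (ss_vars n)). \<exists>E \<subseteq> {(max (x m) (y m), min (x m) (y m)) | m. m < s}.
        is_lead P (squarefree_mon E) \<and>
        (\<forall>M :: 'k mat. M \<in> skew_mats n \<longrightarrow> corner_rank M i j < s \<longrightarrow> poly_eval (ss_point M) P = 0)"
    proof (rule chain_lead)
      show "j \<le> i" "i \<le> n" using c(2,3) by auto
    qed (use c(5,6) in blast)+
    then obtain P E where P: "P \<in> carrier (poly_ring (ss_vars n))"
      and E: "E \<subseteq> {(max (x m) (y m), min (x m) (y m)) | m. m < s}"
      and lead: "is_lead P (squarefree_mon E)"
      and van: "\<forall>M :: 'k mat. M \<in> skew_mats n \<longrightarrow> corner_rank M i j < s \<longrightarrow> poly_eval (ss_point M) P = 0"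
      by (elim bexE exE conjE)
    have "E \<subseteq> S" using E unfolding c(1) arcs_def by auto
    then have Em: "E \<subseteq> Poly_Mapping.keys m" using S(2) by (rule subset_trans)
    then have "finite E" by (rule finite_subset) simp
    then have "m \<in> monomial_multiples (ss_vars n) (squarefree_mon ` {E}) \<inter> mons (ss_vars n)"
      using monomial_multiples_squarefree[of "{E}" m "ss_vars n"] mons Em by simp
    then obtain h where h: "m = squarefree_mon E + h" "h \<in> mons (ss_vars n)"
      unfolding monomial_multiples_def by blast
    let ?f = "Poly_Mapping.single h 1 * P"
    have "poly_eval (ss_point M) ?f = 0" if M: "M \<in> MSV_ss n w" for M
    proof -
      have "M \<in> skew_mats n" "corner_rank M i j < s"
        using M c(2,3,4) by (auto simp: MSV_ss_def less_Suc_eq_le)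
      then show ?thesis using van by (simp add: poly_eval_mult)
    qed
    then have "?f \<in> ?I"
      unfolding vanishing_ideal_def using carrier_mult[OF single_in_carrier[OF h(2)] P] by blast
    moreover have "init revlex ?f = mon_poly m"
      using init_eq_lead[OF is_lead_shift[OF lead, of h]] h(1) by (simp add: add.commute)
    ultimately show ?thesis by (metis image_eqI)
  qed
  have "const_poly (Poly_Mapping.lookup p m) * mon_poly m \<in> span (init revlex ` ?I)"
    if "m \<in> Poly_Mapping.keys p" for m
    by (rule span_scale) (rule span_base[OF mon[OF that]])
  then have "(\<Sum>m\<in>Poly_Mapping.keys p. const_poly (Poly_Mapping.lookup p m) * mon_poly m) \<in> span (init revlex ` ?I)"
    by (rule span_sum)
  moreover have "const_poly c * mon_poly m = Poly_Mapping.single m c" for c :: 'k and m :: "(nat \<times> nat) mon"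
    by (simp add: const_poly_def mon_poly_def mult_single)
  ultimately show "p \<in> init_ideal revlex ?I"
    unfolding init_ideal_def using sum_of_terms[of p] by simp
qed

lemma poly_eval_1: "poly_eval v 1 = 1"
  using poly_eval_const[of v 1] by (simp add: const_poly_def)

lemma vanishing_ideal_ideal: "ideal (vanishing_ideal n V) (poly_ring (ss_vars n))"
  by (rule poly_idealI)
    (auto simp: vanishing_ideal_def poly_eval_0 poly_eval_add poly_eval_mult
      intro: carrier_0 carrier_add carrier_mult)

lemma vanishing_ideal_antimono: "V \<subseteq> V' \<Longrightarrow> vanishing_ideal n V' \<subseteq> vanishing_ideal n V"
  by (auto simp: vanishing_ideal_def)

lemma vanishing_ideal_proper:
  assumes "w \<in> skew_mats n"
  shows "proper_ideal (ss_vars n) (vanishing_ideal n (MSV_ss n w))"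
proof -
  note poly_eval_1[of "ss_point w"]
  moreover have "poly_eval (ss_point w) f = 0" if "f \<in> vanishing_ideal n (MSV_ss n w)" for f
    using that MSV_ss_self[OF assms] unfolding vanishing_ideal_def by blast
  ultimately have "1 \<notin> vanishing_ideal n (MSV_ss n w)" by (metis zero_neq_one)
  then show ?thesis
    using vanishing_ideal_ideal carrier_1 unfolding proper_ideal_def by metis
qed

lemma J_ss_monomial: "monomial_ideal (ss_vars n) (J_ss n w)"
  unfolding monomial_ideal_def J_ss_eq using squarefree_arc_sets_mons by blast

lemma J_ss_ideal: "ideal (J_ss n (w :: 'k::field mat)) (poly_ring (ss_vars n))"
proof -
  interpret R: cring "poly_ring (ss_vars n) :: (nat \<times> nat, 'k) mpoly ring" by (rule cring_poly_ring)
  have "mon_poly ` squarefree_mon ` arc_sets n w \<subseteq> carrier (poly_ring (ss_vars n) :: (nat \<times> nat, 'k) mpoly ring)"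
    using squarefree_arc_sets_mons by (auto simp: mon_poly_def intro!: single_in_carrier)
  then show ?thesis unfolding J_ss_eq by (rule R.genideal_ideal)
qed

lemma excess_chain_mono:
  assumes "excess_chain n w D" "D \<subseteq> D'"
    and "\<And>i j. i \<in> {1..n} \<Longrightarrow> j \<in> {1..n} \<Longrightarrow> corner_rank v i j \<le> corner_rank w i j"
  shows "excess_chain n v D'"
proof -
  obtain i j where ij: "i \<in> {1..n}" "j \<in> {1..i}"
    and c: "has_chain (sym_pairs D) i j (Suc (corner_rank w i j))"
    using assms(1) unfolding excess_chain_def by blast
  have "j \<in> {1..n}" using ij by simp
  then have "has_chain (sym_pairs D') i j (Suc (corner_rank v i j))"
    using assms(2) assms(3)[OF ij(1)] by (intro has_chain_mono[OF c]) (auto simp: sym_pairs_def)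
  then show ?thesis unfolding excess_chain_def using ij by blast
qed

lemma not_excess_chain_empty: "\<not> excess_chain n w {}"
  by (auto simp: excess_chain_def has_chain_def strict_chain_def sym_pairs_def)

lemma J_ss_proper: "proper_ideal (ss_vars n) (J_ss n w)"
proof -
  have "1 \<notin> J_ss n w" unfolding J_ss_iff by (simp add: not_excess_chain_empty)
  then show ?thesis using J_ss_ideal carrier_1 unfolding proper_ideal_def by metis
qed

lemma excess_chain_singleton:
  assumes "(p, q) \<in> ss_vars n" "corner_rank w p q = 0"
  shows "excess_chain n w {(p, q)}"
proof -
  have "strict_chain (sym_pairs {(p, q)}) p q 1 (\<lambda>_. p) (\<lambda>_. q)"
    using assms by (auto simp: strict_chain_def sym_pairs_def ss_vars_def)
  then have "has_chain (sym_pairs {(p, q)}) p q (Suc (corner_rank w p q))"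
    using assms(2) has_chainI by fastforce
  moreover have "p \<in> {1..n}" "q \<in> {1..p}" using assms(1) by (auto simp: ss_vars_def)
  ultimately show ?thesis unfolding excess_chain_def by blast
qed

lemma corner_rank_0_iff:
  "corner_rank M i j = 0 \<longleftrightarrow> (\<forall>y\<in>{1..i}. \<forall>z\<in>{1..j}. entry M y z = 0)"
  using corner_rank_le_iff[of M i j 0] by (simp add: factors_through_0_iff)

lemma J_ss_zero_matrix:
  assumes zero: "\<And>y z. y \<in> {1..n} \<Longrightarrow> z \<in> {1..n} \<Longrightarrow> entry w y z = 0"
    and p: "p \<in> carrier (poly_ring (ss_vars n))" "Poly_Mapping.lookup p 0 = 0"
  shows "p \<in> J_ss n w"
  unfolding J_ss_iff
proof (intro conjI ballI p)
  fix m assume m: "m \<in> Poly_Mapping.keys p"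
  then have "m \<noteq> 0" using p(2) by (auto simp: in_keys_iff)
  then obtain a b where ab: "(a, b) \<in> Poly_Mapping.keys m" by (metis equals0I keys_eq_empty surj_pair)
  then have v: "(a, b) \<in> ss_vars n" using m p(1) by (auto simp: carrier_poly_ring mons_def)
  then have "corner_rank w a b = 0" unfolding corner_rank_0_iff using zero by (auto simp: ss_vars_def)
  from excess_chain_singleton[OF v this] show "excess_chain n w (Poly_Mapping.keys m)"
    by (rule excess_chain_mono) (use ab in auto)
qed

lemma skew_mats_zero: "0\<^sub>m n n \<in> skew_mats n"
  by (auto simp: skew_mats_def)

lemma entry_zero_mat: "y \<in> {1..n} \<Longrightarrow> z \<in> {1..n} \<Longrightarrow> entry (0\<^sub>m n n) y z = 0"
  by (auto simp: entry_def)

lemma zero_in_MSV_ss: "0\<^sub>m n n \<in> MSV_ss n (w :: 'k::field mat)"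
proof -
  have "corner_rank (0\<^sub>m n n :: 'k mat) i j = 0" if "i \<in> {1..n}" "j \<in> {1..n}" for i j
    unfolding corner_rank_0_iff by (intro ballI entry_zero_mat) (use that in auto)
  then show ?thesis by (simp add: MSV_ss_def skew_mats_zero)
qed

lemma poly_eval_zero_mat:
  assumes "p \<in> carrier (poly_ring (ss_vars n))"
  shows "poly_eval (ss_point (0\<^sub>m n n)) p = Poly_Mapping.lookup p 0"
proof -
  have "poly_eval (ss_point (0\<^sub>m n n)) p = poly_eval (\<lambda>x. 0) p"
  proof (rule poly_eval_cong[OF assms])
    fix x assume x: "x \<in> ss_vars n"
    obtain a b where ab: "x = (a, b)" by (cases x)
    then have "a - 1 < n" "b - 1 < n" using x by (auto simp: ss_vars_def)
    with ab show "ss_point (0\<^sub>m n n) x = 0" by (simp add: ss_point_def del: One_nat_def)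
  qed
  then show ?thesis by (simp add: poly_eval_zero_point)
qed

text \<open>Both ideals consist of the polynomials without constant term.\<close>

lemma zero_matrix_ideals_equal:
  fixes w :: "'k::field mat"
  assumes "w \<in> skew_mats n" and zero: "\<And>y z. y \<in> {1..n} \<Longrightarrow> z \<in> {1..n} \<Longrightarrow> entry w y z = 0"
  shows "vanishing_ideal n (MSV_ss n w) = J_ss n w"
proof (intro equalityI subsetI)
  fix p :: "(nat \<times> nat, 'k) mpoly" assume "p \<in> vanishing_ideal n (MSV_ss n w)"
  then have p: "p \<in> carrier (poly_ring (ss_vars n))" "poly_eval (ss_point (0\<^sub>m n n)) p = 0"
    using zero_in_MSV_ss unfolding vanishing_ideal_def by blast+
  then show "p \<in> J_ss n w" using poly_eval_zero_mat[OF p(1)] zero by (intro J_ss_zero_matrix) auto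
next
  fix p :: "(nat \<times> nat, 'k) mpoly" assume p: "p \<in> J_ss n w"
  then have car: "p \<in> carrier (poly_ring (ss_vars n))" unfolding J_ss_iff by blast
  have "0 \<notin> Poly_Mapping.keys p" using p not_excess_chain_empty unfolding J_ss_iff by fastforce
  then have p0: "Poly_Mapping.lookup p 0 = 0" by (simp add: in_keys_iff)
  show "p \<in> vanishing_ideal n (MSV_ss n w)" unfolding vanishing_ideal_def
  proof (intro CollectI conjI ballI car)
    fix M assume "M \<in> MSV_ss n w"
    then have dom: "rank_dominated n (entry M) (entry w)" by (simp add: MSV_ss_iff)
    have "entry M y z = 0" if "y \<in> {1..n}" "z \<in> {1..n}" for y z
      using dominated_zero_block[OF dom, of n n y z] zero that by blast
    then have "poly_eval (ss_point M) p = poly_eval (\<lambda>x. 0) p"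
      by (intro poly_eval_cong[OF car]) (auto simp: ss_vars_def ss_point_def entry_def)
    then show "poly_eval (ss_point M) p = 0" using p0 by (simp add: poly_eval_zero_point)
  qed
qed

text \<open>The zero matrix belongs to every variety, so a maximal vanishing ideal is the ideal of the
  origin, and all variables vanish at \<open>w\<close>.\<close>

lemma maximal_implies_zero:
  fixes w :: "'k::field mat"
  assumes w: "w \<in> skew_mats n" and max: "maximalideal (vanishing_ideal n (MSV_ss n w)) (poly_ring (ss_vars n))"
    and yz: "y \<in> {1..n}" "z \<in> {1..n}"
  shows "entry w y z = 0"
proof -
  interpret maximalideal "vanishing_ideal n (MSV_ss n w)" "poly_ring (ss_vars n) :: (nat \<times> nat, 'k) mpoly ring" by fact
  let ?Z = "vanishing_ideal n {0\<^sub>m n n :: 'k mat}"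
  have "?Z = vanishing_ideal n (MSV_ss n w) \<or> ?Z = carrier (poly_ring (ss_vars n))"
  proof (rule I_maximal[OF vanishing_ideal_ideal])
    show "vanishing_ideal n (MSV_ss n w) \<subseteq> ?Z"
      by (rule vanishing_ideal_antimono) (use zero_in_MSV_ss in blast)
    show "?Z \<subseteq> carrier (poly_ring (ss_vars n))" unfolding vanishing_ideal_def by blast
  qed
  moreover have "?Z \<noteq> carrier (poly_ring (ss_vars n))"
  proof
    assume "?Z = carrier (poly_ring (ss_vars n))"
    have "1 \<in> ?Z" unfolding \<open>?Z = _\<close> by (rule carrier_1)
    then have "poly_eval (ss_point (0\<^sub>m n n :: 'k mat)) 1 = 0"
      unfolding vanishing_ideal_def by blast
    then show False unfolding poly_eval_1 by simp
  qed
  ultimately have eq: "?Z = vanishing_ideal n (MSV_ss n w)" by blast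
  have "u_entry y z \<in> ?Z"
    unfolding vanishing_ideal_def using yz u_entry_carrier[OF yz]
    by (simp add: poly_eval_u_entry[OF skew_mats_zero yz] entry_zero_mat)
  then have "poly_eval (ss_point w) (u_entry y z) = 0"
    unfolding eq using MSV_ss_self[OF w] unfolding vanishing_ideal_def by blast
  then show ?thesis using poly_eval_u_entry[OF w yz] by simp
qed

lemma maximal_initial_ideal:
  fixes w :: "'k::field mat"
  assumes w: "w \<in> skew_mats n" and max: "maximalideal (vanishing_ideal n (MSV_ss n w)) (poly_ring (ss_vars n))"
  shows "J_ss n w = init_ideal revlex (vanishing_ideal n (MSV_ss n w))"
proof
  interpret vector_space "\<lambda>(c::'k) (p::(nat \<times> nat, 'k) mpoly). const_poly c * p"
    by (rule vector_space_mpoly)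
  show "J_ss n w \<subseteq> init_ideal revlex (vanishing_ideal n (MSV_ss n w))" by (rule J_ss_subset_init)
  have zero: "entry w y z = 0" if "y \<in> {1..n}" "z \<in> {1..n}" for y z
    by (rule maximal_implies_zero[OF w max that])
  have eq: "vanishing_ideal n (MSV_ss n w) = J_ss n w"
    by (rule zero_matrix_ideals_equal[OF w]) (rule zero)
  have sub: "init revlex ` vanishing_ideal n (MSV_ss n w) \<subseteq> J_ss n w"
  proof
    fix g :: "(nat \<times> nat, 'k) mpoly" assume "g \<in> init revlex ` vanishing_ideal n (MSV_ss n w)"
    then obtain f where f: "f \<in> J_ss n w" "g = init revlex f"
      unfolding eq by blast
    show "g \<in> J_ss n w"
    proof (cases "f = 0")
      case True
      then show ?thesis using f by (simp add: init_def)
    next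
      case False
      then obtain m where m: "is_lead f m" using lead_exists by blast
      then have "m \<in> Poly_Mapping.keys f" by (simp add: is_lead_def)
      then show ?thesis unfolding f(2) init_eq_lead[OF m] using f(1)
        by (auto simp: J_ss_iff carrier_poly_ring mon_poly_def)
    qed
  qed
  have "const_poly c * a \<in> J_ss n w" if "a \<in> J_ss n w" for c :: 'k and a
    by (rule ideal_mult[OF J_ss_ideal that]) (simp add: const_poly_def single_in_carrier zero_in_mons)
  then have "subspace (J_ss n w)"
    using ideal_0[OF J_ss_ideal] ideal_add[OF J_ss_ideal] by (intro subspaceI)
  then show "init_ideal revlex (vanishing_ideal n (MSV_ss n w)) \<subseteq> J_ss n w"
    unfolding init_ideal_def using sub by (intro span_minimal)
qed

lemma MSV_ss_corner_rank_cong: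
  assumes "\<And>i j. i \<in> {1..n} \<Longrightarrow> j \<in> {1..n} \<Longrightarrow> corner_rank w i j = corner_rank w' i j"
  shows "MSV_ss n w = MSV_ss n w'" "J_ss n w = J_ss n w'"
proof -
  show "MSV_ss n w = MSV_ss n w'" using assms by (simp add: MSV_ss_def)
  have "excess_chain n w D \<longleftrightarrow> excess_chain n w' D" for D
    unfolding excess_chain_def using assms by (intro bex_cong refl) simp
  then show "J_ss n w = J_ss n w'" unfolding set_eq_iff J_ss_iff by simp
qed

text \<open>The vanishing ideal determines all corner ranks, and \<open>J_ss\<close> depends on nothing
  else.\<close>

lemma vanishing_ideal_determines_J:
  assumes "w \<in> skew_mats n" "w' \<in> skew_mats n"
    "vanishing_ideal n (MSV_ss n w) = vanishing_ideal n (MSV_ss n w')"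
  shows "J_ss n w = J_ss n w'"
proof (rule MSV_ss_corner_rank_cong(2))
  fix i j assume "i \<in> {1..n}" "j \<in> {1..n}"
  then show "corner_rank w i j = corner_rank w' i j"
    using vanishing_ideal_rank_le[OF assms(1,2)] vanishing_ideal_rank_le[OF assms(2,1)] assms(3)
    by (intro antisym) auto
qed

lemma corner_rank_le_columns: "corner_rank (w :: 'k::field mat) i j \<le> j"
  unfolding corner_rank_le_iff
  by (rule factors_through_index_set[of "{1..j}" _ _ _ _ "entry w" "\<lambda>l z. if l = z then 1 else 0"])
    (auto simp: if_distrib cong: if_cong)

text \<open>Both ideals depend only on the table of corner ranks, which has finitely many possible values.\<close>

lemma finite_ss_system: "finite (ss_system n :: ((nat \<times> nat, 'k::field) mpoly set \<times> _) set)"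
proof -
  define tab where "tab w = (\<lambda>(i, j)\<in>{1..n} \<times> {1..n}. corner_rank (w :: 'k mat) i j)" for w
  define pair where "pair w = (vanishing_ideal n (MSV_ss n w), J_ss n (w :: 'k mat))" for w
  have pair_cong: "pair w = pair w'" if "tab w = tab w'" for w w'
  proof -
    have "corner_rank w i j = corner_rank w' i j" if "i \<in> {1..n}" "j \<in> {1..n}" for i j
      using fun_cong[OF \<open>tab w = tab w'\<close>, of "(i, j)"] that by (simp add: tab_def)
    then show ?thesis unfolding pair_def using MSV_ss_corner_rank_cong[of n w w'] by simp
  qed
  have "pair w = pair (inv_into (skew_mats n) tab (tab w))" if "w \<in> skew_mats n" for w
    by (rule pair_cong) (rule f_inv_into_f[symmetric], rule imageI[OF that])
  then have "pair ` skew_mats n \<subseteq> (\<lambda>t. pair (inv_into (skew_mats n) tab t)) ` tab ` skew_mats n" by blast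
  moreover have "tab ` skew_mats n \<subseteq> ({1..n} \<times> {1..n}) \<rightarrow>\<^sub>E {..n}"
  proof (rule image_subsetI)
    fix w :: "'k mat"
    have "corner_rank w i j \<le> n" if "j \<le> n" for i j
      using corner_rank_le_columns[of w i j] that by (rule le_trans)
    then show "tab w \<in> ({1..n} \<times> {1..n}) \<rightarrow>\<^sub>E {..n}"
      unfolding tab_def restrict_PiE_iff by auto
  qed
  moreover have "finite (({1..n} \<times> {1..n}) \<rightarrow>\<^sub>E {..n})" by (intro finite_PiE) auto
  ultimately have "finite ((\<lambda>t. pair (inv_into (skew_mats n) tab t)) ` tab ` skew_mats n)"
    using finite_subset by blast
  then have "finite (pair ` skew_mats n)" using \<open>pair ` skew_mats n \<subseteq> _\<close> by (rule rev_finite_subset)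
  moreover have "ss_system n = pair ` skew_mats n" unfolding ss_system_def pair_def by blast
  ultimately show ?thesis by simp
qed

section \<open>The pivot variable\<close>

text \<open>In a finite field one plus the product of all monic linear polynomials has no root.\<close>

lemma infinite_alg_closed: "infinite (UNIV :: 'k::alg_closed_field set)"
proof
  assume fin: "finite (UNIV :: 'k set)"
  define P where "P = (\<Prod>a\<in>(UNIV :: 'k set). [:- a, 1:])"
  have "degree P = (\<Sum>a\<in>(UNIV :: 'k set). degree [:- a, 1:])"
    unfolding P_def by (rule degree_prod_eq_sum_degree) simp
  then have "degree P = card (UNIV :: 'k set)" by simp
  then have "degree P > 0" using fin by (simp add: card_gt_0_iff)
  then have "degree (P + 1) > 0" by (simp add: degree_add_eq_left)
  then obtain x where "poly (P + 1) x = 0" using alg_closed_imp_poly_has_root by blast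
  moreover have "poly P x = 0"
    unfolding P_def poly_prod using fin by (intro prod_zero) auto
  ultimately show False by simp
qed

text \<open>The pivot lies below the diagonal, because a nonzero entry above the diagonal has its mirror
  image in an earlier column.\<close>

lemma pivot_exists:
  fixes w :: "'k::field mat"
  assumes w: "w \<in> skew_mats n" and nz: "\<not> (\<forall>y\<in>{1..n}. \<forall>z\<in>{1..n}. entry w y z = 0)"
  shows "\<exists>p q. 1 \<le> q \<and> q < p \<and> p \<le> n \<and> entry w p q \<noteq> 0 \<and>
    (\<forall>y\<in>{1..n}. \<forall>z\<in>{1..<q}. entry w y z = 0) \<and> (\<forall>y\<in>{1..<p}. entry w y q = 0)"
proof -
  define col where "col z \<longleftrightarrow> z \<in> {1..n} \<and> (\<exists>y\<in>{1..n}. entry w y z \<noteq> 0)" for z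
  have ex: "\<exists>z. col z" using nz unfolding col_def by blast
  define q where "q = (LEAST z. col z)"
  have q: "col q" unfolding q_def using ex by (rule LeastI_ex)
  have left: "entry w y z = 0" if "y \<in> {1..n}" "z \<in> {1..<q}" for y z
  proof (rule ccontr)
    assume "entry w y z \<noteq> 0"
    then have "col z" using that q unfolding col_def by auto
    then have "q \<le> z" unfolding q_def by (rule Least_le)
    then show False using that(2) by simp
  qed
  define row where "row y \<longleftrightarrow> y \<in> {1..n} \<and> entry w y q \<noteq> 0" for y
  define p where "p = (LEAST y. row y)"
  have "\<exists>y. row y" using q unfolding col_def row_def by blast
  then have p: "row p" unfolding p_def by (rule LeastI_ex)
  have top: "entry w y q = 0" if "y \<in> {1..<p}" for y
  proof (rule ccontr)
    assume "entry w y q \<noteq> 0"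
    then have "row y" using that p unfolding row_def by auto
    then have "p \<le> y" unfolding p_def by (rule Least_le)
    then show False using that by simp
  qed
  have range: "q \<in> {1..n}" "p \<in> {1..n}" "entry w p q \<noteq> 0" using p q unfolding col_def row_def by auto
  have sk: "skew_entries n (entry w)" by (rule skew_mats_entries[OF w])
  have "p \<noteq> q" using sk range unfolding skew_entries_def by metis
  moreover have "\<not> p < q"
  proof
    assume "p < q"
    then have "entry w q p = 0" using left[of q p] range by simp
    moreover have "entry w q p = - entry w p q" using sk range unfolding skew_entries_def by blast
    ultimately show False using range(3) by simp
  qed
  ultimately have "q < p" by simp
  then show ?thesis using range left top
    by (intro exI[of _ p] exI[of _ q] conjI ballI) auto
qed

lemma skew_entriesD1: "skew_entries n m \<Longrightarrow> y \<in> {1..n} \<Longrightarrow> z \<in> {1..n} \<Longrightarrow> m z y = - m y z"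
  unfolding skew_entries_def by blast

lemma skew_entriesD2: "skew_entries n m \<Longrightarrow> y \<in> {1..n} \<Longrightarrow> m y y = 0"
  unfolding skew_entries_def by blast

lemma skew_mats_of_entries:
  assumes "skew_entries n m"
  shows "mat n n (\<lambda>(a, b). m (Suc a) (Suc b)) \<in> skew_mats n"
proof -
  have sk: "m (Suc b) (Suc a) = - m (Suc a) (Suc b)" if "a < n" "b < n" for a b
    by (rule skew_entriesD1[OF assms]) (use that in simp_all)
  have "transpose_mat (mat n n (\<lambda>(a, b). m (Suc a) (Suc b))) = - mat n n (\<lambda>(a, b). m (Suc a) (Suc b))"
  proof (rule eq_matI)
    fix i j assume "i < dim_row (- mat n n (\<lambda>(a, b). m (Suc a) (Suc b)))"
      "j < dim_col (- mat n n (\<lambda>(a, b). m (Suc a) (Suc b)))"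
    then have ij: "i < n" "j < n" by simp_all
    show "transpose_mat (mat n n (\<lambda>(a, b). m (Suc a) (Suc b))) $$ (i, j) =
        (- mat n n (\<lambda>(a, b). m (Suc a) (Suc b))) $$ (i, j)"
      using ij sk[OF ij] by simp
  qed simp_all
  moreover have "m (Suc i) (Suc i) = 0" if "i < n" for i
    by (rule skew_entriesD2[OF assms]) (use that in simp_all)
  ultimately show ?thesis unfolding skew_mats_def by simp
qed

text \<open>If the product with the pivot variable vanishes on the variety, then \<open>g\<close> vanishes
  at the points with nonzero pivot entry. Along each deformation \<open>g\<close> restricts to a
  univariate polynomial, so its vanishing for all \<open>\<epsilon> \<noteq> 0\<close> in an
  infinite field carries over to \<open>\<epsilon> = 0\<close>.\<close>

lemma variable_nonzerodivisor:
  fixes w :: "'k::alg_closed_field mat"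
  assumes w: "w \<in> skew_mats n"
    and qp: "1 \<le> q" "q < p" "p \<le> n"
    and w_left: "\<forall>y\<in>{1..n}. \<forall>z\<in>{1..<q}. entry w y z = 0"
    and w_top: "\<forall>y\<in>{1..<p}. entry w y q = 0" and w_pq: "entry w p q \<noteq> 0"
    and g: "g \<in> carrier (poly_ring (ss_vars n))" "var_poly (p, q) * g \<in> vanishing_ideal n (MSV_ss n w)"
  shows "g \<in> vanishing_ideal n (MSV_ss n w)"
  unfolding vanishing_ideal_def
proof (intro CollectI conjI ballI g(1))
  fix M assume "M \<in> MSV_ss n w"
  then have M: "M \<in> skew_mats n" "rank_dominated n (entry M) (entry w)" unfolding MSV_ss_iff by blast+
  define val_of where "val_of m = poly_eval (\<lambda>(a, b). m a b) g" for m :: "nat \<Rightarrow> nat \<Rightarrow> 'k"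
  have "val_of (entry M) = 0"
  proof (rule dominated_deformation_induct[where Pr = "\<lambda>m. val_of m = 0",
        OF skew_mats_entries[OF M(1)] skew_mats_entries[OF w] M(2) qp])
    fix m assume m: "skew_entries n m" "rank_dominated n m (entry w)" "m p q \<noteq> 0"
    define N where "N = mat n n (\<lambda>(a, b). m (Suc a) (Suc b))"
    have N: "N \<in> skew_mats n" unfolding N_def by (rule skew_mats_of_entries[OF m(1)])
    have eN: "entry N a b = m a b" if "a \<in> {1..n}" "b \<in> {1..n}" for a b
      using that by (cases a; cases b) (auto simp: entry_def N_def)
    have "rank_dominated n (entry N) (entry w)"
      unfolding rank_dominated_def
    proof (intro ballI allI impI)
      fix i j r assume ij: "i \<in> {1..n}" "j \<in> {1..n}" and "factors_through (entry w) {1..i} {1..j} r"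
      then have "factors_through m {1..i} {1..j} r" using m(2) unfolding rank_dominated_def by blast
      moreover have "factors_through (entry N) {1..i} {1..j} r \<longleftrightarrow> factors_through m {1..i} {1..j} r"
        by (rule factors_through_cong) (use eN ij in auto)
      ultimately show "factors_through (entry N) {1..i} {1..j} r" by blast
    qed
    then have "N \<in> MSV_ss n w" using N unfolding MSV_ss_iff by blast
    then have "poly_eval (ss_point N) (var_poly (p, q) * g) = 0"
      using g(2) unfolding vanishing_ideal_def by blast
    moreover have "poly_eval (ss_point N) (var_poly (p, q)) = m p q"
      using eN[of p q] qp by (simp add: poly_eval_var ss_point_def entry_def)
    ultimately have "poly_eval (ss_point N) g = 0" using m(3) by (simp add: poly_eval_mult)
    moreover have "poly_eval (ss_point N) g = val_of m"
      unfolding val_of_def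
    proof (rule poly_eval_cong[OF g(1)])
      fix x assume x: "x \<in> ss_vars n"
      obtain a b where ab: "x = (a, b)" by (cases x)
      have "entry N a b = m a b" using x ab by (intro eN) (auto simp: ss_vars_def)
      then show "ss_point N x = (case x of (a, b) \<Rightarrow> m a b)" by (simp add: ab ss_point_def entry_def)
    qed
    ultimately show "val_of m = 0" by simp
  next
    fix m h assume zero: "\<And>\<epsilon>. \<epsilon> \<noteq> 0 \<Longrightarrow> val_of (\<lambda>y z. m y z + \<epsilon> * h y z) = 0"
    obtain P where P: "\<forall>\<epsilon>. poly P \<epsilon> =
        poly_eval (\<lambda>x. (case x of (a, b) \<Rightarrow> m a b) + \<epsilon> * (case x of (a, b) \<Rightarrow> h a b)) g"
      using poly_eval_line_is_poly by blast
    have val: "poly P \<epsilon> = val_of (\<lambda>y z. m y z + \<epsilon> * h y z)" for \<epsilon>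
      unfolding val_of_def P[rule_format] by (rule arg_cong2[of _ _ _ _ poly_eval]) auto
    have "P = 0"
    proof (rule ccontr)
      assume "P \<noteq> 0"
      then have "finite {x. poly P x = 0}" by (rule poly_roots_finite)
      moreover have "UNIV - {0} \<subseteq> {x. poly P x = 0}" using zero val by auto
      ultimately have "finite (UNIV - {0 :: 'k})" by (rule rev_finite_subset)
      then show False using infinite_alg_closed[where 'k='k] by simp
    qed
    then show "val_of m = 0" using val[of 0] by simp
  qed (use w_left w_top w_pq in blast)+
  moreover have "ss_point M = (\<lambda>(a, b). entry M a b)" by (auto simp: ss_point_def entry_def)
  ultimately show "poly_eval (ss_point M) g = 0" by (simp add: val_of_def)
qed

text \<open>The corner ranks of the chain matrix are the lengths of the longest chains in \<open>D\<close>,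
  and no chain exceeds the ranks of \<open>w\<close>. Only corners with at least as many rows as
  columns occur in the hypothesis; skew-symmetry settles the others.\<close>

lemma chain_matrix_dominated:
  fixes w :: "'k::field mat"
  assumes w: "w \<in> skew_mats n" and D: "D \<subseteq> ss_vars n" and no: "\<not> excess_chain n w D"
  shows "chain_matrix n (sym_pairs D) \<in> MSV_ss n w"
proof -
  let ?E = "sym_pairs D"
  note E = sym_sym_pairs[of D] irrefl_sym_pairs[OF D]
  have half: "chain_rank ?E i j \<le> corner_rank w i j" if "i \<in> {1..n}" "j \<in> {1..i}" for i j
  proof -
    have "\<not> has_chain ?E i j (Suc (corner_rank w i j))" using no that unfolding excess_chain_def by blast
    then show ?thesis unfolding has_chain_iff by simp
  qed
  have sw: "corner_rank w j i \<le> corner_rank w i j" if "i \<in> {1..n}" "j \<in> {1..n}" for i j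
  proof -
    have "factors_through (entry w) {1..i} {1..j} (corner_rank w i j)" using corner_rank_le_iff by blast
    then have "factors_through (entry w) {1..j} {1..i} (corner_rank w i j)"
      using that by (intro factors_through_skew_swap[OF skew_mats_entries[OF w], of "{1..i}" "{1..j}"]) auto
    then show ?thesis unfolding corner_rank_le_iff .
  qed
  have "corner_rank (chain_matrix n ?E :: 'k mat) i j \<le> corner_rank w i j"
    if ij: "i \<in> {1..n}" "j \<in> {1..n}" for i j
  proof -
    have eq: "corner_rank (chain_matrix n ?E :: 'k mat) i j = chain_rank ?E i j"
      by (rule corner_rank_chain_matrix[OF E]) (use ij in auto)
    show ?thesis
    proof (cases "j \<le> i")
      case True
      then show ?thesis unfolding eq using half ij by simp
    next
      case False
      then have "chain_rank ?E j i \<le> corner_rank w j i" using half ij by simp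
      then show ?thesis unfolding eq chain_rank_sym[OF E(1), of i j] using sw[OF ij] by simp
    qed
  qed
  then show ?thesis unfolding MSV_ss_def using chain_matrix_skew[OF E] by blast
qed

text \<open>The longest chains of \<open>D\<close> have exactly the lengths that the chain matrix allows.\<close>

lemma not_in_J_chain_matrix:
  assumes D: "D \<subseteq> ss_vars n"
  shows "\<not> excess_chain n (chain_matrix n (sym_pairs D) :: 'k::field mat) D"
proof
  assume "excess_chain n (chain_matrix n (sym_pairs D) :: 'k mat) D"
  then obtain i j where ij: "i \<in> {1..n}" "j \<in> {1..i}" and
    c: "has_chain (sym_pairs D) i j (Suc (corner_rank (chain_matrix n (sym_pairs D) :: 'k mat) i j))"
    unfolding excess_chain_def by blast
  have "corner_rank (chain_matrix n (sym_pairs D) :: 'k mat) i j = chain_rank (sym_pairs D) i j"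
    by (rule corner_rank_chain_matrix[OF sym_sym_pairs irrefl_sym_pairs[OF D]]) (use ij in auto)
  then show False using c unfolding has_chain_iff by simp
qed

lemma init_mon_poly: "init revlex (mon_poly m :: (nat \<times> nat, 'k::field) mpoly) = mon_poly m"
  by (rule init_eq_lead) (simp add: is_lead_def mon_poly_def)

lemma var_poly_squarefree: "var_poly x = mon_poly (squarefree_mon {x})"
  by (simp add: var_poly_def squarefree_mon_def)

text \<open>Let the monomial \<open>m\<close> satisfy neither alternative, and let \<open>D\<close> be its
  support. The chain matrix of \<open>D\<close> is dominated by \<open>w\<close>, and its entry at
  the pivot vanishes: \<open>w\<close> is zero on all corners strictly inside the pivot corner, so
  the reflected \<open>D\<close> has no position there, and the pivot position itself is not in
  \<open>D\<close>. Thus the chain matrix is one of the matrices \<open>v\<close>, but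
  \<open>m\<close> is not in its monomial ideal.\<close>

lemma J_ss_boundary:
  fixes w :: "'k::field mat"
  assumes w: "w \<in> skew_mats n"
    and qp: "1 \<le> q" "q < p" "p \<le> n"
    and w_left: "\<forall>y\<in>{1..n}. \<forall>z\<in>{1..<q}. entry w y z = 0"
    and w_top: "\<forall>y\<in>{1..<p}. entry w y q = 0"
    and g: "g \<in> carrier (poly_ring (ss_vars n))"
    and all: "\<And>v. v \<in> MSV_ss n w \<Longrightarrow> entry v p q = 0 \<Longrightarrow> g \<in> J_ss n v"
    and m: "m \<in> Poly_Mapping.keys g"
  shows "excess_chain n w (Poly_Mapping.keys m) \<or> (p, q) \<in> Poly_Mapping.keys m"
proof (rule ccontr)
  define D where "D = Poly_Mapping.keys m"
  assume "\<not> ?thesis"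
  then have no: "\<not> excess_chain n w D" "(p, q) \<notin> D" unfolding D_def by blast+
  have D: "D \<subseteq> ss_vars n" using g m by (auto simp: D_def carrier_poly_ring mons_def)
  define v where "v = (chain_matrix n (sym_pairs D) :: 'k mat)"
  have v: "v \<in> MSV_ss n w" unfolding v_def by (rule chain_matrix_dominated[OF w D no(1)])
  have range: "p \<in> {1..n}" "q \<in> {1..n}" using qp by auto
  have rk: "corner_rank v a b = chain_rank (sym_pairs D) a b" if "a \<in> {1..p}" "b \<in> {1..q}" for a b
    unfolding v_def by (rule corner_rank_chain_matrix[OF sym_sym_pairs irrefl_sym_pairs[OF D]])
      (use that qp in auto)
  have small: "(a, b) \<notin> sym_pairs D" if "a \<in> {1..p}" "b \<in> {1..q}" for a b
  proof
    assume ab: "(a, b) \<in> sym_pairs D"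
    \<comment> \<open>A position of \<open>D\<close> inside the pivot corner would be a chain of length one in a corner where \<open>w\<close> vanishes.\<close>
    have "\<not> (a = p \<and> b = q)" using ab no(2) D qp unfolding sym_pairs_def ss_vars_def by auto
    then have zero: "entry w y z = 0" if "y \<in> {1..a}" "z \<in> {1..b}" for y z
      using that \<open>a \<in> {1..p}\<close> \<open>b \<in> {1..q}\<close> w_left w_top qp
      by (cases "z = q") auto
    have "corner_rank w a b = 0" unfolding corner_rank_0_iff using zero by blast
    moreover have "chain_rank (sym_pairs D) a b \<le> corner_rank w a b"
    proof -
      have "corner_rank v a b \<le> corner_rank w a b"
        using v that qp unfolding MSV_ss_def by auto
      then show ?thesis
        unfolding rk[OF that] .
    qed
    moreover have "strict_chain (sym_pairs D) a b 1 (\<lambda>_. a) (\<lambda>_. b)"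
      using ab that by (simp add: strict_chain_def)
    then have "1 \<le> chain_rank (sym_pairs D) a b" using has_chainI has_chain_iff by blast
    ultimately show False by simp
  qed
  have "\<not> has_chain (sym_pairs D) p q 1"
  proof
    assume "has_chain (sym_pairs D) p q 1"
    then obtain a b where c: "strict_chain (sym_pairs D) p q 1 a b" unfolding has_chain_def by blast
    show False using strict_chainD(1-3)[OF c, of 0] small[of "a 0" "b 0"] by simp
  qed
  then have "corner_rank v p q = 0"
    using rk[of p q] qp by (simp add: has_chain_iff)
  then have "entry v p q = 0" unfolding corner_rank_0_iff using qp by simp
  then have "g \<in> J_ss n v" by (rule all[OF v])
  then have "excess_chain n v D" using m unfolding J_ss_iff D_def by blast
  then show False using not_in_J_chain_matrix[OF D] unfolding v_def by blast
qed

section \<open>The transition at a pivot\<close>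

lemma genideal_var:
  assumes "x \<in> X"
  shows "p \<in> Idl\<^bsub>poly_ring X\<^esub> {var_poly x :: ('x, 'k::field) mpoly} \<longleftrightarrow>
    p \<in> carrier (poly_ring X) \<and> (\<forall>m\<in>Poly_Mapping.keys p. x \<in> Poly_Mapping.keys m)"
proof -
  have mem: "squarefree_mon {x} \<in> mons X" using assms by (simp add: mons_def keys_squarefree_mon)
  then have N: "squarefree_mon ` {{x}} \<subseteq> mons X" by simp
  have sub: "monomial_multiples X (squarefree_mon ` {{x}}) \<subseteq> mons X"
    using mem add_in_mons unfolding monomial_multiples_def by auto
  have mult: "m \<in> monomial_multiples X (squarefree_mon ` {{x}}) \<longleftrightarrow> m \<in> mons X \<and> x \<in> Poly_Mapping.keys m" for m
  proof -
    have "m \<in> monomial_multiples X (squarefree_mon ` {{x}}) \<longleftrightarrow>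
        m \<in> monomial_multiples X (squarefree_mon ` {{x}}) \<inter> mons X" using sub by blast
    also have "\<dots> \<longleftrightarrow> m \<in> mons X \<and> (\<exists>E\<in>{{x}}. E \<subseteq> Poly_Mapping.keys m)"
      by (rule monomial_multiples_squarefree) simp
    finally show ?thesis by simp
  qed
  have "{var_poly x :: ('x, 'k) mpoly} = mon_poly ` squarefree_mon ` {{x}}" by (simp add: var_poly_squarefree)
  then have "p \<in> Idl\<^bsub>poly_ring X\<^esub> {var_poly x} \<longleftrightarrow>
      Poly_Mapping.keys p \<subseteq> monomial_multiples X (squarefree_mon ` {{x}})"
    using genideal_monomials[OF N, where 'k = 'k] by (metis mem_Collect_eq)
  then show ?thesis unfolding carrier_poly_ring subset_iff mult by blast
qed

lemma poly_set_add: "A <+>\<^bsub>poly_ring X\<^esub> B = {a + b | a b. a \<in> A \<and> b \<in> B}"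
  by (auto simp: AbelCoset.set_add_defs set_mult_def poly_ring_def)

text \<open>The polynomial \<open>f\<close> is the variable of the pivot position, and \<open>\<Phi>\<close>
  consists of the pairs of all \<open>v\<close> in the variety of \<open>w\<close> whose pivot
  entry vanishes. Such \<open>v\<close> are zero on the whole pivot corner, hence so are all
  matrices in their varieties, and the ideals of the pairs contain \<open>f\<close>. The reverse
  inclusion on the monomial side is \<open>J_ss_boundary\<close>. As \<open>f\<close> is a
  nonzerodivisor modulo the vanishing ideal, the colon ideal is nothing new.\<close>

lemma ss_transition_step:
  fixes w :: "'k::alg_closed_field mat" and n :: nat
  defines "I \<equiv> vanishing_ideal n (MSV_ss n w)" and "R \<equiv> poly_ring (ss_vars n) :: (nat \<times> nat, 'k) mpoly ring"
  assumes w: "w \<in> skew_mats n" and ne: "I \<noteq> J_ss n w"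
  shows "\<exists>f \<Phi>. f \<in> carrier R \<and> (\<nexists>c. f = const_poly c) \<and> f \<notin> I \<and>
    \<Phi> \<noteq> {} \<and> finite \<Phi> \<and> \<Phi> \<subseteq> ss_system n \<and>
    I <+>\<^bsub>R\<^esub> Idl\<^bsub>R\<^esub> {f} \<subseteq> (\<Inter>(P, Q)\<in>\<Phi>. P) \<and>
    J_ss n w <+>\<^bsub>R\<^esub> Idl\<^bsub>R\<^esub> {init revlex f} = (\<Inter>(P, Q)\<in>\<Phi>. Q) \<and>
    colon_ideal (ss_vars n) I f = I"
proof -
  have "\<not> (\<forall>y\<in>{1..n}. \<forall>z\<in>{1..n}. entry w y z = 0)"
    using ne zero_matrix_ideals_equal[OF w] unfolding I_def by blast
  from pivot_exists[OF w this] obtain p q where qp: "1 \<le> q" "q < p" "p \<le> n"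
    and pq: "entry w p q \<noteq> 0"
    and left: "\<forall>y\<in>{1..n}. \<forall>z\<in>{1..<q}. entry w y z = 0" and top: "\<forall>y\<in>{1..<p}. entry w y q = 0"
    by (elim exE conjE)
  have var: "(p, q) \<in> ss_vars n" using qp by (simp add: ss_vars_def)
  define f where "f = (var_poly (p, q) :: (nat \<times> nat, 'k) mpoly)"
  define V where "V = {v \<in> MSV_ss n w. entry v p q = 0}"
  define \<Phi> where "\<Phi> = (\<lambda>v. (vanishing_ideal n (MSV_ss n v), J_ss n v)) ` V"
  have f_eval: "poly_eval (ss_point M) f = entry M p q" for M
    by (simp add: f_def poly_eval_var ss_point_def entry_def)
  have f: "f \<in> carrier R"
    unfolding f_def R_def var_poly_def mon_poly_def
    by (rule single_in_carrier) (use var in \<open>simp add: mons_def\<close>)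
  have nonconst: "\<nexists>c. f = const_poly c"
  proof
    assume "\<exists>c. f = const_poly c"
    then obtain c where "f = const_poly c" by (elim exE)
    then have "Poly_Mapping.keys f \<subseteq> {0}" by (simp add: const_poly_def)
    moreover have "Poly_Mapping.keys f = {Poly_Mapping.single (p, q) 1}"
      by (simp add: f_def var_poly_def mon_poly_def)
    ultimately have "Poly_Mapping.single (p, q) (1::nat) = 0" by simp
    then have "Poly_Mapping.keys (Poly_Mapping.single (p, q) (1::nat)) = {}" by (simp only: keys_zero)
    then show False by simp
  qed
  have notin: "f \<notin> I"
  proof
    assume "f \<in> I"
    then have "poly_eval (ss_point w) f = 0" using MSV_ss_self[OF w] unfolding I_def vanishing_ideal_def by blast
    then show False using pq f_eval by simp
  qed
  have skew: "v \<in> skew_mats n" and sub: "MSV_ss n v \<subseteq> MSV_ss n w"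
    and le: "\<And>i j. i \<in> {1..n} \<Longrightarrow> j \<in> {1..n} \<Longrightarrow> corner_rank v i j \<le> corner_rank w i j"
    and rk: "corner_rank v p q = 0" if v: "v \<in> V" for v
  proof -
    show "v \<in> skew_mats n" using v unfolding V_def MSV_ss_def by blast
    show le: "corner_rank v i j \<le> corner_rank w i j" if "i \<in> {1..n}" "j \<in> {1..n}" for i j
      using v that unfolding V_def MSV_ss_def by blast
    show "MSV_ss n v \<subseteq> MSV_ss n w"
    proof
      fix M assume M: "M \<in> MSV_ss n v"
      have "corner_rank M i j \<le> corner_rank w i j" if "i \<in> {1..n}" "j \<in> {1..n}" for i j
        using M that by (intro order_trans[OF _ le[OF that]]) (simp add: MSV_ss_def)
      then show "M \<in> MSV_ss n w" using M by (simp add: MSV_ss_def)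
    qed
    have zero: "entry v y z = 0" if "y \<in> {1..p}" "z \<in> {1..q}" for y z
    proof (cases "y = p \<and> z = q")
      case True
      then show ?thesis using v by (simp add: V_def)
    next
      case False
      have "corner_rank w y z = 0"
        unfolding corner_rank_0_iff
      proof (intro ballI)
        fix y' z' assume yz': "y' \<in> {1..y}" "z' \<in> {1..z}"
        show "entry w y' z' = 0"
        proof (cases "z' = q")
          case True
          then have "y' \<in> {1..<p}" using yz' that False by auto
          then show ?thesis using top True by blast
        next
          case 2: False
          then have "z' \<in> {1..<q}" "y' \<in> {1..n}" using yz' that qp by auto
          then show ?thesis using left by blast
        qed
      qed
      then have "corner_rank v y z = 0" using le[of y z] that qp by auto
      then show ?thesis unfolding corner_rank_0_iff using that by auto
    qed
    show "corner_rank v p q = 0" unfolding corner_rank_0_iff using zero by blast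
  qed
  have "entry (0\<^sub>m n n :: 'k mat) p q = 0" by (rule entry_zero_mat) (use qp in auto)
  then have zero_V: "0\<^sub>m n n \<in> V" unfolding V_def using zero_in_MSV_ss by blast
  from zero_V have nonempty: "\<Phi> \<noteq> {}" by (auto simp: \<Phi>_def)
  have system: "\<Phi> \<subseteq> ss_system n" unfolding \<Phi>_def ss_system_def using skew by blast
  then have fin: "finite \<Phi>" using finite_ss_system by (rule finite_subset)
  have cont: "I <+>\<^bsub>R\<^esub> Idl\<^bsub>R\<^esub> {f} \<subseteq> vanishing_ideal n (MSV_ss n v)" if v: "v \<in> V" for v
  proof -
    let ?P = "vanishing_ideal n (MSV_ss n v)"
    interpret cring "poly_ring (ss_vars n) :: (nat \<times> nat, 'k) mpoly ring" by (rule cring_poly_ring)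
    have "poly_eval (ss_point M) f = 0" if M: "M \<in> MSV_ss n v" for M
    proof -
      have "corner_rank M p q \<le> corner_rank v p q" using M qp unfolding MSV_ss_def by auto
      then have "corner_rank M p q = 0" using rk[OF v] by simp
      then show ?thesis unfolding f_eval corner_rank_0_iff using qp by simp
    qed
    then have "f \<in> ?P" using f unfolding R_def vanishing_ideal_def by blast
    then have "Idl\<^bsub>R\<^esub> {f} \<subseteq> ?P"
      unfolding R_def by (intro genideal_minimal[OF vanishing_ideal_ideal]) simp
    moreover have "I \<subseteq> ?P" unfolding I_def by (rule vanishing_ideal_antimono[OF sub[OF v]])
    ultimately show ?thesis
      unfolding R_def poly_set_add using ideal_add[OF vanishing_ideal_ideal] by blast
  qed
  have init: "init revlex f = f" unfolding f_def var_poly_squarefree by (rule init_mon_poly)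
  have f_iff: "a \<in> Idl\<^bsub>R\<^esub> {f} \<longleftrightarrow> a \<in> carrier R \<and> (\<forall>m\<in>Poly_Mapping.keys a. (p, q) \<in> Poly_Mapping.keys m)" for a
    unfolding f_def R_def by (rule genideal_var[OF var])
  have boundary: "J_ss n w <+>\<^bsub>R\<^esub> Idl\<^bsub>R\<^esub> {f} = (\<Inter>v\<in>V. J_ss n v)"
  proof (intro equalityI subsetI INT_I)
    fix g v assume "g \<in> J_ss n w <+>\<^bsub>R\<^esub> Idl\<^bsub>R\<^esub> {f}" and v: "v \<in> V"
    then obtain a b where ab: "g = a + b" "a \<in> J_ss n w" "b \<in> Idl\<^bsub>R\<^esub> {f}"
      unfolding R_def poly_set_add by blast
    have "a \<in> J_ss n v"
      unfolding J_ss_iff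
    proof (intro conjI ballI)
      show "a \<in> carrier (poly_ring (ss_vars n))" using ab(2) unfolding J_ss_iff by blast
      fix m assume "m \<in> Poly_Mapping.keys a"
      then have "excess_chain n w (Poly_Mapping.keys m)" using ab(2) unfolding J_ss_iff by blast
      then show "excess_chain n v (Poly_Mapping.keys m)"
        by (rule excess_chain_mono) (use le[OF v] in simp_all)
    qed
    moreover have "b \<in> J_ss n v"
      unfolding J_ss_iff
    proof (intro conjI ballI)
      show "b \<in> carrier (poly_ring (ss_vars n))" using iffD1[OF f_iff ab(3)] unfolding R_def by blast
      fix m assume "m \<in> Poly_Mapping.keys b"
      then have "{(p, q)} \<subseteq> Poly_Mapping.keys m" using iffD1[OF f_iff ab(3)] unfolding R_def by blast
      then show "excess_chain n v (Poly_Mapping.keys m)"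
        by (rule excess_chain_mono[OF excess_chain_singleton[OF var rk[OF v]]]) simp
    qed
    ultimately show "g \<in> J_ss n v" unfolding ab(1) by (rule ideal_add[OF J_ss_ideal])
  next
    fix g assume g: "g \<in> (\<Inter>v\<in>V. J_ss n v)"
    then have "g \<in> J_ss n (0\<^sub>m n n :: 'k mat)" using zero_V by (rule INT_D)
    then have car: "g \<in> carrier (poly_ring (ss_vars n))" unfolding J_ss_iff by (rule conjunct1)
    have mons: "m \<in> mons (ss_vars n)" if "m \<in> Poly_Mapping.keys g" for m
      using car that unfolding carrier_poly_ring by blast
    have split: "excess_chain n w (Poly_Mapping.keys m) \<or> (p, q) \<in> Poly_Mapping.keys m"
      if m: "m \<in> Poly_Mapping.keys g" for m
    proof (rule J_ss_boundary[OF w qp left top car _ m])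
      fix v assume "v \<in> MSV_ss n w" "entry v p q = 0"
      then show "g \<in> J_ss n v" using g unfolding V_def by blast
    qed
    define part where "part A = (\<Sum>m\<in>A. Poly_Mapping.single m (Poly_Mapping.lookup g m))" for A
    define K where "K = {m \<in> Poly_Mapping.keys g. excess_chain n w (Poly_Mapping.keys m)}"
    have K: "K \<subseteq> Poly_Mapping.keys g" by (auto simp: K_def)
    have keys_part: "Poly_Mapping.keys (part A) \<subseteq> A" if "A \<subseteq> Poly_Mapping.keys g" for A
    proof -
      have "Poly_Mapping.lookup (part A) m = 0" if "m \<notin> A" for m
        unfolding part_def lookup_sum using that
        by (intro sum.neutral) (auto simp: lookup_single when_def)
      then show ?thesis by (auto simp: in_keys_iff)
    qed
    have car_part: "part A \<in> carrier (poly_ring (ss_vars n))" if "A \<subseteq> Poly_Mapping.keys g" for A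
      unfolding part_def by (intro carrier_sum single_in_carrier mons) (use that in blast)
    have "g = part (Poly_Mapping.keys g)" unfolding part_def by (rule sum_of_terms)
    also have "\<dots> = part (Poly_Mapping.keys g - K) + part K"
      unfolding part_def by (rule sum.subset_diff[OF K]) simp
    finally have "g = part K + part (Poly_Mapping.keys g - K)" by (simp add: add.commute)
    moreover have "part K \<in> J_ss n w"
      unfolding J_ss_iff using car_part[OF K] keys_part[OF K] unfolding K_def by blast
    moreover have "part (Poly_Mapping.keys g - K) \<in> Idl\<^bsub>R\<^esub> {f}"
      unfolding f_iff
    proof (intro conjI ballI)
      have d: "Poly_Mapping.keys g - K \<subseteq> Poly_Mapping.keys g" by blast
      show "part (Poly_Mapping.keys g - K) \<in> carrier R" unfolding R_def by (rule car_part[OF d])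
      fix m assume "m \<in> Poly_Mapping.keys (part (Poly_Mapping.keys g - K))"
      then have "m \<in> Poly_Mapping.keys g - K" using keys_part[OF d] by blast
      then show "(p, q) \<in> Poly_Mapping.keys m" using split[of m] unfolding K_def by blast
    qed
    ultimately show "g \<in> J_ss n w <+>\<^bsub>R\<^esub> Idl\<^bsub>R\<^esub> {f}" unfolding R_def poly_set_add by blast
  qed
  have colon: "colon_ideal (ss_vars n) I f = I"
  proof (intro equalityI subsetI)
    fix g assume "g \<in> colon_ideal (ss_vars n) I f"
    then show "g \<in> I" unfolding colon_ideal_def I_def f_def
      using variable_nonzerodivisor[OF w qp left top pq] by blast
  next
    fix g assume g: "g \<in> I"
    then have "f * g \<in> I" using f unfolding I_def R_def by (intro ideal_mult[OF vanishing_ideal_ideal])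
    then show "g \<in> colon_ideal (ss_vars n) I f"
      using g unfolding colon_ideal_def I_def vanishing_ideal_def by blast
  qed
  have "I <+>\<^bsub>R\<^esub> Idl\<^bsub>R\<^esub> {f} \<subseteq> (\<Inter>(P, Q)\<in>\<Phi>. P)" using cont unfolding \<Phi>_def by auto
  moreover have "J_ss n w <+>\<^bsub>R\<^esub> Idl\<^bsub>R\<^esub> {init revlex f} = (\<Inter>(P, Q)\<in>\<Phi>. Q)"
    unfolding init boundary \<Phi>_def by auto
  ultimately show ?thesis using f nonconst notin nonempty fin system colon by (intro exI[of _ f] exI[of _ \<Phi>] conjI)
qed

theorem theorem5p3:
  fixes n :: nat
  assumes "n > 0"
  shows "finite (ss_system n ::
           ((nat \<times> nat, 'k::alg_closed_field) mpoly set \<times> (nat \<times> nat, 'k) mpoly set) set) \<and>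
         transition_system (ss_vars n) revlex
           (ss_system n :: ((nat \<times> nat, 'k) mpoly set \<times> (nat \<times> nat, 'k) mpoly set) set)"
proof (rule conjI[OF finite_ss_system])
  let ?T = "ss_system n :: ((nat \<times> nat, 'k) mpoly set \<times> (nat \<times> nat, 'k) mpoly set) set"
  have all: "\<forall>(I, J)\<in>?T. Q I J"
    if "\<And>w. w \<in> skew_mats n \<Longrightarrow> Q (vanishing_ideal n (MSV_ss n w)) (J_ss n w)" for Q
  proof (intro ballI, unfold split_paired_all, simp only: case_prod_conv)
    fix I J assume "(I, J) \<in> ?T"
    then obtain w where "w \<in> skew_mats n" "I = vanishing_ideal n (MSV_ss n w)" "J = J_ss n w"
      unfolding ss_system_def by blast
    then show "Q I J" using that by simp
  qed
  show "transition_system (ss_vars n) revlex ?T"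
    unfolding transition_system_def
  proof (intro conjI)
    show "\<forall>(I, J)\<in>?T. proper_ideal (ss_vars n) I \<and> proper_ideal (ss_vars n) J"
      by (rule all) (simp add: vanishing_ideal_proper J_ss_proper)
    show "\<forall>(I, J)\<in>?T. monomial_ideal (ss_vars n) J \<and> J \<subseteq> init_ideal revlex I \<and>
        (maximalideal I (poly_ring (ss_vars n)) \<longrightarrow> J = init_ideal revlex I)"
      by (rule all) (intro conjI impI J_ss_monomial J_ss_subset_init maximal_initial_ideal)
    show "\<forall>(I, J)\<in>?T. \<forall>(I', J')\<in>?T. I = I' \<longrightarrow> J = J'"
      by (rule all, rule all, rule impI) (rule vanishing_ideal_determines_J)
    show "\<forall>(I, J)\<in>?T. \<not> maximalideal I (poly_ring (ss_vars n)) \<longrightarrow> I \<noteq> J \<longrightarrow>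
        (\<exists>f \<Phi>. f \<in> carrier (poly_ring (ss_vars n)) \<and> (\<nexists>c. f = const_poly c) \<and> f \<notin> I \<and>
           \<Phi> \<noteq> {} \<and> finite \<Phi> \<and> \<Phi> \<subseteq> ?T \<and>
           I <+>\<^bsub>poly_ring (ss_vars n)\<^esub> Idl\<^bsub>poly_ring (ss_vars n)\<^esub> {f} \<subseteq> (\<Inter>(P, Q)\<in>\<Phi>. P) \<and>
           J <+>\<^bsub>poly_ring (ss_vars n)\<^esub> Idl\<^bsub>poly_ring (ss_vars n)\<^esub> {init revlex f} = (\<Inter>(P, Q)\<in>\<Phi>. Q) \<and>
           (colon_ideal (ss_vars n) I f \<noteq> I \<longrightarrow>
              (colon_ideal (ss_vars n) I f, colon_ideal (ss_vars n) J (init revlex f)) \<in> ?T))"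
    proof (rule all, intro impI)
      fix w :: "'k mat"
      assume "w \<in> skew_mats n" "vanishing_ideal n (MSV_ss n w) \<noteq> J_ss n w"
      from ss_transition_step[OF this] obtain f \<Phi> where
        *: "f \<in> carrier (poly_ring (ss_vars n))" "\<nexists>c. f = const_poly c"
          "f \<notin> vanishing_ideal n (MSV_ss n w)" "\<Phi> \<noteq> {}" "finite \<Phi>" "\<Phi> \<subseteq> ?T"
          "vanishing_ideal n (MSV_ss n w) <+>\<^bsub>poly_ring (ss_vars n)\<^esub> Idl\<^bsub>poly_ring (ss_vars n)\<^esub> {f} \<subseteq>
            (\<Inter>(P, Q)\<in>\<Phi>. P)"
          "J_ss n w <+>\<^bsub>poly_ring (ss_vars n)\<^esub> Idl\<^bsub>poly_ring (ss_vars n)\<^esub> {init revlex f} =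
            (\<Inter>(P, Q)\<in>\<Phi>. Q)"
        and colon: "colon_ideal (ss_vars n) (vanishing_ideal n (MSV_ss n w)) f =
          vanishing_ideal n (MSV_ss n w)"
        by (elim exE conjE)
      from colon show "\<exists>f \<Phi>. f \<in> carrier (poly_ring (ss_vars n)) \<and> (\<nexists>c. f = const_poly c) \<and>
          f \<notin> vanishing_ideal n (MSV_ss n w) \<and> \<Phi> \<noteq> {} \<and> finite \<Phi> \<and> \<Phi> \<subseteq> ?T \<and>
          vanishing_ideal n (MSV_ss n w) <+>\<^bsub>poly_ring (ss_vars n)\<^esub> Idl\<^bsub>poly_ring (ss_vars n)\<^esub> {f} \<subseteq>
            (\<Inter>(P, Q)\<in>\<Phi>. P) \<and>
          J_ss n w <+>\<^bsub>poly_ring (ss_vars n)\<^esub> Idl\<^bsub>poly_ring (ss_vars n)\<^esub> {init revlex f} =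
            (\<Inter>(P, Q)\<in>\<Phi>. Q) \<and>
          (colon_ideal (ss_vars n) (vanishing_ideal n (MSV_ss n w)) f \<noteq> vanishing_ideal n (MSV_ss n w) \<longrightarrow>
             (colon_ideal (ss_vars n) (vanishing_ideal n (MSV_ss n w)) f,
              colon_ideal (ss_vars n) (J_ss n w) (init revlex f)) \<in> ?T)"
        by (intro exI[of _ f] exI[of _ \<Phi>] conjI *) blast
    qed
  qed
qed

end
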